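(* Let $D$ be a bounded domain in $\mathbb{R}^n$ with smooth boundary, and let $1\leq q\leq n-1$. Suppose that for every function $\varphi$ of the form $$\varphi(x)=a\|x-x_0\|^2-b,\qquad a,b>0,\ x_0\in\mathbb{R}^n,$$ and for every $d$-closed form $f\in\wedge^{q}(\bar D)\cap\mathrm{Dom}(d^*_{\varphi})$, there exists $u\in L^2_{q-1}(D,\varphi)$ with $du=f$ on $D$ and $$\int_D|u|^2e^{-\varphi}\,d\lambda\ \leq\ \int_D\langle \mathrm{Hess}_{\varphi}^{-1}f,f\rangle e^{-\varphi}\,d\lambda\ =\ \frac{1}{2aq}\int_D|f|^2e^{-\varphi}\,d\lambda .$$ Then $D$ is $q$-convex.
   Context: Notation. $\|\cdot\|$ is the Euclidean norm on $\mathbb{R}^n$ and $d\lambda$ is Lebesgue measure. $\wedge^{q}(\bar D)$ is the space of real $q$-forms $\alpha=\sum'_{|I|=q}\alpha_I\,dx_I$ (sum over strictly increasing multi-indices $I$) whose coefficients are smooth up to the boundary; $\alpha_I$ is extended to all multi-indices by skew-symmetry. The pointwise inner product is $\langle\alpha,\beta\rangle=\sum'_I\alpha_I\beta_I$, and $|\alpha|^2=\langle\alpha,\alpha\rangle$. $L^2_{q}(D,\varphi)$ is the Hilbert space of $q$-forms on $D$ with inner product $\int_D\langle\alpha,\beta\rangle e^{-\varphi}d\lambda$. The operator $d:L^2_{q-1}(D,\varphi)\to L^2_{q}(D,\varphi)$ is the closed, densely defined exterior derivative acting in the sense of distributions, and $d^*_\varphi$ is its Hilbert space adjoint, with domain $\mathrm{Dom}(d^*_\varphi)$.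 For $\alpha\in\wedge^{q}(\bar D)$ one has $\alpha\in\mathrm{Dom}(d^*_\varphi)$ if and only if $\sum_{j=1}^n\frac{\partial\rho}{\partial x_j}\alpha_{jK}=0$ on $\partial D$ for all $|K|=q-1$, where $\rho$ is a smooth defining function of $D$ as below (a condition independent of $\varphi$). For a smooth real function $\varphi$, $\mathrm{Hess}_\varphi$ is the symmetric operator on $q$-forms determined by $\langle\mathrm{Hess}_\varphi\alpha,\alpha\rangle=\sum_{i,j}\sum'_{|K|=q-1}\frac{\partial^2\varphi}{\partial x_i\partial x_j}\alpha_{iK}\alpha_{jK}$; for $\varphi=a\|x-x_0\|^2-b$ it is multiplication by $2aq$. $q$-convexity (in the sense of Harvey–Lawson). Let $\rho:\mathbb{R}^n\to\mathbb{R}$ be smooth with $D=\{\rho<0\}$, $\nabla\rho\neq0$ on $\partial D$, normalized so that $|\nabla\rho|=1$ on $\partial D$. The second fundamental form of $\partial D$ at $p\in\partial D$ is the restriction of the quadratic form $\xi\mapsto\sum_{i,j}\frac{\partial^2\rho}{\partial x_i\partial x_j}(p)\xi_i\xi_j$ to $T_p\partial D=\{\xi\in\mathbb{R}^n:\nabla\rho(p)\cdot\xi=0\}$ (sign convention: it is non-negative for convex domains). $D$ is $q$-convex if at every $p\in\partial D$ the sum of any $q$ eigenvalues (counted with multiplicity) of the second fundamental form on $T_p\partial D$ is non-negative. *)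

theory Defs
  imports "HOL-Analysis.Analysis"
begin
section \<open>Smooth functions\<close>

definition partial :: "'n::finite \<Rightarrow> (real ^ 'n \<Rightarrow> real) \<Rightarrow> real ^ 'n \<Rightarrow> real"
  where "partial i g x = frechet_derivative g (at x) (axis i 1)"

definition grad :: "(real ^ 'n::finite \<Rightarrow> real) \<Rightarrow> real ^ 'n \<Rightarrow> real ^ 'n"
  where "grad g x = (\<chi> i. partial i g x)"

text \<open>Meaningful for open \<open>U\<close> only, since derivatives are taken in the whole space.\<close>

primrec Ck_on :: "nat \<Rightarrow> (real ^ 'n::finite) set \<Rightarrow> (real ^ 'n \<Rightarrow> real) \<Rightarrow> bool" where
  "Ck_on 0 U g \<longleftrightarrow> continuous_on U g"
| "Ck_on (Suc k) U g \<longleftrightarrow> (\<forall>x\<in>U. g differentiable (at x)) \<and> (\<forall>i. Ck_on k U (partial i g))"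

definition smooth_on :: "(real ^ 'n::finite) set \<Rightarrow> (real ^ 'n \<Rightarrow> real) \<Rightarrow> bool"
  where "smooth_on U g \<longleftrightarrow> (\<forall>k. Ck_on k U g)"

definition smooth_up_to_boundary :: "(real ^ 'n::finite) set \<Rightarrow> (real ^ 'n \<Rightarrow> real) \<Rightarrow> bool"
  where "smooth_up_to_boundary D g \<longleftrightarrow>
    (\<exists>U h. open U \<and> closure D \<subseteq> U \<and> smooth_on U h \<and> (\<forall>x\<in>closure D. g x = h x))"

definition test_functions :: "(real ^ 'n::finite) set \<Rightarrow> (real ^ 'n \<Rightarrow> real) set"
  where "test_functions D =
    {\<psi>. smooth_on UNIV \<psi> \<and> (\<exists>K. compact K \<and> K \<subseteq> D \<and> (\<forall>x. x \<notin> K \<longrightarrow> \<psi> x = 0))}"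


section \<open>Differential forms\<close>

text \<open>
  A multi-index is a list of coordinate indices. The value of a \<open>q\<close>-form at a point is the family of
  its coefficients over all multi-indices, skew-symmetric on those of length \<open>q\<close> and zero elsewhere.
  The linear order on the index type only serves to single out the increasing multi-indices.
\<close>

type_synonym 'n covector = "'n list \<Rightarrow> real"
type_synonym 'n form = "real ^ 'n \<Rightarrow> 'n covector"

definition covectors :: "nat \<Rightarrow> 'n covector set"
  where "covectors q = {\<omega>. (\<forall>I. length I \<noteq> q \<longrightarrow> \<omega> I = 0) \<and>
    (\<forall>I i j. length I = q \<longrightarrow> i < q \<longrightarrow> j < q \<longrightarrow> i \<noteq> j \<longrightarrow> \<omega> (I[i := I ! j, j := I ! i]) = - \<omega> I)}"

definition incr_indices :: "nat \<Rightarrow> 'n::linorder list set"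
  where "incr_indices q = {I. length I = q \<and> sorted_wrt (<) I}"

definition cov_inner :: "nat \<Rightarrow> 'n::{finite,linorder} covector \<Rightarrow> 'n covector \<Rightarrow> real"
  where "cov_inner q \<omega> \<eta> = (\<Sum>I\<in>incr_indices q. \<omega> I * \<eta> I)"

definition smooth_forms :: "nat \<Rightarrow> (real ^ 'n::{finite,linorder}) set \<Rightarrow> 'n form set"
  where "smooth_forms q D = {\<alpha>. (\<forall>x\<in>closure D. \<alpha> x \<in> covectors q) \<and>
    (\<forall>I\<in>incr_indices q. smooth_up_to_boundary D (\<lambda>x. \<alpha> x I))}"

text \<open>Elements of the \<open>L\<^sup>2\<close> spaces are represented by functions rather than by classes modulo null sets.\<close>

definition L2_forms ::
    "nat \<Rightarrow> (real ^ 'n::{finite,linorder}) set \<Rightarrow> (real ^ 'n::_ \<Rightarrow> real) \<Rightarrow> 'n form set"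
  where "L2_forms q D \<phi> = {\<alpha>. (\<forall>x\<in>D. \<alpha> x \<in> covectors q) \<and>
    (\<forall>I\<in>incr_indices q. set_borel_measurable lebesgue D (\<lambda>x. \<alpha> x I)) \<and>
    set_integrable lebesgue D (\<lambda>x. cov_inner q (\<alpha> x) (\<alpha> x) * exp (- \<phi> x))}"

definition L2_inner ::
    "nat \<Rightarrow> (real ^ 'n::{finite,linorder}) set \<Rightarrow> (real ^ 'n::_ \<Rightarrow> real) \<Rightarrow> 'n form \<Rightarrow> 'n form \<Rightarrow> real"
  where "L2_inner q D \<phi> \<alpha> \<beta> = (LINT x:D|lebesgue. cov_inner q (\<alpha> x) (\<beta> x) * exp (- \<phi> x))"


section \<open>The exterior derivative and its Hilbert space adjoint\<close>

text \<open>
  For \<open>q \<ge> 1\<close>, \<open>ext_d q D \<phi> u f\<close> says that \<open>u\<close> is in the domain of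
  \<open>d : L\<^sup>2\<^sub>q\<^sub>-\<^sub>1(D,\<phi>) \<rightarrow> L\<^sup>2\<^sub>q(D,\<phi>)\<close> and \<open>du = f\<close>. The last conjunct is the distributional form of
  \<open>(du)\<^sub>J = \<Sum>\<^sub>k (-1)\<^sup>k \<partial>u\<^sub>J\<^sub>' / \<partial>x\<^sub>j\<close>, where \<open>j\<close> is the entry of \<open>J\<close> at position \<open>k\<close>
  (counted from 0) and \<open>J'\<close> is \<open>J\<close> without it.
\<close>

definition ext_d ::
    "nat \<Rightarrow> (real ^ 'n::{finite,linorder}) set \<Rightarrow> (real ^ 'n::_ \<Rightarrow> real) \<Rightarrow> 'n form \<Rightarrow> 'n form \<Rightarrow> bool"
  where "ext_d q D \<phi> u f \<longleftrightarrow> u \<in> L2_forms (q - 1) D \<phi> \<and> f \<in> L2_forms q D \<phi> \<and>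
    (\<forall>J\<in>incr_indices q. \<forall>\<psi>\<in>test_functions D.
      (LINT x:D|lebesgue. f x J * \<psi> x) =
      - (\<Sum>k<q. (-1) ^ k *
          (LINT x:D|lebesgue. u x (take k J @ drop (Suc k) J) * partial (J ! k) \<psi> x)))"

definition dom_d_adj ::
    "nat \<Rightarrow> (real ^ 'n::{finite,linorder}) set \<Rightarrow> (real ^ 'n::_ \<Rightarrow> real) \<Rightarrow> 'n form set"
  where "dom_d_adj q D \<phi> = {\<alpha> \<in> L2_forms q D \<phi>. \<exists>\<beta>\<in>L2_forms (q - 1) D \<phi>.
    \<forall>u v. ext_d q D \<phi> u v \<longrightarrow> L2_inner q D \<phi> v \<alpha> = L2_inner (q - 1) D \<phi> u \<beta>}"


section \<open>The Hessian acting on forms\<close>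

definition hess_form ::
    "nat \<Rightarrow> (real ^ 'n::{finite,linorder} \<Rightarrow> real) \<Rightarrow> real ^ 'n::_ \<Rightarrow> 'n covector \<Rightarrow> 'n covector \<Rightarrow> real"
  where "hess_form q \<phi> x \<omega> \<eta> =
    (\<Sum>i\<in>UNIV. \<Sum>j\<in>UNIV. \<Sum>K\<in>incr_indices (q - 1). partial i (partial j \<phi>) x * \<omega> (i # K) * \<eta> (j # K))"

text \<open>The symmetric operator determined by the quadratic form \<open>\<omega> \<mapsto> hess_form q \<phi> x \<omega> \<omega>\<close>,
  through its polarization.\<close>

definition hess_op ::
    "nat \<Rightarrow> (real ^ 'n::{finite,linorder} \<Rightarrow> real) \<Rightarrow> real ^ 'n::_ \<Rightarrow> 'n covector \<Rightarrow> 'n covector"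
  where "hess_op q \<phi> x \<omega> =
    (THE \<theta>. \<theta> \<in> covectors q \<and> (\<forall>\<eta>\<in>covectors q. cov_inner q \<theta> \<eta> = hess_form q \<phi> x \<omega> \<eta>))"

definition hess_inv ::
    "nat \<Rightarrow> (real ^ 'n::{finite,linorder} \<Rightarrow> real) \<Rightarrow> real ^ 'n::_ \<Rightarrow> 'n covector \<Rightarrow> 'n covector"
  where "hess_inv q \<phi> x = inv_into (covectors q) (hess_op q \<phi> x)"


section \<open>Domains with smooth boundary and \<open>q\<close>-convexity\<close>

definition defining_function :: "(real ^ 'n::finite) set \<Rightarrow> (real ^ 'n \<Rightarrow> real) \<Rightarrow> bool"
  where "defining_function D \<rho> \<longleftrightarrow>
    smooth_on UNIV \<rho> \<and> D = {x. \<rho> x < 0} \<and> (\<forall>p\<in>frontier D. norm (grad \<rho> p) = 1)"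

definition smooth_bounded_domain :: "(real ^ 'n::finite) set \<Rightarrow> bool"
  where "smooth_bounded_domain D \<longleftrightarrow>
    open D \<and> connected D \<and> D \<noteq> {} \<and> bounded D \<and> (\<exists>\<rho>. defining_function D \<rho>)"

definition tangent_space :: "(real ^ 'n::finite \<Rightarrow> real) \<Rightarrow> real ^ 'n \<Rightarrow> (real ^ 'n) set"
  where "tangent_space \<rho> p = {\<xi>. grad \<rho> p \<bullet> \<xi> = 0}"

definition second_fund_form ::
    "(real ^ 'n::finite \<Rightarrow> real) \<Rightarrow> real ^ 'n \<Rightarrow> real ^ 'n \<Rightarrow> real ^ 'n \<Rightarrow> real"
  where "second_fund_form \<rho> p \<xi> \<eta> =
    (\<Sum>i\<in>UNIV. \<Sum>j\<in>UNIV. partial i (partial j \<rho>) p * \<xi> $ i * \<eta> $ j)"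

definition sff_eigenspace :: "(real ^ 'n::finite \<Rightarrow> real) \<Rightarrow> real ^ 'n \<Rightarrow> real \<Rightarrow> (real ^ 'n) set"
  where "sff_eigenspace \<rho> p \<mu> =
    {\<xi> \<in> tangent_space \<rho> p. \<forall>\<eta>\<in>tangent_space \<rho> p. second_fund_form \<rho> p \<xi> \<eta> = \<mu> * (\<xi> \<bullet> \<eta>)}"

text \<open>A choice of \<open>q\<close> eigenvalues counted with multiplicity is a multiset of size \<open>q\<close> in which no
  number occurs more often than the dimension of its eigenspace.\<close>

definition q_convex :: "nat \<Rightarrow> (real ^ 'n::finite) set \<Rightarrow> bool"
  where "q_convex q D \<longleftrightarrow> (\<forall>\<rho>. defining_function D \<rho> \<longrightarrow> (\<forall>p\<in>frontier D. \<forall>M :: real multiset.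
    size M = q \<and> (\<forall>\<mu>. count M \<mu> \<le> dim (sff_eigenspace \<rho> p \<mu>)) \<longrightarrow> 0 \<le> \<Sum>\<^sub># M))"


section \<open>The Hessian of \<open>a \<parallel>x - x\<^sub>0\<parallel>\<^sup>2 - b\<close> is multiplication by \<open>2aq\<close>\<close>

lemma covector_swap_adjacent:
  assumes "\<omega> \<in> covectors q" "length P + length K + 2 = q"
  shows "\<omega> (P @ y # x # K) = - \<omega> (P @ x # y # K)"
proof -
  let ?I = "P @ x # y # K"
  have H: "\<And>I i j. length I = q \<Longrightarrow> i < q \<Longrightarrow> j < q \<Longrightarrow> i \<noteq> j \<Longrightarrow>
      \<omega> (I[i := I ! j, j := I ! i]) = - \<omega> I"
    using assms(1) by (simp add: covectors_def)
  have "\<omega> (?I[length P := ?I ! Suc (length P), Suc (length P) := ?I ! length P]) = - \<omega> ?I"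
    using H[of ?I "length P" "Suc (length P)"] assms(2) by simp
  moreover have "?I[length P := ?I ! Suc (length P), Suc (length P) := ?I ! length P] = P @ y # x # K"
    by (simp add: nth_append list_update_append)
  ultimately show ?thesis by simp
qed

lemma covector_insort:
  fixes x :: "'n::linorder"
  shows "\<exists>s\<in>{1,-1::real}. \<forall>\<omega>\<in>covectors (length P + length K + 1).
    \<omega> (P @ insort x K) = s * \<omega> (P @ x # K)"
proof (induction K arbitrary: P)
  case Nil
  then show ?case by (intro bexI[of _ 1]) auto
next
  case (Cons y K)
  show ?case
  proof (cases "x \<le> y")
    case True
    then show ?thesis by (intro bexI[of _ 1]) auto
  next
    case False
    obtain s where s: "s \<in> {1,-1::real}"
      "\<forall>\<omega>\<in>covectors (length (P @ [y]) + length K + 1).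
         \<omega> ((P @ [y]) @ insort x K) = s * \<omega> ((P @ [y]) @ x # K)"
      using Cons.IH[of "P @ [y]"] by blast
    have "\<omega> (P @ insort x (y # K)) = (- s) * \<omega> (P @ x # y # K)"
      if "\<omega> \<in> covectors (length P + length (y # K) + 1)" for \<omega>
      using s(2) that False covector_swap_adjacent[OF that, of P K y x] by auto
    moreover have "- s \<in> {1,-1}" using s(1) by auto
    ultimately show ?thesis by blast
  qed
qed

lemma covector_sort:
  fixes L :: "'n::linorder list"
  assumes "\<omega> \<in> covectors (length P + length L)" "\<omega> (P @ sort L) = 0"
  shows "\<omega> (P @ L) = 0"
  using assms
proof (induction L arbitrary: P)
  case (Cons x L)
  obtain s where "s \<in> {1,-1::real}" "\<omega> (P @ insort x (sort L)) = s * \<omega> (P @ x # sort L)"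
    using covector_insort[of P "sort L" x] Cons.prems(1) by (simp del: bex_simps) blast
  then have "\<omega> ((P @ [x]) @ sort L) = 0"
    using Cons.prems(2) by auto
  then show ?case
    using Cons.IH[of "P @ [x]"] Cons.prems(1) by auto
qed simp

lemma covector_not_distinct:
  assumes "\<omega> \<in> covectors q" "\<not> distinct L"
  shows "\<omega> L = 0"
proof (cases "length L = q")
  case True
  obtain i j where ij: "i < q" "j < q" "i \<noteq> j" "L ! i = L ! j"
    using assms(2) True by (auto simp: distinct_conv_nth)
  then have "L[i := L ! j, j := L ! i] = L"
    by (metis list_update_id)
  then show ?thesis
    using assms(1) True ij unfolding covectors_def
    by (smt (verit, ccfv_threshold) mem_Collect_eq)
next
  case False
  then show ?thesis using assms(1) by (auto simp: covectors_def)
qed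

lemma covectors_diff:
  assumes "\<omega> \<in> covectors q" "\<eta> \<in> covectors q"
  shows "(\<lambda>I. \<omega> I - \<eta> I) \<in> covectors q"
  using assms by (auto simp: covectors_def)

lemma covectors_scale:
  assumes "\<omega> \<in> covectors q"
  shows "(\<lambda>I. c * \<omega> I) \<in> covectors q"
  using assms by (auto simp: covectors_def)

lemma finite_incr_indices [simp]: "finite (incr_indices q :: 'n::{finite,linorder} list set)"
  by (rule finite_subset[OF _ finite_lists_length_eq[of UNIV q]]) (auto simp: incr_indices_def)

lemma covector_eq_zero:
  fixes \<omega> :: "'n::{finite,linorder} covector"
  assumes "\<omega> \<in> covectors q" "cov_inner q \<omega> \<omega> = 0"
  shows "\<omega> L = 0"
proof (cases "length L = q \<and> distinct L")
  case True
  have "\<forall>I\<in>incr_indices q. \<omega> I * \<omega> I = 0"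
    using assms(2) unfolding cov_inner_def
    by (subst (asm) sum_nonneg_eq_0_iff) auto
  moreover have "sort L \<in> incr_indices q"
    using True by (auto simp: incr_indices_def strict_sorted_iff)
  ultimately have "\<omega> ([] @ sort L) = 0" by auto
  then show ?thesis
    using covector_sort[of \<omega> "[]" L] assms(1) True by auto
next
  case False
  then show ?thesis
    using covector_not_distinct[OF assms(1)] assms(1) by (auto simp: covectors_def)
qed

lemma sum_covectors_Cons:
  fixes \<omega> \<eta> :: "'n::{finite,linorder} covector"
  assumes "\<omega> \<in> covectors q" "\<eta> \<in> covectors q" "1 \<le> q"
  shows "(\<Sum>K\<in>incr_indices (q - 1). \<Sum>i\<in>UNIV. \<omega> (i # K) * \<eta> (i # K)) = real q * cov_inner q \<omega> \<eta>"
proof -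
  let ?g = "\<lambda>I. \<omega> I * \<eta> I"
  have ins: "?g (insort i K) = ?g (i # K)" if "K \<in> incr_indices (q - 1)" for i K
  proof -
    obtain s where s: "s \<in> {1,-1::real}"
        and eq: "\<forall>\<omega>\<in>covectors (length K + 1). \<omega> (insort i K) = s * \<omega> (i # K)"
      using covector_insort[of "[]" K i] by (simp del: bex_simps) blast
    have len: "length K + 1 = q" using that assms(3) by (auto simp: incr_indices_def)
    have "\<omega> (insort i K) = s * \<omega> (i # K)" "\<eta> (insort i K) = s * \<eta> (i # K)"
      using eq[unfolded len] assms(1,2) by blast+
    then show ?thesis using s by auto
  qed
  have "(\<Sum>K\<in>incr_indices (q - 1). \<Sum>i\<in>UNIV. ?g (i # K)) =
      (\<Sum>K\<in>incr_indices (q - 1). \<Sum>i\<in>- set K. ?g (insort i K))"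
  proof (rule sum.cong[OF refl])
    fix K :: "'n list" assume K: "K \<in> incr_indices (q - 1)"
    have "(\<Sum>i\<in>UNIV. ?g (i # K)) = (\<Sum>i\<in>- set K. ?g (i # K))"
      using covector_not_distinct[OF assms(1)] by (intro sum.mono_neutral_right) auto
    then show "(\<Sum>i\<in>UNIV. ?g (i # K)) = (\<Sum>i\<in>- set K. ?g (insort i K))"
      using ins[OF K] by simp
  qed
  also have "\<dots> = (\<Sum>(K, i)\<in>Sigma (incr_indices (q - 1)) (\<lambda>K. - set K). ?g (insort i K))"
    by (subst sum.Sigma) auto
  also have "\<dots> = (\<Sum>(I, i)\<in>Sigma (incr_indices q) set. ?g I)"
    by (rule sum.reindex_bij_witness[where i = "\<lambda>(I, i). (remove1 i I, i)"
          and j = "\<lambda>(K, i). (insort i K, i)"])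
      (use assms(3) in \<open>auto simp: incr_indices_def strict_sorted_iff insort_remove1 length_remove1
        sorted_remove1 sorted_insort distinct_insort set_insort_key\<close>)
  also have "\<dots> = (\<Sum>I\<in>incr_indices q. \<Sum>i\<in>set I. ?g I)"
    by (subst sum.Sigma) auto
  also have "\<dots> = (\<Sum>I\<in>incr_indices q. real q * ?g I)"
    by (intro sum.cong) (auto simp: incr_indices_def strict_sorted_iff distinct_card)
  finally show ?thesis by (simp add: cov_inner_def sum_distrib_left)
qed

lemma partial_quadratic:
  fixes x0 :: "real ^ 'n::finite"
  shows "partial j (\<lambda>x. a * (norm (x - x0))\<^sup>2 - b) = (\<lambda>x. 2 * a * (x - x0) $ j)"
proof
  fix x :: "real ^ 'n"
  have "((\<lambda>x. a * (norm (x - x0))\<^sup>2 - b) has_derivative (\<lambda>h. 2 * a * ((x - x0) \<bullet> h))) (at x)"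
    unfolding power2_norm_eq_inner
    by (auto intro!: derivative_eq_intros simp: inner_commute algebra_simps)
  from frechet_derivative_at[OF this]
  show "partial j (\<lambda>x. a * (norm (x - x0))\<^sup>2 - b) x = 2 * a * (x - x0) $ j"
    unfolding partial_def by (metis inner_axis inner_commute inner_real_def mult.right_neutral)
qed

lemma partial_partial_quadratic:
  fixes x0 :: "real ^ 'n::finite"
  shows "partial i (partial j (\<lambda>x. a * (norm (x - x0))\<^sup>2 - b)) x = (if i = j then 2 * a else 0)"
proof -
  have "((\<lambda>x. 2 * a * (x - x0) $ j) has_derivative (\<lambda>h. 2 * a * h $ j)) (at x)"
    by (auto intro!: derivative_eq_intros bounded_linear_imp_has_derivative bounded_linear_vec_nth)
  from frechet_derivative_at[OF this, symmetric]
  have "partial i (\<lambda>x. 2 * a * (x - x0) $ j) x = 2 * a * axis i 1 $ j"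
    unfolding partial_def by (rule fun_cong)
  then show ?thesis by (auto simp: partial_quadratic axis_def)
qed

lemma hess_op_quadratic:
  fixes \<omega> :: "'n::{finite,linorder} covector"
  assumes "\<omega> \<in> covectors q" "1 \<le> q"
  shows "hess_op q (\<lambda>x. a * (norm (x - x0))\<^sup>2 - b) x \<omega> = (\<lambda>I. 2 * a * real q * \<omega> I)"
proof -
  let ?\<phi> = "\<lambda>x. a * (norm (x - x0))\<^sup>2 - b"
  let ?\<theta> = "\<lambda>I. 2 * a * real q * \<omega> I"
  have hf: "hess_form q ?\<phi> x \<omega> \<eta> = cov_inner q ?\<theta> \<eta>" if "\<eta> \<in> covectors q" for \<eta>
  proof -
    have "hess_form q ?\<phi> x \<omega> \<eta> =
        (\<Sum>i\<in>UNIV. \<Sum>K\<in>incr_indices (q - 1). 2 * a * (\<omega> (i # K) * \<eta> (i # K)))"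
      unfolding hess_form_def partial_partial_quadratic
    proof (rule sum.cong[OF refl])
      fix i :: 'n
      have "(\<Sum>j\<in>UNIV. \<Sum>K\<in>incr_indices (q - 1). (if i = j then 2 * a else 0) * \<omega> (i # K) * \<eta> (j # K))
        = (\<Sum>j\<in>UNIV. if i = j then \<Sum>K\<in>incr_indices (q - 1). 2 * a * (\<omega> (i # K) * \<eta> (i # K)) else 0)"
        by (intro sum.cong) (auto simp: mult.assoc)
      then show "(\<Sum>j\<in>UNIV. \<Sum>K\<in>incr_indices (q - 1). (if i = j then 2 * a else 0) * \<omega> (i # K) * \<eta> (j # K))
        = (\<Sum>K\<in>incr_indices (q - 1). 2 * a * (\<omega> (i # K) * \<eta> (i # K)))"
        by simp
    qed
    also have "\<dots> = 2 * a * (\<Sum>K\<in>incr_indices (q - 1). \<Sum>i\<in>UNIV. \<omega> (i # K) * \<eta> (i # K))"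
      by (subst sum.swap) (simp add: sum_distrib_left)
    also have "\<dots> = 2 * a * (real q * cov_inner q \<omega> \<eta>)"
      by (simp only: sum_covectors_Cons[OF assms(1) that assms(2)])
    finally show ?thesis by (simp add: cov_inner_def sum_distrib_left mult.assoc)
  qed
  show ?thesis
    unfolding hess_op_def
  proof (rule the_equality)
    show "?\<theta> \<in> covectors q \<and> (\<forall>\<eta>\<in>covectors q. cov_inner q ?\<theta> \<eta> = hess_form q ?\<phi> x \<omega> \<eta>)"
      using covectors_scale[OF assms(1)] hf by auto
  next
    fix \<theta> :: "'n covector"
    assume t: "\<theta> \<in> covectors q \<and> (\<forall>\<eta>\<in>covectors q. cov_inner q \<theta> \<eta> = hess_form q ?\<phi> x \<omega> \<eta>)"
    define \<delta> where "\<delta> = (\<lambda>I. \<theta> I - ?\<theta> I)"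
    have d: "\<delta> \<in> covectors q"
      unfolding \<delta>_def using t covectors_scale[OF assms(1)] by (intro covectors_diff) auto
    have "cov_inner q \<delta> \<delta> = cov_inner q \<theta> \<delta> - cov_inner q ?\<theta> \<delta>"
      unfolding cov_inner_def sum_subtractf[symmetric]
      by (intro sum.cong) (auto simp: \<delta>_def left_diff_distrib)
    also have "\<dots> = 0" using t hf d by auto
    finally have "\<delta> I = 0" for I by (rule covector_eq_zero[OF d])
    then show "\<theta> = ?\<theta>" by (auto simp: \<delta>_def fun_eq_iff)
  qed
qed

lemma hess_inv_quadratic:
  fixes \<omega> :: "'n::{finite,linorder} covector"
  assumes "\<omega> \<in> covectors q" "1 \<le> q" "a > 0"
  shows "hess_inv q (\<lambda>x. a * (norm (x - x0))\<^sup>2 - b) x \<omega> = (\<lambda>I. 1 / (2 * a * real q) * \<omega> I)"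
  unfolding hess_inv_def
proof (rule inv_into_f_eq)
  show "inj_on (hess_op q (\<lambda>x. a * (norm (x - x0))\<^sup>2 - b) x) (covectors q)"
    using assms(2,3) by (auto simp: inj_on_def hess_op_quadratic fun_eq_iff)
  show "(\<lambda>I. 1 / (2 * a * real q) * \<omega> I) \<in> covectors q"
    by (rule covectors_scale[OF assms(1)])
  then show "hess_op q (\<lambda>x. a * (norm (x - x0))\<^sup>2 - b) x (\<lambda>I. 1 / (2 * a * real q) * \<omega> I) = \<omega>"
    using assms(2,3) by (simp add: hess_op_quadratic)
qed

lemma L2_inner_hess_inv_quadratic:
  fixes f :: "'n::{finite,linorder} form"
  assumes "\<phi> = (\<lambda>x. a * (norm (x - x0))\<^sup>2 - b)" "1 \<le> q" "a > 0" "\<forall>x\<in>D. f x \<in> covectors q"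
    and "D \<in> sets lebesgue"
  shows "L2_inner q D \<phi> (\<lambda>x. hess_inv q \<phi> x (f x)) f = 1 / (2 * a * real q) * L2_inner q D \<phi> f f"
proof -
  have "L2_inner q D \<phi> (\<lambda>x. hess_inv q \<phi> x (f x)) f =
      (LINT x:D|lebesgue. 1 / (2 * a * real q) * (cov_inner q (f x) (f x) * exp (- \<phi> x)))"
    unfolding L2_inner_def
  proof (rule set_lebesgue_integral_cong[OF assms(5)], intro allI impI)
    fix x assume "x \<in> D"
    then have "hess_inv q \<phi> x (f x) = (\<lambda>I. 1 / (2 * a * real q) * f x I)"
      unfolding assms(1) using assms by (intro hess_inv_quadratic) auto
    then show "cov_inner q (hess_inv q \<phi> x (f x)) (f x) * exp (- \<phi> x) =
        1 / (2 * a * real q) * (cov_inner q (f x) (f x) * exp (- \<phi> x))"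
      by (simp only: cov_inner_def sum_distrib_left mult.assoc sum_distrib_right)
  qed
  then show ?thesis by (simp add: L2_inner_def)
qed

end

theory Submission
  imports Defs "HOL-Computational_Algebra.Polynomial" "HOL-Probability.Distributions"
begin

text \<open>
  Let \<open>\<xi>\<^sub>1, \<dots>, \<xi>\<^sub>q\<close> be orthonormal eigenvectors of the second fundamental form at a boundary point \<open>p\<close>,
  with eigenvalues \<open>\<mu>\<^sub>1, \<dots>, \<mu>\<^sub>q\<close>, and let \<open>\<nu> = \<nabla>\<rho>(p)\<close>. The functions
  \<open>h\<^sub>k = \<xi>\<^sub>k \<bullet> x - \<rho> (\<nabla>\<rho> \<bullet> \<xi>\<^sub>k)\<close> have vanishing normal derivative on the boundary, so
  \<open>f = dh\<^sub>1 \<and> \<dots> \<and> dh\<^sub>q\<close> is closed and lies in the domain of the adjoint for every weight. For the weight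
  \<open>a \<parallel>x - p\<parallel>\<^sup>2 - b\<close>, pairing the solution of \<open>du = f\<close> with \<open>d\<^sup>*f\<close> gives
  \<open>2aq \<parallel>f\<parallel>\<^sup>2 \<le> \<parallel>d\<^sup>*f\<parallel>\<^sup>2 = \<langle>dd\<^sup>*f, f\<rangle>\<close>. Since \<open>f\<close> is closed,
  \<open>dd\<^sup>*f = 2aq f + 2a (x - p) \<bullet> \<nabla>f - \<Delta>f\<close> coefficientwise, hence
  \<open>0 \<le> \<integral>\<^sub>D (2a (x - p) \<bullet> \<langle>\<nabla>f, f\<rangle> - \<langle>\<Delta>f, f\<rangle>) e\<^sup>-\<^sup>\<phi>\<close>. As \<open>a \<rightarrow> \<infinity>\<close> the weight concentrates at \<open>p\<close> and the first
  term dominates. There \<open>\<langle>\<nabla>f, f\<rangle> = - (\<mu>\<^sub>1 + \<dots> + \<mu>\<^sub>q) \<nu>\<close>, while \<open>(x - p) \<bullet> \<nu> < 0\<close> on the tangent half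
  space, so \<open>\<mu>\<^sub>1 + \<dots> + \<mu>\<^sub>q \<ge> 0\<close>.
\<close>

text \<open>Two demands compete: \<open>f\<close> must be closed, and its normal component must
  vanish on the whole boundary, although only its behaviour at \<open>p\<close> matters. Cutting a
  form off near \<open>p\<close> would destroy closedness. Hence a product of differentials of
  globally defined functions, with the localization left to the weight. Curvature enters without any
  boundary integral: the correction in \<open>h_k\<close> is a product of two functions that vanish
  at \<open>p\<close>, so its Hessian there produces the second fundamental form, which shows up in
  the first derivatives of \<open>f\<close>. The domain of the adjoint quantifies over all weak
  solutions, so Stokes' theorem for smooth forms is replaced by cutoffs. Both integrations by parts
  put the boundary condition on \<open>f\<close> alone: the pairs are \<open>(u, f)\<close> and
  \<open>(d*f, dd*f)\<close>, and the normal component of \<open>d*f\<close> never enters. After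
  rescaling by the square root of \<open>a\<close>, the first-order term has relative size the
  square root of \<open>a\<close>, the Laplacian term size 1.\<close>

section \<open>Skew-symmetric covectors\<close>

text \<open>Signed sum over the deletions of one entry of the list. With \<open>F j K\<close> the
  j-th derivative of the coefficient \<open>K\<close> it is the exterior derivative; with
  \<open>v j * \<omega> K\<close> it is the exterior product by a one-form. Recursion on the head
  opens both to list induction.\<close>

primrec alt_sum :: "('n \<Rightarrow> 'n list \<Rightarrow> real) \<Rightarrow> 'n list \<Rightarrow> real" where
  "alt_sum F [] = 0"
| "alt_sum F (x # J) = F x J - alt_sum (\<lambda>y K. F y (x # K)) J"

lemma alt_sum_eq_sum:
  "alt_sum F J = (\<Sum>k<length J. (-1) ^ k * F (J ! k) (take k J @ drop (Suc k) J))"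
proof (induction J arbitrary: F)
  case (Cons x J)
  show ?case
    by (simp add: Cons.IH sum.lessThan_Suc_shift sum_negf del: sum.lessThan_Suc)
qed simp

lemma alt_sum_add: "alt_sum (\<lambda>i K. F i K + G i K) J = alt_sum F J + alt_sum G J"
  by (induction J arbitrary: F G) auto

lemma alt_sum_diff: "alt_sum (\<lambda>i K. F i K - G i K) J = alt_sum F J - alt_sum G J"
  by (induction J arbitrary: F G) auto

lemma alt_sum_minus: "alt_sum (\<lambda>i K. - F i K) J = - alt_sum F J"
  by (induction J arbitrary: F) auto

lemma alt_sum_mult: "alt_sum (\<lambda>i K. c * F i K) J = c * alt_sum F J"
  by (induction J arbitrary: F) (auto simp: algebra_simps)

lemma alt_sum_zero: "alt_sum (\<lambda>i K. 0) J = 0"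
  using alt_sum_mult[of 0 "\<lambda>_ _. 0" J] by simp

lemma alt_sum_sum: "alt_sum (\<lambda>i K. \<Sum>s\<in>S. F s i K) J = (\<Sum>s\<in>S. alt_sum (F s) J)"
  by (induction J arbitrary: F) (auto simp: sum_subtractf)

lemma alt_sum_cong:
  assumes "\<And>i K. length K + 1 = length J \<Longrightarrow> F i K = G i K"
  shows "alt_sum F J = alt_sum G J"
  using assms
proof (induction J arbitrary: F G)
  case (Cons x J)
  have "alt_sum (\<lambda>y K. F y (x # K)) J = alt_sum (\<lambda>y K. G y (x # K)) J"
    by (rule Cons.IH) (use Cons.prems in auto)
  then show ?case using Cons.prems by auto
qed simp

text \<open>Deleting two entries in the opposite order flips the sign. The terms that delete the
  head first or second trade places; those that keep it are the induction hypothesis. This is the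
  source of dd = 0.\<close>

lemma alt_sum_alt_sum_swap:
  "alt_sum (\<lambda>i. alt_sum (F i)) J = - alt_sum (\<lambda>i. alt_sum (\<lambda>j. F j i)) J"
proof (induction J arbitrary: F)
  case (Cons x J)
  have "alt_sum (\<lambda>i K. alt_sum (\<lambda>j K. F i j (x # K)) K) J
      = - alt_sum (\<lambda>i K. alt_sum (\<lambda>j K. F j i (x # K)) K) J"
    using Cons.IH[of "\<lambda>i j K. F i j (x # K)"] by simp
  then show ?case by (simp add: alt_sum_diff)
qed simp

lemma alt_sum_alt_sum_symmetric:
  assumes "\<And>i j K. F i j K = F j i K"
  shows "alt_sum (\<lambda>i. alt_sum (F i)) J = 0"
  using alt_sum_alt_sum_swap[of F J] assms by (metis (no_types, lifting) ext add.inverse_neutral neg_equal_zero)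

lemma covectors_ConsD:
  assumes "\<omega> \<in> covectors (Suc q)"
  shows "(\<lambda>K. \<omega> (i # K)) \<in> covectors q"
proof -
  have H: "\<And>I i j. length I = Suc q \<Longrightarrow> i < Suc q \<Longrightarrow> j < Suc q \<Longrightarrow> i \<noteq> j \<Longrightarrow>
      \<omega> (I[i := I ! j, j := I ! i]) = - \<omega> I" "\<And>I. length I \<noteq> Suc q \<Longrightarrow> \<omega> I = 0"
    using assms by (simp_all add: covectors_def)
  show ?thesis
    unfolding covectors_def
  proof (intro CollectI conjI allI impI)
    fix I :: "'a list" and a b assume "length I = q" "a < q" "b < q" "a \<noteq> b"
    then show "\<omega> (i # I[a := I ! b, b := I ! a]) = - \<omega> (i # I)"
      using H(1)[of "i # I" "Suc a" "Suc b"] by simp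
  qed (use H(2) in auto)
qed

lemma adjacent_skew_move:
  assumes "\<And>P x y K. length P + length K + 2 = q \<Longrightarrow> \<omega> (P @ y # x # K) = - \<omega> (P @ x # y # K)"
    and "length P + length M + length K + 1 = q"
  shows "\<omega> (P @ x # M @ K) = (-1::real) ^ length M * \<omega> (P @ M @ x # K)"
  using assms(2)
proof (induction M arbitrary: P)
  case (Cons y M)
  have "\<omega> (P @ x # y # M @ K) = - \<omega> ((P @ [y]) @ x # M @ K)"
    using assms(1)[of P "M @ K" x y] Cons.prems by simp
  also have "\<dots> = - ((-1) ^ length M * \<omega> ((P @ [y]) @ M @ x # K))"
    by (subst Cons.IH) (use Cons.prems in auto)
  finally show ?case by simp
qed simp

text \<open>Both sides of a distant transposition are moved past the block \<open>M\<close> between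
  the two entries at the same cost \<open>(-1) ^ length M\<close>, so a single adjacent swap decides
  the sign.\<close>

lemma covectors_adjacentI:
  assumes skew: "\<And>P x y K. length P + length K + 2 = q \<Longrightarrow> \<omega> (P @ y # x # K) = - \<omega> (P @ x # y # K)"
    and zero: "\<And>I. length I \<noteq> q \<Longrightarrow> \<omega> I = 0"
  shows "\<omega> \<in> covectors q"
proof -
  have *: "\<omega> (I[i := I ! j, j := I ! i]) = - \<omega> I" if "length I = q" "i < j" "j < q" for I i j
  proof -
    define P M K where "P = take i I" and "M = take (j - i - 1) (drop (Suc i) I)" and "K = drop (Suc j) I"
    have MK: "drop (Suc i) I = M @ I ! j # K"
    proof -
      have "drop (Suc i) I = M @ drop (j - i - 1) (drop (Suc i) I)"
        unfolding M_def by (rule append_take_drop_id[symmetric])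
      also have "drop (j - i - 1) (drop (Suc i) I) = drop j I"
        using that by simp
      also have "drop j I = I ! j # K"
        unfolding K_def using that by (simp add: Cons_nth_drop_Suc)
      finally show ?thesis .
    qed
    have I: "I = P @ I ! i # M @ I ! j # K"
      unfolding P_def MK[symmetric] using that by (simp add: id_take_nth_drop)
    have len: "length P = i" "length M = j - i - 1" using that by (auto simp: P_def M_def)
    then have len2: "length P + length M + length K + 2 = q"
      using that by (simp add: K_def)
    define x y where "x = I ! i" and "y = I ! j"
    have I': "I = P @ x # M @ y # K" using I by (simp add: x_def y_def)
    have "I[i := y, j := x] = P @ y # M @ x # K"
    proof -
      have j: "j = length P + Suc (length M)" using len that by simp
      show ?thesis unfolding I' j len(1)[symmetric] by (simp add: list_update_append)
    qed
    moreover have "\<omega> (P @ x # M @ y # K) = (-1) ^ length M * \<omega> (P @ M @ x # y # K)"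
      using adjacent_skew_move[of q \<omega> P M "y # K" x, OF skew] len2 by simp
    moreover have "\<omega> ((P @ M) @ x # y # K) = - \<omega> ((P @ M) @ y # x # K)"
      using skew[of "P @ M" K x y] len2 by simp
    moreover have "\<omega> (P @ y # M @ x # K) = (-1) ^ length M * \<omega> (P @ M @ y # x # K)"
      using adjacent_skew_move[of q \<omega> P M "x # K" y, OF skew] len2 by simp
    ultimately have "\<omega> (I[i := y, j := x]) = - \<omega> (P @ x # M @ y # K)" by simp
    also have "P @ x # M @ y # K = I" using I' ..
    finally show ?thesis by (simp only: x_def y_def)
  qed
  show ?thesis
    unfolding covectors_def
  proof (intro CollectI conjI allI impI)
    fix I :: "'a list" and i j assume I: "length I = q" "i < q" "j < q" "i \<noteq> j"
    show "\<omega> (I[i := I ! j, j := I ! i]) = - \<omega> I"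
    proof (cases "i < j")
      case True
      then show ?thesis using *[of I i j] I by simp
    next
      case False
      then show ?thesis using *[of I j i] I by (simp add: list_update_swap[of i j])
    qed
  qed (use zero in auto)
qed

definition wedge :: "('n \<Rightarrow> real) \<Rightarrow> 'n covector \<Rightarrow> 'n covector"
  where "wedge v \<omega> = alt_sum (\<lambda>i K. v i * \<omega> K)"


text \<open>The terms that delete \<open>x\<close> or \<open>y\<close> sit at neighbouring positions
  with opposite signs, and the swap exchanges them. In all other terms \<open>x\<close> and
  \<open>y\<close> stay adjacent and the skewness of \<open>F i\<close> applies.\<close>

lemma alt_sum_adjacent:
  fixes F :: "'n \<Rightarrow> 'n list \<Rightarrow> real"
  assumes "\<And>i P K. length P + length K + 2 = q \<Longrightarrow> F i (P @ y # x # K) = - F i (P @ x # y # K)"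
    and "length P + length K + 1 = q"
  shows "alt_sum F (P @ y # x # K) = - alt_sum F (P @ x # y # K)"
  using assms
proof (induction P arbitrary: F q)
  case Nil
  have "alt_sum (\<lambda>z K. F z (y # x # K)) K = alt_sum (\<lambda>z K. - F z (x # y # K)) K"
  proof (rule alt_sum_cong)
    fix i and K' :: "'n list" assume "length K' + 1 = length K"
    then show "F i (y # x # K') = - F i (x # y # K')"
      using Nil(1)[of "[]" K' i] Nil(2) by simp
  qed
  then show ?case by (simp add: alt_sum_minus)
next
  case (Cons z P)
  obtain q' where q: "q = Suc q'" using Cons.prems(2) by (cases q) auto
  have "F z (P @ y # x # K) = - F z (P @ x # y # K)"
    using Cons.prems(1)[of P K z] Cons.prems(2) by simp
  moreover have "alt_sum (\<lambda>w K. F w (z # K)) (P @ y # x # K) = - alt_sum (\<lambda>w K. F w (z # K)) (P @ x # y # K)"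
    by (rule Cons.IH[of q']) (use Cons.prems(1)[of "z # _"] Cons.prems(2) q in auto)
  ultimately show ?case by simp
qed

lemma alt_sum_covectors:
  assumes "\<And>i. F i \<in> covectors q"
  shows "alt_sum F \<in> covectors (Suc q)"
proof (rule covectors_adjacentI)
  fix P K :: "'a list" and x y assume "length P + length K + 2 = Suc q"
  then show "alt_sum F (P @ y # x # K) = - alt_sum F (P @ x # y # K)"
    by (intro alt_sum_adjacent[of q] covector_swap_adjacent[OF assms]) auto
next
  fix I :: "'a list" assume "length I \<noteq> Suc q"
  then have "alt_sum F I = alt_sum (\<lambda>i K. 0) I"
    by (intro alt_sum_cong) (use assms in \<open>auto simp: covectors_def\<close>)
  then show "alt_sum F I = 0" by (simp add: alt_sum_zero)
qed

lemma wedge_covectors: "\<omega> \<in> covectors q \<Longrightarrow> wedge v \<omega> \<in> covectors (Suc q)"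
  unfolding wedge_def by (intro alt_sum_covectors covectors_scale)

text \<open>Moving the deleted entry back to the front costs exactly the sign of its position, so
  all \<open>q\<close> terms agree. This is the origin of the degree factor in
  \<open>2aq\<close>.\<close>

lemma alt_sum_covector:
  assumes "\<omega> \<in> covectors q" "length J = q"
  shows "alt_sum (\<lambda>i K. \<omega> (i # K)) J = real q * \<omega> J"
  using assms
proof (induction J arbitrary: q \<omega>)
  case (Cons x J)
  obtain q' where q: "q = Suc q'" using Cons.prems(2) by (cases q) auto
  have "alt_sum (\<lambda>y K. \<omega> (y # x # K)) J = alt_sum (\<lambda>y K. - \<omega> (x # y # K)) J"
  proof (rule alt_sum_cong)
    fix y and K :: "'a list" assume "length K + 1 = length J"
    then show "\<omega> (y # x # K) = - \<omega> (x # y # K)"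
      using covector_swap_adjacent[OF Cons.prems(1), of "[]" K y x] Cons.prems(2) by simp
  qed
  also have "\<dots> = - (real q' * \<omega> (x # J))"
    using Cons.IH[of "\<lambda>K. \<omega> (x # K)" q'] Cons.prems q covectors_ConsD[of \<omega> q' x]
    by (simp add: alt_sum_minus)
  finally show ?case using q by (simp add: algebra_simps)
qed simp

text \<open>Runs over all multi-indices, hence q! times \<open>cov_inner\<close> on skew covectors.
  Peeling off the first index permits induction on the degree, which increasing multi-indices do
  not.\<close>

primrec full_inner :: "nat \<Rightarrow> 'n::finite covector \<Rightarrow> 'n covector \<Rightarrow> real" where
  "full_inner 0 \<omega> \<eta> = \<omega> [] * \<eta> []"
| "full_inner (Suc q) \<omega> \<eta> = (\<Sum>i\<in>UNIV. full_inner q (\<lambda>K. \<omega> (i # K)) (\<lambda>K. \<eta> (i # K)))"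

lemma full_inner_cov_inner:
  fixes \<omega> \<eta> :: "'n::{finite,linorder} covector"
  assumes "\<omega> \<in> covectors q" "\<eta> \<in> covectors q"
  shows "full_inner q \<omega> \<eta> = fact q * cov_inner q \<omega> \<eta>"
  using assms
proof (induction q arbitrary: \<omega> \<eta>)
  case 0
  have "incr_indices 0 = {[] :: 'n list}" by (auto simp: incr_indices_def)
  then show ?case by (simp add: cov_inner_def)
next
  case (Suc q)
  have "full_inner (Suc q) \<omega> \<eta> = (\<Sum>i\<in>UNIV. fact q * cov_inner q (\<lambda>K. \<omega> (i # K)) (\<lambda>K. \<eta> (i # K)))"
    by (simp add: Suc covectors_ConsD)
  also have "\<dots> = fact q * (\<Sum>K\<in>incr_indices q. \<Sum>i\<in>UNIV. \<omega> (i # K) * \<eta> (i # K))"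
    unfolding cov_inner_def by (subst sum.swap) (simp add: sum_distrib_left)
  also have "\<dots> = fact (Suc q) * cov_inner (Suc q) \<omega> \<eta>"
    using sum_covectors_Cons[OF Suc.prems] by simp
  finally show ?case .
qed

lemma full_inner_commute: "full_inner q \<omega> \<eta> = full_inner q \<eta> \<omega>"
proof (induction q arbitrary: \<omega> \<eta>)
  case (Suc q)
  show ?case
    unfolding full_inner.simps by (intro sum.cong refl Suc.IH)
qed simp

lemma full_inner_add_right: "full_inner q \<omega> (\<lambda>K. \<eta> K + \<theta> K) = full_inner q \<omega> \<eta> + full_inner q \<omega> \<theta>"
  by (induction q arbitrary: \<omega> \<eta> \<theta>) (auto simp: algebra_simps sum.distrib)

lemma full_inner_diff_right: "full_inner q \<omega> (\<lambda>K. \<eta> K - \<theta> K) = full_inner q \<omega> \<eta> - full_inner q \<omega> \<theta>"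
  by (induction q arbitrary: \<omega> \<eta> \<theta>) (auto simp: right_diff_distrib sum_subtractf)

lemma full_inner_mult_right: "full_inner q \<omega> (\<lambda>K. c * \<eta> K) = c * full_inner q \<omega> \<eta>"
  by (induction q arbitrary: \<omega> \<eta>) (auto simp: algebra_simps sum_distrib_left)

lemma full_inner_sum_right: "full_inner q \<omega> (\<lambda>K. \<Sum>s\<in>S. \<eta> s K) = (\<Sum>s\<in>S. full_inner q \<omega> (\<eta> s))"
proof (induction q arbitrary: \<omega> \<eta>)
  case (Suc q)
  show ?case by (simp add: Suc, subst sum.swap, rule refl)
qed (simp add: sum_distrib_left)

lemma full_inner_cong:
  assumes "\<And>K. length K = q \<Longrightarrow> \<omega> K = \<omega>' K" "\<And>K. length K = q \<Longrightarrow> \<eta> K = \<eta>' K"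
  shows "full_inner q \<omega> \<eta> = full_inner q \<omega>' \<eta>'"
  using assms
proof (induction q arbitrary: \<omega> \<omega>' \<eta> \<eta>')
  case (Suc q)
  show ?case
    unfolding full_inner.simps by (intro sum.cong refl Suc.IH) (simp_all add: Suc.prems)
qed simp

lemma full_inner_minus_left: "full_inner q (\<lambda>K. - \<omega> K) \<eta> = - full_inner q \<omega> \<eta>"
  by (induction q arbitrary: \<omega> \<eta>) (auto simp: sum_negf)

text \<open>Each position of the deleted index contributes equally: exchanging the first two
  arguments of \<omega> turns the subtracted sum into further copies of the first one.\<close>

lemma full_inner_alt_sum:
  assumes "\<omega> \<in> covectors (Suc q)"
  shows "full_inner (Suc q) \<omega> (alt_sum G) = real (Suc q) * (\<Sum>j\<in>UNIV. full_inner q (\<lambda>K. \<omega> (j # K)) (G j))"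
  using assms
proof (induction q arbitrary: \<omega> G)
  case 0
  then show ?case by simp
next
  case (Suc q)
  let ?S = "\<Sum>j\<in>UNIV. full_inner (Suc q) (\<lambda>K. \<omega> (j # K)) (G j)"
  have "full_inner (Suc (Suc q)) \<omega> (alt_sum G)
     = ?S - (\<Sum>i\<in>UNIV. full_inner (Suc q) (\<lambda>K. \<omega> (i # K)) (alt_sum (\<lambda>y K. G y (i # K))))"
    by (subst full_inner.simps) (simp add: full_inner_diff_right sum_subtractf del: full_inner.simps)
  also have "(\<Sum>i\<in>UNIV. full_inner (Suc q) (\<lambda>K. \<omega> (i # K)) (alt_sum (\<lambda>y K. G y (i # K))))
     = (\<Sum>i\<in>UNIV. real (Suc q) * (\<Sum>j\<in>UNIV. full_inner q (\<lambda>K. \<omega> (i # j # K)) (\<lambda>K. G j (i # K))))"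
    by (intro sum.cong refl) (subst Suc.IH, auto simp: covectors_ConsD Suc.prems)
  also have "\<dots> = real (Suc q) * (\<Sum>j\<in>UNIV. \<Sum>i\<in>UNIV. full_inner q (\<lambda>K. \<omega> (i # j # K)) (\<lambda>K. G j (i # K)))"
    by (subst sum.swap) (simp add: sum_distrib_left)
  also have "\<dots> = real (Suc q) * (\<Sum>j\<in>UNIV. \<Sum>i\<in>UNIV. full_inner q (\<lambda>K. - \<omega> (j # i # K)) (\<lambda>K. G j (i # K)))"
  proof -
    have "full_inner q (\<lambda>K. \<omega> (i # j # K)) (\<lambda>K. G j (i # K)) = full_inner q (\<lambda>K. - \<omega> (j # i # K)) (\<lambda>K. G j (i # K))"
      for i j
    proof (rule full_inner_cong)
      fix K :: "'a list" assume "length K = q"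
      then show "\<omega> (i # j # K) = - \<omega> (j # i # K)"
        using covector_swap_adjacent[OF Suc.prems, of "[]" K i j] by simp
    qed simp
    then show ?thesis by presburger
  qed
  also have "\<dots> = - (real (Suc q) * ?S)"
    by (simp add: full_inner_minus_left sum_negf)
  finally show ?case by (simp add: algebra_simps del: full_inner.simps)
qed

section \<open>Interior product and its duality with the exterior product\<close>

definition contract :: "('n::finite \<Rightarrow> real) \<Rightarrow> 'n covector \<Rightarrow> 'n covector"
  where "contract v \<omega> K = (\<Sum>j\<in>UNIV. v j * \<omega> (j # K))"

lemma contract_covectors:
  assumes "\<omega> \<in> covectors (Suc q)"
  shows "contract v \<omega> \<in> covectors q"
proof -
  have "\<And>j. (\<lambda>K. \<omega> (j # K)) \<in> covectors q" by (rule covectors_ConsD[OF assms])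
  then show ?thesis
    unfolding contract_def covectors_def by (auto simp: sum_negf)
qed

text \<open>The antiderivation rule. It is the recursion of \<open>alt_sum\<close> at
  \<open>j # K\<close>: deleting the head gives the scalar term, and the rest is the exterior
  product with the contraction.\<close>

lemma contract_wedge:
  "contract v (wedge w \<omega>) K = (\<Sum>j\<in>UNIV. v j * w j) * \<omega> K - wedge w (contract v \<omega>) K"
proof -
  have "wedge w (contract v \<omega>) K = alt_sum (\<lambda>i M. \<Sum>j\<in>UNIV. v j * (w i * \<omega> (j # M))) K"
    unfolding wedge_def contract_def
    by (rule alt_sum_cong) (simp add: sum_distrib_left mult.left_commute)
  also have "\<dots> = (\<Sum>j\<in>UNIV. v j * alt_sum (\<lambda>i M. w i * \<omega> (j # M)) K)"
    by (simp only: alt_sum_sum alt_sum_mult)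
  finally have *: "(\<Sum>j\<in>UNIV. v j * alt_sum (\<lambda>i M. w i * \<omega> (j # M)) K) = wedge w (contract v \<omega>) K" ..
  have "contract v (wedge w \<omega>) K = (\<Sum>j\<in>UNIV. v j * w j * \<omega> K - v j * alt_sum (\<lambda>i M. w i * \<omega> (j # M)) K)"
    by (simp add: contract_def wedge_def right_diff_distrib mult.assoc)
  then show ?thesis
    by (simp only: sum_subtractf * sum_distrib_right)
qed

text \<open>Interior and exterior product are adjoint; \<open>real (Suc q)\<close> is the quotient
  of the factorials that \<open>full_inner\<close> carries in the two degrees.\<close>

lemma full_inner_wedge:
  assumes "\<omega> \<in> covectors (Suc q)"
  shows "full_inner (Suc q) \<omega> (wedge v \<eta>) = real (Suc q) * full_inner q (contract v \<omega>) \<eta>"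
proof -
  have "full_inner q (contract v \<omega>) \<eta> = (\<Sum>j\<in>UNIV. full_inner q (\<lambda>K. \<omega> (j # K)) (\<lambda>K. v j * \<eta> K))"
  proof -
    have "full_inner q \<eta> (contract v \<omega>) = (\<Sum>j\<in>UNIV. full_inner q \<eta> (\<lambda>K. v j * \<omega> (j # K)))"
      unfolding contract_def[abs_def] by (rule full_inner_sum_right)
    then show ?thesis
      by (simp only: full_inner_mult_right full_inner_commute[of q \<eta>])
  qed
  then show ?thesis
    unfolding wedge_def by (simp add: full_inner_alt_sum[OF assms] del: full_inner.simps)
qed

text \<open>Turns the distributional \<open>d\<close>, tested coefficient by coefficient, into a
  pairing of \<open>u\<close> with a divergence; \<open>\<omega> j J\<close> will be the j-th
  derivative of a test coefficient. Expanded in the coordinate one-forms \<open>?e m\<close>, it is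
  the adjointness of exterior and interior product.\<close>

lemma cov_inner_alt_sum:
  fixes \<omega> :: "'n::{finite,linorder} \<Rightarrow> 'n covector"
  assumes "\<And>m. \<omega> m \<in> covectors (Suc q)" "u \<in> covectors q"
  shows "(\<Sum>J\<in>incr_indices (Suc q). alt_sum (\<lambda>j K. u K * \<omega> j J) J)
    = cov_inner q u (\<lambda>K. \<Sum>j\<in>UNIV. \<omega> j (j # K))"
proof -
  let ?e = "\<lambda>m i. if i = m then 1 else 0 :: real"
  have "(\<Sum>J\<in>incr_indices (Suc q). alt_sum (\<lambda>j K. u K * \<omega> j J) J)
     = (\<Sum>J\<in>incr_indices (Suc q). alt_sum (\<lambda>j K. \<Sum>m\<in>UNIV. \<omega> m J * (?e m j * u K)) J)"
  proof (intro sum.cong refl alt_sum_cong)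
    fix J :: "'n list" and j K
    have "(\<Sum>m\<in>UNIV. \<omega> m J * (?e m j * u K)) = (\<Sum>m\<in>UNIV. if m = j then u K * \<omega> j J else 0)"
      by (intro sum.cong) auto
    then show "u K * \<omega> j J = (\<Sum>m\<in>UNIV. \<omega> m J * (?e m j * u K))" by simp
  qed
  also have "\<dots> = (\<Sum>J\<in>incr_indices (Suc q). \<Sum>m\<in>UNIV. \<omega> m J * wedge (?e m) u J)"
    by (simp add: alt_sum_sum alt_sum_mult wedge_def)
  also have "\<dots> = (\<Sum>m\<in>UNIV. cov_inner (Suc q) (\<omega> m) (wedge (?e m) u))"
    by (subst sum.swap) (simp add: cov_inner_def)
  also have "\<dots> = (\<Sum>m\<in>UNIV. cov_inner q (contract (?e m) (\<omega> m)) u)"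
  proof (rule sum.cong[OF refl])
    fix m
    have "fact (Suc q) * cov_inner (Suc q) (\<omega> m) (wedge (?e m) u)
        = real (Suc q) * (fact q * cov_inner q (contract (?e m) (\<omega> m)) u)"
      using full_inner_wedge[OF assms(1), of m "?e m" u]
      by (simp add: full_inner_cov_inner assms wedge_covectors contract_covectors del: full_inner.simps fact_Suc)
    then have "fact (Suc q) * cov_inner (Suc q) (\<omega> m) (wedge (?e m) u)
        = fact (Suc q) * cov_inner q (contract (?e m) (\<omega> m)) u"
      by (simp only: fact_Suc mult.assoc of_nat_mult of_nat_fact)
    then show "cov_inner (Suc q) (\<omega> m) (wedge (?e m) u) = cov_inner q (contract (?e m) (\<omega> m)) u"
      by simp
  qed
  also have "\<dots> = cov_inner q u (\<lambda>K. \<Sum>j\<in>UNIV. \<omega> j (j # K))"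
  proof -
    have "contract (?e m) (\<omega> m) K = \<omega> m (m # K)" for m K
    proof -
      have "contract (?e m) (\<omega> m) K = (\<Sum>j\<in>UNIV. if j = m then \<omega> m (m # K) else 0)"
        unfolding contract_def by (intro sum.cong) auto
      then show ?thesis by simp
    qed
    then show ?thesis
      unfolding cov_inner_def by (subst sum.swap) (simp add: sum_distrib_left mult.commute)
  qed
  finally show ?thesis .
qed

section \<open>Smooth functions\<close>

abbreviation smooth :: "(real ^ 'n::finite \<Rightarrow> real) \<Rightarrow> bool"
  where "smooth \<equiv> smooth_on UNIV"

lemma partialI:
  assumes "(g has_derivative g') (at x)"
  shows "partial i g x = g' (axis i 1)"
  unfolding partial_def using frechet_derivative_at[OF assms] by simp

lemma Ck_on_mono: "Ck_on (Suc k) UNIV g \<Longrightarrow> Ck_on k UNIV g"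
  by (induction k arbitrary: g)
    (auto intro!: continuous_at_imp_continuous_on differentiable_imp_continuous_within)

lemma smooth_continuous: "smooth g \<Longrightarrow> continuous_on S g"
  by (metis Ck_on.simps(1) continuous_on_subset smooth_on_def subset_UNIV)

lemma smooth_isCont: "smooth g \<Longrightarrow> isCont g x"
  using smooth_continuous[of g UNIV] by (simp add: continuous_on_eq_continuous_at)

lemma smooth_differentiable: "smooth g \<Longrightarrow> g differentiable (at x)"
  unfolding smooth_on_def by (metis Ck_on.simps(2) UNIV_I)

lemma smooth_partial: "smooth g \<Longrightarrow> smooth (partial i g)"
  unfolding smooth_on_def by (metis Ck_on.simps(2))

lemma has_derivative_grad:
  assumes "g differentiable (at x)"
  shows "(g has_derivative (\<lambda>v. grad g x \<bullet> v)) (at x)"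
proof -
  let ?D = "frechet_derivative g (at x)"
  have D: "(g has_derivative ?D) (at x)"
    using assms by (simp add: frechet_derivative_works)
  then interpret bounded_linear ?D by (rule has_derivative_bounded_linear)
  have "?D v = grad g x \<bullet> v" for v
  proof -
    have "?D v = ?D (\<Sum>i\<in>UNIV. v $ i *s axis i 1)"
      by (simp add: basis_expansion)
    also have "\<dots> = (\<Sum>i\<in>UNIV. v $ i * ?D (axis i 1))"
      by (simp add: sum scaleR scalar_mult_eq_scaleR)
    finally show ?thesis
      by (simp add: inner_vec_def grad_def partial_def mult.commute)
  qed
  then show ?thesis using D by presburger
qed

lemmas smooth_has_derivative = has_derivative_grad[OF smooth_differentiable]

lemma partial_const: "partial i (\<lambda>x. c) = (\<lambda>x. 0)"
  by (auto intro!: partialI derivative_eq_intros)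

lemma partial_add:
  assumes "f differentiable (at x)" "g differentiable (at x)"
  shows "partial i (\<lambda>x. f x + g x) x = partial i f x + partial i g x"
  by (rule partialI[OF has_derivative_add[OF has_derivative_grad has_derivative_grad, OF assms], THEN trans])
    (simp add: grad_def inner_axis)

lemma partial_mult:
  assumes "f differentiable (at x)" "g differentiable (at x)"
  shows "partial i (\<lambda>x. f x * g x) x = partial i f x * g x + f x * partial i g x"
  by (rule partialI[OF has_derivative_mult[OF has_derivative_grad has_derivative_grad, OF assms], THEN trans])
    (simp add: grad_def inner_axis)

lemma partial_compose:
  assumes "(F has_real_derivative d) (at (g x))" "g differentiable (at x)"
  shows "partial i (\<lambda>x. F (g x)) x = d * partial i g x"
  by (rule partialI[OF has_derivative_compose[OF has_derivative_grad[OF assms(2)]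
        assms(1)[unfolded has_field_derivative_def]], THEN trans])
    (simp add: grad_def inner_axis)

lemma Ck_on_const: "Ck_on k UNIV (\<lambda>x. c)"
  by (induction k arbitrary: c) (auto simp: partial_const)

lemma Ck_on_add:
  "Ck_on k UNIV f \<Longrightarrow> Ck_on k UNIV g \<Longrightarrow> Ck_on k UNIV (\<lambda>x. f x + g x)"
proof (induction k arbitrary: f g)
  case (Suc k)
  have "partial i (\<lambda>x. f x + g x) = (\<lambda>x. partial i f x + partial i g x)" for i
    using Suc.prems by (intro ext partial_add) auto
  then show ?case using Suc by simp
qed (auto intro: continuous_on_add)

lemma Ck_on_mult:
  "Ck_on k UNIV f \<Longrightarrow> Ck_on k UNIV g \<Longrightarrow> Ck_on k UNIV (\<lambda>x. f x * g x)"
proof (induction k arbitrary: f g)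
  case (Suc k)
  have "partial i (\<lambda>x. f x * g x) = (\<lambda>x. partial i f x * g x + f x * partial i g x)" for i
    using Suc.prems by (intro ext partial_mult) auto
  then show ?case
    using Suc.prems Suc.IH Ck_on_mono[OF Suc.prems(1)] Ck_on_mono[OF Suc.prems(2)] by (auto intro!: Ck_on_add)
qed (auto intro: continuous_on_mult)

lemma smooth_const [simp, intro]: "smooth (\<lambda>x. c)"
  by (simp add: smooth_on_def Ck_on_const)

lemma smooth_add [intro]: "smooth f \<Longrightarrow> smooth g \<Longrightarrow> smooth (\<lambda>x. f x + g x)"
  by (simp add: smooth_on_def Ck_on_add)

lemma smooth_mult [intro]: "smooth f \<Longrightarrow> smooth g \<Longrightarrow> smooth (\<lambda>x. f x * g x)"
  by (simp add: smooth_on_def Ck_on_mult)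

lemma smooth_minus [intro]: "smooth f \<Longrightarrow> smooth (\<lambda>x. - f x)"
  using smooth_mult[OF smooth_const[of "-1"]] by simp

lemma smooth_diff [intro]: "smooth f \<Longrightarrow> smooth g \<Longrightarrow> smooth (\<lambda>x. f x - g x)"
  using smooth_add[OF _ smooth_minus, of f g] by simp

lemma smooth_sum [intro]: "(\<And>s. s \<in> S \<Longrightarrow> smooth (f s)) \<Longrightarrow> smooth (\<lambda>x. \<Sum>s\<in>S. f s x)"
  by (induction S rule: infinite_finite_induct) auto

lemma partial_component: "partial i (\<lambda>x. x $ j) x = (if i = j then 1 else 0)"
  by (subst partialI[OF bounded_linear_imp_has_derivative[OF bounded_linear_vec_nth]]) (simp add: axis_def)

lemma smooth_component [simp, intro]: "smooth (\<lambda>x. x $ j)"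
proof -
  have "Ck_on k UNIV (\<lambda>x :: real ^ 'a. x $ j)" for k
  proof (cases k)
    case (Suc k')
    have "partial i (\<lambda>x :: real ^ 'a. x $ j) = (\<lambda>x. if i = j then 1 else 0)" for i
      by (rule ext) (rule partial_component)
    then show ?thesis
      using Suc by (auto intro!: bounded_linear_imp_differentiable bounded_linear_vec_nth Ck_on_const)
  qed (auto intro: continuous_intros)
  then show ?thesis by (simp add: smooth_on_def)
qed

text \<open>A family of one-variable functions closed under differentiation stands in for smoothness
  of the outer function, so that product and chain rule carry the induction. The instances are
  \<open>{exp}\<close> and \<open>range flat\<close>.\<close>

lemma smooth_compose:
  assumes closed: "\<And>F. F \<in> \<F> \<Longrightarrow> \<exists>F'\<in>\<F>. \<forall>t. (F has_real_derivative F' t) (at t)"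
    and "F \<in> \<F>" "smooth g"
  shows "smooth (\<lambda>x. F (g x))"
proof -
  have "Ck_on k UNIV (\<lambda>x. F (g x))" for k
    using assms(2)
  proof (induction k arbitrary: F)
    case 0
    then obtain F' where "\<forall>t. (F has_real_derivative F' t) (at t)" using closed by blast
    then have "continuous_on UNIV F"
      by (auto intro!: continuous_at_imp_continuous_on DERIV_isCont)
    then show ?case
      using continuous_on_compose2[of UNIV F UNIV g] smooth_continuous[OF assms(3)] by auto
  next
    case (Suc k)
    then obtain F' where F': "F' \<in> \<F>" "\<And>t. (F has_real_derivative F' t) (at t)" using closed by blast
    have "partial i (\<lambda>x. F (g x)) = (\<lambda>x. F' (g x) * partial i g x)" for i
      by (intro ext partial_compose F' smooth_differentiable assms)
    moreover have "Ck_on k UNIV (\<lambda>x. F' (g x) * partial i g x)" for i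
      using Suc.IH[OF F'(1)] smooth_partial[OF assms(3), of i] by (auto simp: smooth_on_def intro: Ck_on_mult)
    moreover have "(\<lambda>x. F (g x)) differentiable (at x)" for x
      using differentiable_compose[of F g x UNIV] F'(2)[of "g x"] smooth_differentiable[OF assms(3), of x]
      by (metis differentiable_def has_field_derivative_def differentiable_compose)
    ultimately show ?case by simp
  qed
  then show ?thesis by (simp add: smooth_on_def)
qed

lemma smooth_exp [intro]: "smooth g \<Longrightarrow> smooth (\<lambda>x. exp (g x))"
  by (rule smooth_compose[of "{exp}" exp]) (auto intro!: derivative_eq_intros)

lemma partial_mvt:
  assumes "smooth g" "0 < t"
  obtains s where "0 < s" "s < t" "g (x + t *\<^sub>R axis i 1) - g x = t * partial i g (x + s *\<^sub>R axis i 1)"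
proof -
  have d: "((\<lambda>r. g (x + r *\<^sub>R axis i 1)) has_derivative (\<lambda>h. grad g (x + r *\<^sub>R axis i 1) \<bullet> (h *\<^sub>R axis i 1))) (at r)" for r
    by (rule has_derivative_compose[OF _ smooth_has_derivative[OF assms(1)]])
       (auto intro!: derivative_eq_intros)
  obtain s where "s \<in> {0<..<t}"
    "g (x + t *\<^sub>R axis i 1) - g (x + 0 *\<^sub>R axis i 1) = grad g (x + s *\<^sub>R axis i 1) \<bullet> ((t - 0) *\<^sub>R axis i 1)"
    using mvt_simple[OF assms(2) has_derivative_at_withinI[OF d]] by blast
  then show thesis
    by (intro that[of s]) (auto simp: grad_def inner_axis)
qed

text \<open>Schwarz's theorem. The second difference \<open>?\<Delta>\<close> is symmetric in the
  two directions, and two uses of the mean value theorem express it, in either order, by a mixed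
  derivative at a point tending to \<open>x\<close>.\<close>

lemma partial_commute:
  assumes "smooth g"
  shows "partial i (partial j g) x = partial j (partial i g) x"
proof -
  let ?e = "\<lambda>i. axis i 1 :: real ^ 'a"
  let ?\<Delta> = "\<lambda>i j t. g (x + t *\<^sub>R ?e i + t *\<^sub>R ?e j) - g (x + t *\<^sub>R ?e i) - g (x + t *\<^sub>R ?e j) + g x"
  have *: "\<exists>y. dist y x \<le> 2 * t \<and> ?\<Delta> i j t = t * t * partial j (partial i g) y" if t: "0 < t" for i j t
  proof -
    let ?G = "\<lambda>z. g (z + t *\<^sub>R ?e j) - g z"
    have shift: "((\<lambda>z. g (z + t *\<^sub>R ?e j)) has_derivative (\<lambda>v. grad g (z + t *\<^sub>R ?e j) \<bullet> v)) (at z)" for z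
      by (rule has_derivative_compose[OF _ smooth_has_derivative[OF assms]])
         (auto intro!: derivative_eq_intros)
    have d: "((\<lambda>r. ?G (x + r *\<^sub>R ?e i)) has_derivative
        (\<lambda>h. grad g (x + r *\<^sub>R ?e i + t *\<^sub>R ?e j) \<bullet> (h *\<^sub>R ?e i) - grad g (x + r *\<^sub>R ?e i) \<bullet> (h *\<^sub>R ?e i))) (at r)" for r
      by (intro has_derivative_diff has_derivative_compose[OF _ shift]
          has_derivative_compose[OF _ smooth_has_derivative[OF assms]])
         (auto intro!: derivative_eq_intros)
    obtain s where s: "s \<in> {0<..<t}" "?G (x + t *\<^sub>R ?e i) - ?G (x + 0 *\<^sub>R ?e i) =
        grad g (x + s *\<^sub>R ?e i + t *\<^sub>R ?e j) \<bullet> ((t - 0) *\<^sub>R ?e i) - grad g (x + s *\<^sub>R ?e i) \<bullet> ((t - 0) *\<^sub>R ?e i)"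
      using mvt_simple[OF t has_derivative_at_withinI[OF d]] by blast
    obtain r where r: "0 < r" "r < t" "partial i g (x + s *\<^sub>R ?e i + t *\<^sub>R ?e j) - partial i g (x + s *\<^sub>R ?e i)
        = t * partial j (partial i g) (x + s *\<^sub>R ?e i + r *\<^sub>R ?e j)"
      by (rule partial_mvt[OF smooth_partial[OF assms] t])
    have "?\<Delta> i j t = t * (partial i g (x + s *\<^sub>R ?e i + t *\<^sub>R ?e j) - partial i g (x + s *\<^sub>R ?e i))"
      using s(2) by (simp add: grad_def inner_axis algebra_simps)
    also have "\<dots> = t * t * partial j (partial i g) (x + s *\<^sub>R ?e i + r *\<^sub>R ?e j)"
      by (simp add: r(3))
    moreover have "dist (x + s *\<^sub>R ?e i + r *\<^sub>R ?e j) x \<le> 2 * t"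
    proof -
      have "norm (s *\<^sub>R ?e i + r *\<^sub>R ?e j) \<le> s + r"
        by (rule norm_triangle_le) (use s(1) r in \<open>simp add: norm_axis_1\<close>)
      then show ?thesis using s(1) r by (simp add: dist_norm add.assoc)
    qed
    ultimately show ?thesis by auto
  qed
  define t where "t = (\<lambda>m. 1 / real (Suc m))"
  have t: "0 < t m" for m by (simp add: t_def)
  have t0: "(\<lambda>m. 2 * t m) \<longlonglongrightarrow> 0"
    unfolding t_def using tendsto_mult_right_zero[OF LIMSEQ_inverse_real_of_nat, of 2] by (simp add: inverse_eq_divide)
  obtain y where y: "\<And>m. dist (y m) x \<le> 2 * t m" "\<And>m. ?\<Delta> i j (t m) = t m * t m * partial j (partial i g) (y m)"
    using *[OF t, where i=i and j=j] by metis
  obtain z where z: "\<And>m. dist (z m) x \<le> 2 * t m" "\<And>m. ?\<Delta> j i (t m) = t m * t m * partial i (partial j g) (z m)"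
    using *[OF t, where i=j and j=i] by metis
  have lim: "y \<longlonglongrightarrow> x" "z \<longlonglongrightarrow> x"
    by (intro metric_tendsto_imp_tendsto[OF t0] always_eventually allI; use y(1) z(1) t in \<open>simp add: less_imp_le\<close>)+
  have "partial j (partial i g) (y m) = partial i (partial j g) (z m)" for m
  proof -
    have "?\<Delta> i j (t m) = ?\<Delta> j i (t m)" by (simp add: algebra_simps)
    then have "t m * t m * partial j (partial i g) (y m) = t m * t m * partial i (partial j g) (z m)"
      unfolding y(2) z(2) .
    then show ?thesis using t[of m] by simp
  qed
  moreover have "(\<lambda>m. partial j (partial i g) (y m)) \<longlonglongrightarrow> partial j (partial i g) x"
    "(\<lambda>m. partial i (partial j g) (z m)) \<longlonglongrightarrow> partial i (partial j g) x"
    using lim by (intro isCont_tendsto_compose[OF smooth_isCont] smooth_partial assms; simp)+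
  ultimately show ?thesis
    by (metis (no_types, lifting) ext LIMSEQ_unique)
qed

lemma partial_minus:
  assumes "smooth f"
  shows "partial i (\<lambda>x. - f x) = (\<lambda>x. - partial i f x)"
  using partial_mult[of "\<lambda>x. -1" _ f i] smooth_differentiable[OF assms] by (simp add: partial_const fun_eq_iff)

lemma partial_diff:
  assumes "smooth f" "smooth g"
  shows "partial i (\<lambda>x. f x - g x) x = partial i f x - partial i g x"
  using partial_add[of f x "\<lambda>x. - g x" i] smooth_differentiable[OF assms(1)]
    smooth_differentiable[OF smooth_minus[OF assms(2)]]
  by (simp add: partial_minus[OF assms(2)])

lemma partial_sum:
  assumes "\<And>s. s \<in> S \<Longrightarrow> smooth (f s)"
  shows "partial i (\<lambda>x. \<Sum>s\<in>S. f s x) x = (\<Sum>s\<in>S. partial i (f s) x)"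
  using assms
proof (induction S rule: infinite_finite_induct)
  case (insert s S)
  then show ?case
    by (simp add: partial_add smooth_differentiable smooth_sum)
qed (simp_all add: partial_const)

lemma smooth_alt_sum:
  assumes "\<And>i K. smooth (\<lambda>x. F x i K)"
  shows "smooth (\<lambda>x. alt_sum (F x) J)"
  using assms
proof (induction J arbitrary: F)
  case (Cons a J)
  show ?case by (simp, intro smooth_diff Cons)
qed simp

lemma partial_alt_sum:
  assumes "\<And>i K. smooth (\<lambda>x. F x i K)"
  shows "partial m (\<lambda>x. alt_sum (F x) J) x = alt_sum (\<lambda>i K. partial m (\<lambda>x. F x i K) x) J"
  using assms
proof (induction J arbitrary: F)
  case (Cons a J)
  show ?case
    by (simp add: partial_diff Cons smooth_alt_sum)
qed (simp add: partial_const)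

section \<open>A flat cutoff function\<close>

text \<open>The polynomial factor makes the family closed under differentiation.
  \<open>flat 1\<close> is the cutoff profile, and \<open>flat [:0, 0, 1:]\<close> is its
  derivative.\<close>

definition flat :: "real poly \<Rightarrow> real \<Rightarrow> real"
  where "flat P t = (if 0 < t then poly P (1 / t) * exp (- 1 / t) else 0)"

lemma poly_exp_tendsto_0: "((\<lambda>s. poly P s * exp (- s)) \<longlongrightarrow> (0::real)) at_top"
proof -
  have "((\<lambda>s. \<Sum>i\<le>degree P. coeff P i * (s ^ i / exp s)) \<longlongrightarrow> (\<Sum>i\<le>degree P. coeff P i * 0)) at_top"
    by (intro tendsto_sum tendsto_mult tendsto_const tendsto_power_div_exp_0)
  then show ?thesis
    by (simp add: poly_altdef sum_divide_distrib exp_minus field_simps)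
qed

text \<open>In s = 1/t one has d/dt = -s^2 d/ds, and P(s) e^(-s) has derivative (P' - P)(s) e^(-s);
  the two \<open>pCons 0\<close> are the factor s^2. At 0 the quotient from the right is s P(s)
  e^(-s) with s tending to infinity.\<close>

lemma has_derivative_flat:
  "(flat P has_real_derivative flat (pCons 0 (pCons 0 (P - pderiv P))) t) (at t)"
proof -
  consider "t < 0" | "t = 0" | "0 < t" by linarith
  then show ?thesis
  proof cases
    case 1
    have "((\<lambda>t. 0) has_real_derivative flat (pCons 0 (pCons 0 (P - pderiv P))) t) (at t)"
      using 1 by (auto simp: flat_def)
    then show ?thesis
      by (rule has_field_derivative_transform_within_open[where S = "{..<0}"])
        (use 1 in \<open>auto simp: flat_def\<close>)
  next
    case 2
    have right: "((\<lambda>h. poly (pCons 0 P) (inverse h) * exp (- inverse h)) \<longlongrightarrow> 0) (at_right (0::real))"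
      by (rule filterlim_compose[OF poly_exp_tendsto_0 filterlim_inverse_at_top_right])
    have "((\<lambda>h. flat P h / h) \<longlongrightarrow> 0) (at 0)"
    proof (rule filterlim_split_at)
      show "((\<lambda>h. flat P h / h) \<longlongrightarrow> 0) (at_left 0)"
        by (rule tendsto_eventually) (auto simp: flat_def eventually_at_filter)
      show "((\<lambda>h. flat P h / h) \<longlongrightarrow> 0) (at_right 0)"
        by (rule Lim_transform_eventually[OF right])
          (auto simp: flat_def eventually_at_filter field_simps)
    qed
    then show ?thesis
      using 2 by (simp add: has_field_derivative_iff flat_def)
  next
    case 3
    have "((\<lambda>t. poly P (1 / t) * exp (- 1 / t)) has_real_derivative
        (poly (pderiv P) (1 / t) * (- 1 / t\<^sup>2)) * exp (- 1 / t) + (exp (- 1 / t) * (1 / t\<^sup>2)) * poly P (1 / t)) (at t)"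
      using 3 by (auto intro!: derivative_eq_intros DERIV_chain'[of _ _ t UNIV "poly P"] poly_DERIV simp: power2_eq_square)
    then have "((\<lambda>t. poly P (1 / t) * exp (- 1 / t)) has_real_derivative
        flat (pCons 0 (pCons 0 (P - pderiv P))) t) (at t)"
      using 3 by (simp add: flat_def field_simps power2_eq_square)
    then show ?thesis
      by (rule has_field_derivative_transform_within_open[where S = "{0<..}"])
        (use 3 in \<open>auto simp: flat_def\<close>)
  qed
qed

lemma smooth_flat [intro]: "smooth g \<Longrightarrow> smooth (\<lambda>x. flat P (g x))"
  by (rule smooth_compose[of "range flat" "flat P"]) (use has_derivative_flat in auto)

lemma flat_1_bounds: "0 \<le> flat 1 t" "flat 1 t \<le> 1"
  by (auto simp: flat_def)

text \<open>For t = m |\<rho>| - 1 the factor \<open>1 + t\<close> is m |\<rho>|, so the bound on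
  the cutoff gradient weighted by |\<rho>| is uniform in m. With r = 1/t it follows from exp r \<ge>
  1 + r + r^2/2.\<close>

lemma flat_deriv_bounds:
  "0 \<le> flat [:0, 0, 1:] t" "(1 + t) * flat [:0, 0, 1:] t \<le> 2"
proof -
  show "0 \<le> flat [:0, 0, 1:] t" by (simp add: flat_def)
  show "(1 + t) * flat [:0, 0, 1:] t \<le> 2"
  proof (cases "0 < t")
    case True
    define r where "r = 1 / t"
    have r: "0 < r" using True by (simp add: r_def)
    have "(1 + t) * flat [:0, 0, 1:] t = (r\<^sup>2 + r) / exp r"
      using True by (simp add: flat_def r_def exp_minus field_simps power2_eq_square)
    also have "\<dots> \<le> 2"
      using exp_lower_Taylor_quadratic[of r] r by (simp add: field_simps)
    finally show ?thesis .
  qed (simp add: flat_def)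
qed

lemma flat_tendsto:
  assumes "0 < c"
  shows "(\<lambda>m. flat 1 (real m * c - 1)) \<longlonglongrightarrow> 1"
    and "(\<lambda>m. real m * c * flat [:0, 0, 1:] (real m * c - 1)) \<longlonglongrightarrow> 0"
proof -
  have lin: "filterlim (\<lambda>m. real m * c - 1) at_top sequentially"
    using filterlim_tendsto_add_at_top[OF tendsto_const[of "-1"]
        filterlim_at_top_mult_tendsto_pos[OF tendsto_const assms filterlim_real_sequentially]]
    by (simp add: add.commute)
  have inv: "(\<lambda>m. inverse (real m * c - 1)) \<longlonglongrightarrow> 0"
    by (rule filterlim_compose[OF tendsto_inverse_0_at_top[OF filterlim_ident] lin])
  have pos: "eventually (\<lambda>m. 0 < real m * c - 1) sequentially"
    using lin unfolding filterlim_at_top_dense by blast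
  have "(\<lambda>m. exp (- inverse (real m * c - 1))) \<longlonglongrightarrow> exp (- 0)"
    by (intro tendsto_exp tendsto_minus inv)
  then show "(\<lambda>m. flat 1 (real m * c - 1)) \<longlonglongrightarrow> 1"
    unfolding minus_zero exp_zero
    by (rule Lim_transform_eventually[OF _ eventually_mono[OF pos]])
      (auto simp: flat_def field_simps)
  let ?r = "\<lambda>m. inverse (real m * c - 1)"
  have "(\<lambda>m. (?r m * ?r m + ?r m) * exp (- ?r m)) \<longlonglongrightarrow> (0 * 0 + 0) * exp (- 0)"
    by (intro tendsto_intros inv)
  then have "(\<lambda>m. (?r m * ?r m + ?r m) * exp (- ?r m)) \<longlonglongrightarrow> 0" by simp
  then show "(\<lambda>m. real m * c * flat [:0, 0, 1:] (real m * c - 1)) \<longlonglongrightarrow> 0"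
  proof (rule Lim_transform_eventually[OF _ eventually_mono[OF pos]])
    fix m assume *: "0 < real m * c - 1"
    define s where "s = real m * c - 1"
    have s: "0 < s" "real m * c = 1 + s" using * by (auto simp: s_def)
    show "(?r m * ?r m + ?r m) * exp (- ?r m) = real m * c * flat [:0, 0, 1:] (real m * c - 1)"
      unfolding s_def[symmetric] s(2) using s(1) by (simp add: flat_def field_simps)
  qed
qed

section \<open>Integration by parts\<close>

lemma integrable_compact_support:
  fixes g :: "real ^ 'n::finite \<Rightarrow> real"
  assumes "continuous_on UNIV g" "compact K" "\<And>x. x \<notin> K \<Longrightarrow> g x = 0"
  shows "integrable lborel g"
proof -
  have "integrable lborel (\<lambda>x. indicator K x *\<^sub>R g x)"
    by (rule borel_integrable_compact[OF assms(2) continuous_on_subset[OF assms(1)]]) simp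
  also have "(\<lambda>x. indicator K x *\<^sub>R g x) = g"
    using assms(3) by (auto simp: indicator_def fun_eq_iff)
  finally show ?thesis .
qed

lemma lebesgue_integral_continuous:
  fixes g :: "real ^ 'n::finite \<Rightarrow> real"
  assumes "continuous_on UNIV g"
  shows "(LINT x|lebesgue. g x) = (LINT x|lborel. g x)"
  using borel_measurable_continuous_onI[OF assms] by (intro integral_completion) simp

lemma open_in_sets_lebesgue: "open D \<Longrightarrow> D \<in> sets lebesgue"
  by (intro sets_completionI_sets) simp

lemma set_integral_sum:
  fixes f :: "'i \<Rightarrow> 'a \<Rightarrow> real"
  assumes "\<And>i. i \<in> I \<Longrightarrow> set_integrable M A (f i)"
  shows "set_integrable M A (\<lambda>x. \<Sum>i\<in>I. f i x)"
    and "(LINT x:A|M. \<Sum>i\<in>I. f i x) = (\<Sum>i\<in>I. LINT x:A|M. f i x)"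
  using assms unfolding set_integrable_def set_lebesgue_integral_def scaleR_sum_right
  by (intro Bochner_Integration.integrable_sum Bochner_Integration.integral_sum; simp)+

lemma partial_eq_0_outside:
  assumes "compact K" "\<And>x. x \<notin> K \<Longrightarrow> g x = 0" "x \<notin> K"
  shows "partial j g x = 0"
proof -
  have "((\<lambda>x. 0) has_derivative (\<lambda>h. 0)) (at x)" by simp
  then have "(g has_derivative (\<lambda>h. 0)) (at x)"
    by (rule has_derivative_transform_within_open[of _ _ _ _ "- K"])
       (use assms compact_imp_closed in auto)
  then show ?thesis by (rule partialI)
qed

text \<open>The integral of \<open>\<psi> (x + t e\<^sub>j)\<close> does not depend on \<open>t\<close>; differentiate at \<open>t = 0\<close>.\<close>

lemma integral_partial_eq_0:
  fixes \<psi> :: "real ^ 'n::finite \<Rightarrow> real"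
  assumes "smooth \<psi>" "compact K" "\<And>x. x \<notin> K \<Longrightarrow> \<psi> x = 0"
  shows "(LINT x|lborel. partial j \<psi> x) = 0"
proof -
  define e :: "real ^ 'n" where "e = axis j 1"
  define t where "t = (\<lambda>m. 1 / real (Suc m))"
  have t: "0 < t m" "t m \<le> 1" for m by (auto simp: t_def)
  define s where "s = (\<lambda>m x. (\<psi> (t m *\<^sub>R e + x) - \<psi> x) / t m)"
  obtain R where R: "\<And>x. x \<in> K \<Longrightarrow> norm x \<le> R"
    using compact_imp_bounded[OF assms(2)] unfolding bounded_iff by blast
  \<comment> \<open>Shifts have length at most 1: a quotient at a point of norm at most R + 1 is a
    derivative at a point of norm at most R + 2, and beyond R + 1 both values of \<psi>
    vanish.\<close>
  define C :: "(real ^ 'n) set" where "C = cball 0 (R + 2)"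
  have "bounded (partial j \<psi> ` C)"
    by (intro compact_imp_bounded compact_continuous_image smooth_continuous smooth_partial assms(1))
       (simp add: C_def)
  then obtain B where B: "\<And>x. x \<in> C \<Longrightarrow> \<bar>partial j \<psi> x\<bar> \<le> B"
    unfolding bounded_iff by auto
  have quot: "\<exists>y. dist y x \<le> t m \<and> s m x = partial j \<psi> y" for m x
  proof -
    obtain r where r: "0 < r" "r < t m" "\<psi> (x + t m *\<^sub>R e) - \<psi> x = t m * partial j \<psi> (x + r *\<^sub>R e)"
      unfolding e_def by (rule partial_mvt[OF assms(1) t(1)])
    then show ?thesis
      using t(1)[of m] unfolding s_def
      by (intro exI[of _ "x + r *\<^sub>R e"]) (auto simp: dist_norm e_def norm_axis_1 add.commute)
  qed
  have bound: "\<bar>s m x\<bar> \<le> indicator C x *\<^sub>R B" for m x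
  proof (cases "norm x \<le> R + 1")
    case True
    obtain y where y: "dist y x \<le> t m" "s m x = partial j \<psi> y" using quot by blast
    have "y \<in> C" "x \<in> C" using y(1) t(2)[of m] True norm_triangle_sub[of y x] by (auto simp: C_def dist_norm)
    then show ?thesis using B[of y] y(2) by simp
  next
    case False
    have "norm x \<le> norm (t m *\<^sub>R e + x) + norm (t m *\<^sub>R e)"
      by (metis add_diff_cancel_left' norm_triangle_ineq4)
    then have "norm (t m *\<^sub>R e + x) > R"
      using False t(1,2)[of m] by (simp add: e_def norm_axis_1)
    then have "s m x = 0" using assms(3) R False unfolding s_def by (smt (verit) diff_self div_0)
    then show ?thesis using B[of x] by (auto simp: indicator_def)
  qed
  have int: "integrable lborel \<psi>"
    by (rule integrable_compact_support[OF smooth_continuous assms(2,3)]) (use assms(1) in auto)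
  have trans: "integrable lborel (\<lambda>x. \<psi> (c + x))" "(LINT x|lborel. \<psi> (c + x)) = (LINT x|lborel. \<psi> x)" for c
  proof -
    have m: "\<psi> \<in> borel_measurable borel"
      by (intro borel_measurable_continuous_onI smooth_continuous assms(1))
    have "integrable (distr lborel borel ((+) c)) \<psi>" using int by (simp add: lborel_distr_plus)
    then show "integrable lborel (\<lambda>x. \<psi> (c + x))" using m by (subst (asm) integrable_distr_eq) auto
    have "(LINT x|lborel. \<psi> x) = (LINT x|distr lborel borel ((+) c). \<psi> x)" by (simp add: lborel_distr_plus)
    then show "(LINT x|lborel. \<psi> (c + x)) = (LINT x|lborel. \<psi> x)" using m by (subst (asm) integral_distr) auto
  qed
  have s0: "(LINT x|lborel. s m x) = 0" for m
    unfolding s_def using trans int by simp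
  have lim: "(\<lambda>m. s m x) \<longlonglongrightarrow> partial j \<psi> x" for x
  proof -
    obtain y where y: "\<And>m. dist (y m) x \<le> t m" "\<And>m. s m x = partial j \<psi> (y m)" using quot[where x = x] by metis
    have t0: "t \<longlonglongrightarrow> 0"
      unfolding t_def using LIMSEQ_inverse_real_of_nat by (simp add: inverse_eq_divide)
    have "y \<longlonglongrightarrow> x"
      by (rule metric_tendsto_imp_tendsto[OF t0]) (use y(1) t in \<open>auto simp: less_imp_le\<close>)
    then show ?thesis
      unfolding y(2) by (rule isCont_tendsto_compose[OF smooth_isCont[OF smooth_partial[OF assms(1)]]])
  qed
  have "(\<lambda>m. LINT x|lborel. s m x) \<longlonglongrightarrow> (LINT x|lborel. partial j \<psi> x)"
  proof (rule integral_dominated_convergence[where w = "\<lambda>x. indicator C x *\<^sub>R B"])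
    show "integrable lborel (\<lambda>x. indicator C x *\<^sub>R B)"
      by (rule borel_integrable_compact) (auto simp: C_def)
    show "partial j \<psi> \<in> borel_measurable lborel"
      using borel_measurable_continuous_onI[OF smooth_continuous[OF smooth_partial[OF assms(1)]]] by simp
    show "s m \<in> borel_measurable lborel" for m
      unfolding s_def using trans(1) int by (intro borel_measurable_integrable) simp
  qed (use bound lim in auto)
  then show ?thesis
    unfolding s0 by (simp add: LIMSEQ_const_iff)
qed

lemma test_functionsE:
  assumes "\<psi> \<in> test_functions D"
  obtains K where "smooth \<psi>" "compact K" "K \<subseteq> D" "\<And>x. x \<notin> K \<Longrightarrow> \<psi> x = 0"
  using assms unfolding test_functions_def by blast

lemma integral_by_parts:
  fixes g \<psi> :: "real ^ 'n::finite \<Rightarrow> real"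
  assumes "smooth g" "\<psi> \<in> test_functions D"
  shows "(LINT x:D|lebesgue. g x * partial j \<psi> x) = - (LINT x:D|lebesgue. partial j g x * \<psi> x)"
proof -
  obtain K where K: "smooth \<psi>" "compact K" "K \<subseteq> D" "\<And>x. x \<notin> K \<Longrightarrow> \<psi> x = 0"
    using test_functionsE[OF assms(2)] by blast
  have K': "x \<notin> K \<Longrightarrow> partial j \<psi> x = 0" for x
    by (rule partial_eq_0_outside[OF K(2,4)])
  have D: "(LINT x:D|lebesgue. h x) = (LINT x|lborel. h x)" if "smooth h" "\<And>x. x \<notin> K \<Longrightarrow> h x = 0" for h :: "real ^ 'n \<Rightarrow> real"
  proof -
    have "(LINT x:D|lebesgue. h x) = (LINT x|lebesgue. h x)"
      unfolding set_lebesgue_integral_def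
      by (rule Bochner_Integration.integral_cong) (use K(3) that(2) in \<open>auto simp: indicator_def\<close>)
    then show ?thesis using lebesgue_integral_continuous[OF smooth_continuous[OF that(1)]] by simp
  qed
  have int: "integrable lborel h" if "smooth h" "\<And>x. x \<notin> K \<Longrightarrow> h x = 0" for h :: "real ^ 'n \<Rightarrow> real"
    by (rule integrable_compact_support[OF smooth_continuous[OF that(1)] K(2) that(2)])
  have sm: "smooth (\<lambda>x. g x * partial j \<psi> x)" "smooth (\<lambda>x. partial j g x * \<psi> x)"
    using assms(1) K(1) by (auto intro: smooth_partial)
  have "0 = (LINT x|lborel. partial j (\<lambda>x. g x * \<psi> x) x)"
    by (rule integral_partial_eq_0[OF _ K(2), symmetric]) (use assms(1) K in auto)
  also have "\<dots> = (LINT x|lborel. partial j g x * \<psi> x + g x * partial j \<psi> x)"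
    using assms(1) K(1) by (simp add: partial_mult smooth_differentiable)
  also have "\<dots> = (LINT x|lborel. partial j g x * \<psi> x) + (LINT x|lborel. g x * partial j \<psi> x)"
    by (intro Bochner_Integration.integral_add int sm) (use K' K(4) in auto)
  finally show ?thesis
    using D[OF sm(1)] D[OF sm(2)] K' K(4) by simp
qed

section \<open>Integrability on a bounded open set\<close>

lemma set_integrable_smooth:
  fixes g :: "real ^ 'n::finite \<Rightarrow> real"
  assumes "open D" "bounded D" "smooth g"
  shows "set_integrable lebesgue D g"
proof -
  have "integrable lborel (\<lambda>x. indicator (closure D) x *\<^sub>R g x)"
    using assms by (intro borel_integrable_compact smooth_continuous) auto
  then have "integrable lebesgue (\<lambda>x. indicator (closure D) x *\<^sub>R g x)"
    by (subst integrable_completion) auto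
  then show ?thesis
    using set_integrable_subset[of lebesgue "closure D" g D] assms(1)
    by (simp add: set_integrable_def closure_subset)
qed

lemma set_borel_measurable_smooth:
  fixes g :: "real ^ 'n::finite \<Rightarrow> real"
  assumes "open D" "smooth g"
  shows "set_borel_measurable lebesgue D g"
proof -
  have "g \<in> borel_measurable lebesgue"
    using borel_measurable_continuous_onI[OF smooth_continuous[OF assms(2)]]
    by (intro measurable_completion) simp
  then show ?thesis
    using open_in_sets_lebesgue[OF assms(1)] unfolding set_borel_measurable_def
    by (intro borel_measurable_scaleR borel_measurable_indicator)
qed

lemma smooth_bounded:
  fixes g :: "real ^ 'n::finite \<Rightarrow> real"
  assumes "bounded D" "smooth g"
  shows "\<exists>B\<ge>0. \<forall>x\<in>D. \<bar>g x\<bar> \<le> B"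
proof -
  have "bounded (g ` closure D)"
    using assms by (intro compact_imp_bounded compact_continuous_image smooth_continuous) auto
  then obtain B where B: "\<And>x. x \<in> closure D \<Longrightarrow> \<bar>g x\<bar> \<le> B"
    unfolding bounded_iff by auto
  have "\<bar>g x\<bar> \<le> max 0 B" if "x \<in> D" for x
    using B[of x] closure_subset that by fastforce
  then show ?thesis by (intro exI[of _ "max 0 B"]) simp
qed

lemma set_integrable_mult_smooth:
  fixes g h :: "real ^ 'n::finite \<Rightarrow> real"
  assumes "open D" "bounded D" "set_integrable lebesgue D h" "smooth g"
  shows "set_integrable lebesgue D (\<lambda>x. h x * g x)"
proof -
  obtain B where B: "0 \<le> B" "\<And>x. x \<in> D \<Longrightarrow> \<bar>g x\<bar> \<le> B"
    using smooth_bounded[OF assms(2,4)] by blast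
  have "g \<in> borel_measurable lebesgue"
    using borel_measurable_continuous_onI[OF smooth_continuous[OF assms(4)]]
    by (intro measurable_completion) simp
  moreover have "(\<lambda>x. indicator D x *\<^sub>R h x) \<in> borel_measurable lebesgue"
    using assms(3) unfolding set_integrable_def by (rule borel_measurable_integrable)
  ultimately have "(\<lambda>x. (indicator D x *\<^sub>R h x) * g x) \<in> borel_measurable lebesgue"
    by (rule borel_measurable_times[rotated])
  then have m: "(\<lambda>x. indicator D x *\<^sub>R (h x * g x)) \<in> borel_measurable lebesgue"
    by (simp add: mult.assoc)
  have "integrable lebesgue (\<lambda>x. B * (indicator D x *\<^sub>R h x))"
    using assms(3) unfolding set_integrable_def by (rule integrable_mult_right)
  then show ?thesis
    unfolding set_integrable_def
    by (rule Bochner_Integration.integrable_bound[OF _ m])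
      (auto simp: indicator_def abs_mult B(1) mult.commute[of _ "\<bar>g _\<bar>"] intro!: mult_right_mono B(2))
qed

lemma set_integral_dominated_convergence:
  fixes f w :: "'a \<Rightarrow> real"
  assumes "set_integrable M A w"
    and "\<And>m. set_integrable M A (s m)" "set_borel_measurable M A f"
    and "\<And>m x. x \<in> A \<Longrightarrow> \<bar>s m x\<bar> \<le> w x" "\<And>x. x \<in> A \<Longrightarrow> (\<lambda>m. s m x) \<longlonglongrightarrow> f x"
  shows "(\<lambda>m. LINT x:A|M. s m x) \<longlonglongrightarrow> (LINT x:A|M. f x)"
  unfolding set_lebesgue_integral_def
proof (rule integral_dominated_convergence[where w = "\<lambda>x. indicator A x *\<^sub>R w x"])
  show "(\<lambda>x. indicat_real A x *\<^sub>R s m x) \<in> borel_measurable M" for m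
    using assms(2)[of m] unfolding set_integrable_def by (rule borel_measurable_integrable)
qed (use assms in \<open>auto simp: set_integrable_def set_borel_measurable_def indicator_def\<close>)

lemma L2_forms_smooth:
  fixes \<alpha> :: "'n::{finite,linorder} form"
  assumes "open D" "bounded D" "\<And>x. x \<in> D \<Longrightarrow> \<alpha> x \<in> covectors q" "\<And>I. smooth (\<lambda>x. \<alpha> x I)" "smooth \<phi>"
  shows "\<alpha> \<in> L2_forms q D \<phi>"
  unfolding L2_forms_def cov_inner_def using assms
  by (auto intro!: set_borel_measurable_smooth set_integrable_smooth smooth_mult smooth_exp)

text \<open>The weight is removed by multiplying with \<open>exp (\<phi> x)\<close>, which is
  bounded on \<open>D\<close>; then |t| \<le> 1 + t^2 and the finite measure of \<open>D\<close>
  pass from square integrable to integrable.\<close>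

lemma L2_forms_set_integrable:
  fixes u :: "'n::{finite,linorder} form"
  assumes "open D" "bounded D" "u \<in> L2_forms q D \<phi>" "smooth \<phi>" "K \<in> incr_indices q"
  shows "set_integrable lebesgue D (\<lambda>x. u x K)"
proof -
  let ?c = "\<lambda>x. cov_inner q (u x) (u x)"
  have "set_integrable lebesgue D (\<lambda>x. ?c x * exp (- \<phi> x) * exp (\<phi> x))"
    by (rule set_integrable_mult_smooth[OF assms(1,2)]) (use assms in \<open>auto simp: L2_forms_def\<close>)
  then have "set_integrable lebesgue D (\<lambda>x. 1 + ?c x)"
    by (intro set_integral_add(1)[OF set_integrable_smooth[OF assms(1,2) smooth_const]])
      (simp add: mult.assoc exp_add[symmetric])
  then show ?thesis
    unfolding set_integrable_def
  proof (rule Bochner_Integration.integrable_bound)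
    show "(\<lambda>x. indicat_real D x *\<^sub>R u x K) \<in> borel_measurable lebesgue"
      using assms(3,5) by (auto simp: L2_forms_def set_borel_measurable_def)
    have "\<bar>u x K\<bar> \<le> 1 + ?c x" for x
    proof -
      have "u x K * u x K \<le> ?c x"
        unfolding cov_inner_def by (rule member_le_sum[OF assms(5)]) auto
      moreover have "\<bar>u x K\<bar> \<le> 1 + u x K * u x K"
        using sum_squares_bound[of "\<bar>u x K\<bar>" 1] by (simp add: power2_eq_square)
      ultimately show ?thesis by linarith
    qed
    then show "AE x in lebesgue. norm (indicat_real D x *\<^sub>R u x K) \<le> norm (indicat_real D x *\<^sub>R (1 + ?c x))"
      by (auto simp: indicator_def intro!: AE_I2 order_trans[OF _ abs_ge_self])
  qed
qed

section \<open>The classical exterior derivative as a distributional one\<close>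

lemma remove_nth_incr_indices:
  assumes "J \<in> incr_indices (Suc q)" "k < Suc q"
  shows "take k J @ drop (Suc k) J \<in> incr_indices q"
proof -
  have J: "take k J @ J ! k # drop (Suc k) J = J"
    using assms by (simp add: incr_indices_def id_take_nth_drop[symmetric])
  have "sorted_wrt (<) (take k J @ J ! k # drop (Suc k) J)"
    unfolding J using assms by (simp add: incr_indices_def)
  then show ?thesis
    using assms by (auto simp: incr_indices_def sorted_wrt_append)
qed

definition smooth_d :: "'n::{finite,linorder} form \<Rightarrow> 'n form"
  where "smooth_d \<beta> x = alt_sum (\<lambda>j K. partial j (\<lambda>x. \<beta> x K) x)"

text \<open>Test functions vanish near the boundary, so integration by parts leaves no boundary
  term. This admits \<beta> = d*f, whose normal component is uncontrolled.\<close>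

lemma ext_d_smooth:
  fixes \<beta> :: "'n::{finite,linorder} form"
  assumes "open D" "bounded D" "\<And>x. \<beta> x \<in> covectors q" "\<And>K. smooth (\<lambda>x. \<beta> x K)" "smooth \<phi>"
    and "\<And>x. smooth_d \<beta> x \<in> covectors (Suc q)"
  shows "ext_d (Suc q) D \<phi> \<beta> (smooth_d \<beta>)"
proof -
  have sd: "smooth (\<lambda>x. smooth_d \<beta> x J)" for J
    unfolding smooth_d_def by (intro smooth_alt_sum smooth_partial assms(4))
  have "(LINT x:D|lebesgue. smooth_d \<beta> x J * \<psi> x) =
      - (\<Sum>k<Suc q. (-1) ^ k * (LINT x:D|lebesgue. \<beta> x (take k J @ drop (Suc k) J) * partial (J ! k) \<psi> x))"
    if "J \<in> incr_indices (Suc q)" "\<psi> \<in> test_functions D" for J \<psi>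
  proof -
    have "smooth \<psi>" using that(2) by (rule test_functionsE)
    have len: "length J = Suc q" using that(1) by (simp add: incr_indices_def)
    have "(LINT x:D|lebesgue. smooth_d \<beta> x J * \<psi> x)
        = (LINT x:D|lebesgue. (\<Sum>k<Suc q. (-1) ^ k * (partial (J ! k) (\<lambda>x. \<beta> x (take k J @ drop (Suc k) J)) x * \<psi> x)))"
      by (simp add: smooth_d_def alt_sum_eq_sum len sum_distrib_right mult.assoc del: sum.lessThan_Suc)
    also have "\<dots> = (\<Sum>k<Suc q. (-1) ^ k * (LINT x:D|lebesgue. partial (J ! k) (\<lambda>x. \<beta> x (take k J @ drop (Suc k) J)) x * \<psi> x))"
      unfolding set_integral_mult_right[symmetric]
      by (rule set_integral_sum(2)) (use \<open>smooth \<psi>\<close> in \<open>auto intro!: set_integrable_smooth smooth_mult smooth_partial assms\<close>)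
    also have "\<dots> = (\<Sum>k<Suc q. - ((-1) ^ k * (LINT x:D|lebesgue. \<beta> x (take k J @ drop (Suc k) J) * partial (J ! k) \<psi> x)))"
      by (simp only: integral_by_parts[OF assms(4) that(2)] mult_minus_right minus_minus)
    finally show ?thesis by (simp only: sum_negf)
  qed
  then show ?thesis
    unfolding ext_d_def using assms sd by (auto intro!: L2_forms_smooth)
qed

section \<open>The formal adjoint on a domain with boundary\<close>

lemma covectors_sum:
  assumes "\<And>s. s \<in> S \<Longrightarrow> \<omega> s \<in> covectors q"
  shows "(\<lambda>I. \<Sum>s\<in>S. \<omega> s I) \<in> covectors q"
  using assms unfolding covectors_def by (auto simp: sum_negf intro!: sum.neutral)

lemma covectors_partial:
  assumes "\<And>x. F x \<in> covectors q" "\<And>I. smooth (\<lambda>x. F x I)"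
  shows "(\<lambda>I. partial j (\<lambda>x. F x I) x) \<in> covectors q"
proof -
  have "(\<lambda>x. F x I) = (\<lambda>x. 0)" if "length I \<noteq> q" for I
    using assms(1) that by (auto simp: covectors_def)
  moreover have "(\<lambda>x. F x (I[i := I ! j, j := I ! i])) = (\<lambda>x. - F x I)"
    if "length I = q" "i < q" "j < q" "i \<noteq> j" for I i j
    using assms(1) that by (auto simp: covectors_def)
  ultimately show ?thesis
    unfolding covectors_def by (auto simp: partial_const partial_minus assms(2))
qed

text \<open>Formal adjoint of d for the weight exp(-\<phi>): minus exp(\<phi>) times the divergence
  of exp(-\<phi>) f in the first index.\<close>

definition d_adj :: "(real ^ 'n::finite \<Rightarrow> real) \<Rightarrow> 'n form \<Rightarrow> 'n form"
  where "d_adj \<phi> f x K = (\<Sum>j\<in>UNIV. partial j \<phi> x * f x (j # K) - partial j (\<lambda>x. f x (j # K)) x)"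

lemma d_adj_covectors:
  assumes "\<And>x. f x \<in> covectors (Suc q)" "\<And>I. smooth (\<lambda>x. f x I)"
  shows "d_adj \<phi> f x \<in> covectors q"
proof -
  have "(\<lambda>K. partial j (\<lambda>x. f x (j # K)) x) \<in> covectors q" for j
    by (rule covectors_partial[OF covectors_ConsD[OF assms(1)] assms(2)])
  then show ?thesis
    unfolding d_adj_def[abs_def]
    by (intro covectors_sum covectors_diff covectors_scale covectors_ConsD[OF assms(1)])
qed

lemma smooth_d_adj:
  assumes "\<And>I. smooth (\<lambda>x. f x I)" "smooth \<phi>"
  shows "smooth (\<lambda>x. d_adj \<phi> f x K)"
  unfolding d_adj_def by (intro smooth_sum smooth_diff smooth_mult smooth_partial assms)

lemma sublevel_open: "smooth \<rho> \<Longrightarrow> open {x. \<rho> x < c}"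
  using open_Collect_less[OF smooth_continuous, of \<rho> "\<lambda>_. c"] by simp

text \<open>Multiplying by the cutoffs \<open>flat 1 (- m \<rho> - 1)\<close> turns the coefficients of \<open>e\<^sup>-\<^sup>\<phi> f\<close> into test
  functions. The cutoffs have gradients of size \<open>1 / \<bar>\<rho>\<bar>\<close>, which the decay of the normal component
  of \<open>f\<close> compensates.\<close>

lemma L2_inner_d_adj:
  fixes f :: "'n::{finite,linorder} form"
  assumes "bounded D" "smooth \<rho>" "D = {x. \<rho> x < 0}" "smooth \<phi>"
    and f: "\<And>x. f x \<in> covectors (Suc q)" "\<And>I. smooth (\<lambda>x. f x I)"
    and C: "\<And>x K. x \<in> D \<Longrightarrow> K \<in> incr_indices q \<Longrightarrow> \<bar>contract (\<lambda>j. partial j \<rho> x) (f x) K\<bar> \<le> C * \<bar>\<rho> x\<bar>"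
    and uv: "ext_d (Suc q) D \<phi> u v"
  shows "L2_inner (Suc q) D \<phi> v f = L2_inner q D \<phi> u (d_adj \<phi> f)"
proof -
  have D: "open D" using sublevel_open assms by blast
  have uL: "u \<in> L2_forms q D \<phi>" and vL: "v \<in> L2_forms (Suc q) D \<phi>"
    and weak: "\<And>J \<psi>. J \<in> incr_indices (Suc q) \<Longrightarrow> \<psi> \<in> test_functions D \<Longrightarrow>
      (LINT x:D|lebesgue. v x J * \<psi> x) = - (\<Sum>k<Suc q. (-1) ^ k *
          (LINT x:D|lebesgue. u x (take k J @ drop (Suc k) J) * partial (J ! k) \<psi> x))"
    using uv unfolding ext_d_def by auto
  define \<beta> where "\<beta> = d_adj \<phi> f"
  define \<kappa> where "\<kappa> = (\<lambda>m x. flat 1 (real m * (- \<rho> x) - 1))"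
  define \<kappa>' where "\<kappa>' = (\<lambda>m x. flat [:0, 0, 1:] (real m * (- \<rho> x) - 1))"
  define \<psi> where "\<psi> = (\<lambda>m J x. \<kappa> m x * (f x J * exp (- \<phi> x)))"
  \<comment> \<open>Minus the divergence of the truncated coefficients
    \<open>\<psi> m (j # K)\<close>. In the first summand the derivative falls on the cutoff, and
    only the normal component of \<open>f\<close> appears.\<close>
  define T where "T = (\<lambda>m x K. (real m * \<kappa>' m x * contract (\<lambda>j. partial j \<rho> x) (f x) K + \<kappa> m x * \<beta> x K) * exp (- \<phi> x))"
  have smooth_\<beta>: "smooth (\<lambda>x. \<beta> x K)" for K
    unfolding \<beta>_def by (rule smooth_d_adj[OF f(2) assms(4)])
  have smooth_\<kappa>: "smooth (\<kappa> m)" "smooth (\<kappa>' m)" for m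
    unfolding \<kappa>_def \<kappa>'_def using assms(2) by (intro smooth_flat smooth_diff smooth_mult smooth_const smooth_minus; simp)+
  have smooth_e: "smooth (\<lambda>x. exp (- \<phi> x))"
    using assms(4) by auto
  have smooth_\<psi>: "smooth (\<psi> m J)" for m J
    unfolding \<psi>_def by (intro smooth_mult smooth_\<kappa> smooth_e f(2))
  have smooth_T: "smooth (\<lambda>x. T m x K)" for m K
    unfolding T_def contract_def using assms(2)
    by (intro smooth_mult smooth_add smooth_\<kappa> smooth_\<beta> smooth_const smooth_sum smooth_partial smooth_e f(2))
  have test: "\<psi> m J \<in> test_functions D" for m J
  proof -
    \<comment> \<open>\<open>flat 1\<close> vanishes at nonpositive arguments, so
      \<open>\<psi> m J\<close> is supported where m |\<rho>| \<ge> 1 with \<rho> negative; this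
      keeps the support away from the boundary.\<close>
    let ?K = "closure D \<inter> {x. 0 \<le> real m * (- \<rho> x) - 1}"
    have "closed {x. 0 \<le> real m * (- \<rho> x) - 1}"
      by (intro closed_Collect_le continuous_intros smooth_continuous assms(2))
    then have "compact ?K"
      using assms(1) by (intro compact_Int_closed) auto
    moreover have "?K \<subseteq> D"
    proof
      fix x assume "x \<in> ?K"
      then have "0 < real m * (- \<rho> x)" by simp
      then have "\<rho> x < 0" by (simp add: mult_less_0_iff)
      then show "x \<in> D" by (simp add: assms(3))
    qed
    moreover have "\<psi> m J x = 0" if "x \<notin> ?K" for x
    proof -
      have "\<not> 0 < real m * (- \<rho> x) - 1"
      proof (cases "x \<in> closure D")
        case False
        then have "x \<notin> D" using closure_subset by blast
        then have "0 \<le> \<rho> x" by (simp add: assms(3))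
        then have "0 \<le> real m * \<rho> x" by simp
        then show ?thesis by simp
      qed (use that in auto)
      then show ?thesis by (simp add: \<psi>_def \<kappa>_def flat_def)
    qed
    ultimately show ?thesis
      unfolding test_functions_def using smooth_\<psi> by blast
  qed
  have partial_\<psi>: "partial j (\<psi> m J) x = (- real m * \<kappa>' m x * partial j \<rho> x * f x J
      + \<kappa> m x * (partial j (\<lambda>x. f x J) x - partial j \<phi> x * f x J)) * exp (- \<phi> x)" for j m J x
  proof -
    have "((\<lambda>t. flat 1 (real m * (- t) - 1)) has_real_derivative \<kappa>' m x * (- real m)) (at (\<rho> x))"
      unfolding \<kappa>'_def
      by (rule DERIV_chain2[where f = "flat 1"]) (use has_derivative_flat[of 1] in \<open>auto intro!: derivative_eq_intros simp: one_pCons pderiv_pCons\<close>)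
    then have 1: "partial j (\<kappa> m) x = \<kappa>' m x * (- real m) * partial j \<rho> x"
      unfolding \<kappa>_def by (rule partial_compose[OF _ smooth_differentiable[OF assms(2)]])
    have "((\<lambda>t. exp (- t)) has_real_derivative - exp (- \<phi> x)) (at (\<phi> x))"
      by (auto intro!: derivative_eq_intros)
    then have 2: "partial j (\<lambda>x. exp (- \<phi> x)) x = - exp (- \<phi> x) * partial j \<phi> x"
      by (rule partial_compose[OF _ smooth_differentiable[OF assms(4)]])
    show ?thesis
      unfolding \<psi>_def
      by (simp add: partial_mult smooth_differentiable smooth_\<kappa> smooth_e f(2) smooth_mult 1 2)
        (simp add: algebra_simps)
  qed
  have sum_\<psi>: "(\<Sum>j\<in>UNIV. partial j (\<psi> m (j # K)) x) = - T m x K" for m x K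
    unfolding partial_\<psi> T_def \<beta>_def d_adj_def contract_def
    by (simp add: sum_distrib_left sum_distrib_right sum.distrib[symmetric] sum_negf[symmetric])
       (intro sum.cong refl, simp add: algebra_simps)
  have int_u: "set_integrable lebesgue D (\<lambda>x. u x K * g x)" if "K \<in> incr_indices q" "smooth g" for K g
    by (intro set_integrable_mult_smooth L2_forms_set_integrable[OF D assms(1) uL assms(4)] that D assms(1))
  have int_v: "set_integrable lebesgue D (\<lambda>x. v x J * g x)" if "J \<in> incr_indices (Suc q)" "smooth g" for J g
    by (intro set_integrable_mult_smooth L2_forms_set_integrable[OF D assms(1) vL assms(4)] that D assms(1))
  have eq: "(LINT x:D|lebesgue. \<kappa> m x * (cov_inner (Suc q) (v x) (f x) * exp (- \<phi> x)))
      = (LINT x:D|lebesgue. cov_inner q (u x) (T m x))" for m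
  proof -
    have "(LINT x:D|lebesgue. \<kappa> m x * (cov_inner (Suc q) (v x) (f x) * exp (- \<phi> x)))
        = (LINT x:D|lebesgue. (\<Sum>J\<in>incr_indices (Suc q). v x J * \<psi> m J x))"
      by (simp add: cov_inner_def \<psi>_def sum_distrib_left sum_distrib_right mult_ac)
    also have "\<dots> = (\<Sum>J\<in>incr_indices (Suc q). (LINT x:D|lebesgue. v x J * \<psi> m J x))"
      by (intro set_integral_sum(2) int_v smooth_\<psi>)
    also have "\<dots> = (\<Sum>J\<in>incr_indices (Suc q). - (LINT x:D|lebesgue. alt_sum (\<lambda>j K. u x K * partial j (\<psi> m J) x) J))"
    proof (rule sum.cong[OF refl])
      fix J :: "'n list" assume J: "J \<in> incr_indices (Suc q)"
      then have len: "length J = Suc q" by (simp add: incr_indices_def)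
      have "(LINT x:D|lebesgue. alt_sum (\<lambda>j K. u x K * partial j (\<psi> m J) x) J)
        = (\<Sum>k<Suc q. LINT x:D|lebesgue. (-1) ^ k * (u x (take k J @ drop (Suc k) J) * partial (J ! k) (\<psi> m J) x))"
        unfolding alt_sum_eq_sum len
        by (rule set_integral_sum(2), rule set_integrable_mult_right, rule int_u)
          (use J in \<open>auto intro!: remove_nth_incr_indices smooth_partial smooth_\<psi>\<close>)
      then show "(LINT x:D|lebesgue. v x J * \<psi> m J x) = - (LINT x:D|lebesgue. alt_sum (\<lambda>j K. u x K * partial j (\<psi> m J) x) J)"
        using weak[OF J test] by simp
    qed
    also have "\<dots> = - (LINT x:D|lebesgue. (\<Sum>J\<in>incr_indices (Suc q). alt_sum (\<lambda>j K. u x K * partial j (\<psi> m J) x) J))"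
    proof -
      have "set_integrable lebesgue D (\<lambda>x. alt_sum (\<lambda>j K. u x K * partial j (\<psi> m J) x) J)"
        if J: "J \<in> incr_indices (Suc q)" for J
      proof -
        have len: "length J = Suc q" using J by (simp add: incr_indices_def)
        show ?thesis
          unfolding alt_sum_eq_sum len
          by (rule set_integral_sum(1), rule set_integrable_mult_right, rule int_u)
            (use J in \<open>auto intro!: remove_nth_incr_indices smooth_partial smooth_\<psi>\<close>)
      qed
      then show ?thesis by (simp add: set_integral_sum(2) sum_negf)
    qed
    also have "\<dots> = - (LINT x:D|lebesgue. - cov_inner q (u x) (T m x))"
    proof -
      have "(\<Sum>J\<in>incr_indices (Suc q). alt_sum (\<lambda>j K. u x K * partial j (\<psi> m J) x) J) = - cov_inner q (u x) (T m x)"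
        if "x \<in> D" for x
      proof -
        have "(\<lambda>J. \<psi> m J y) \<in> covectors (Suc q)" for y
          using covectors_scale[OF f(1)[of y], of "\<kappa> m y * exp (- \<phi> y)"] by (simp add: \<psi>_def mult_ac)
        then have "(\<lambda>J. partial j (\<psi> m J) x) \<in> covectors (Suc q)" for j
          using covectors_partial[of "\<lambda>x J. \<psi> m J x"] smooth_\<psi> by simp
        moreover have "u x \<in> covectors q" using uL that by (simp add: L2_forms_def)
        ultimately have "(\<Sum>J\<in>incr_indices (Suc q). alt_sum (\<lambda>j K. u x K * partial j (\<psi> m J) x) J)
          = cov_inner q (u x) (\<lambda>K. \<Sum>j\<in>UNIV. partial j (\<psi> m (j # K)) x)"
          by (rule cov_inner_alt_sum)
        then show ?thesis unfolding sum_\<psi> by (simp add: cov_inner_def sum_negf)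
      qed
      then show ?thesis
        by (intro arg_cong[where f = uminus] set_lebesgue_integral_cong open_in_sets_lebesgue D) auto
    qed
    finally show ?thesis
      by (simp add: set_lebesgue_integral_def)
  qed
  have int_vf: "set_integrable lebesgue D (\<lambda>x. g x * (cov_inner (Suc q) (v x) (f x) * exp (- \<phi> x)))" if "smooth g" for g
  proof -
    have "set_integrable lebesgue D (\<lambda>x. \<Sum>J\<in>incr_indices (Suc q). v x J * (g x * (f x J * exp (- \<phi> x))))"
      by (intro set_integral_sum(1) int_v smooth_mult that f(2) smooth_e)
    then show ?thesis by (simp add: cov_inner_def sum_distrib_left sum_distrib_right mult_ac)
  qed
  have int_uT: "set_integrable lebesgue D (\<lambda>x. cov_inner q (u x) (\<lambda>K. g K x))" if "\<And>K. smooth (g K)" for g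
    unfolding cov_inner_def by (intro set_integral_sum(1) int_u that)
  have lim_\<kappa>: "(\<lambda>m. \<kappa> m x) \<longlonglongrightarrow> 1" if "x \<in> D" for x
    unfolding \<kappa>_def by (rule flat_tendsto) (use that in \<open>simp add: assms(3)\<close>)
  have "(\<lambda>m. LINT x:D|lebesgue. \<kappa> m x * (cov_inner (Suc q) (v x) (f x) * exp (- \<phi> x))) \<longlonglongrightarrow> L2_inner (Suc q) D \<phi> v f"
    unfolding L2_inner_def
  proof (rule set_integral_dominated_convergence)
    show "set_integrable lebesgue D (\<lambda>x. \<bar>1 * (cov_inner (Suc q) (v x) (f x) * exp (- \<phi> x))\<bar>)"
      by (intro set_integrable_abs int_vf) simp
    show "set_integrable lebesgue D (\<lambda>x. \<kappa> m x * (cov_inner (Suc q) (v x) (f x) * exp (- \<phi> x)))" for m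
      by (rule int_vf) (rule smooth_\<kappa>)
    show "set_borel_measurable lebesgue D (\<lambda>x. cov_inner (Suc q) (v x) (f x) * exp (- \<phi> x))"
      using int_vf[of "\<lambda>x. 1"] unfolding set_borel_measurable_def set_integrable_def
      by (simp add: borel_measurable_integrable)
    show "\<bar>\<kappa> m x * (cov_inner (Suc q) (v x) (f x) * exp (- \<phi> x))\<bar> \<le> \<bar>1 * (cov_inner (Suc q) (v x) (f x) * exp (- \<phi> x))\<bar>" for m x
      unfolding abs_mult[of "\<kappa> m x"] abs_mult[of 1] using flat_1_bounds
      by (intro mult_right_mono) (auto simp: \<kappa>_def)
    show "(\<lambda>m. \<kappa> m x * (cov_inner (Suc q) (v x) (f x) * exp (- \<phi> x))) \<longlonglongrightarrow> cov_inner (Suc q) (v x) (f x) * exp (- \<phi> x)"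
      if "x \<in> D" for x
      using tendsto_mult_right[OF lim_\<kappa>[OF that], of "cov_inner (Suc q) (v x) (f x) * exp (- \<phi> x)"] by simp
  qed
  moreover have "(\<lambda>m. LINT x:D|lebesgue. cov_inner q (u x) (T m x)) \<longlonglongrightarrow> L2_inner q D \<phi> u (d_adj \<phi> f)"
  proof -
    obtain B where B: "\<And>K. 0 \<le> B K" "\<And>K x. x \<in> D \<Longrightarrow> \<bar>\<beta> x K\<bar> \<le> B K"
      using smooth_bounded[OF assms(1) smooth_\<beta>] by metis
    obtain Be where Be: "0 \<le> Be" "\<And>x. x \<in> D \<Longrightarrow> \<bar>exp (- \<phi> x)\<bar> \<le> Be"
      using smooth_bounded[OF assms(1) smooth_e] by metis
    \<comment> \<open>The cutoff gradient grows like m, but hypothesis \<open>C\<close> supplies a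
      factor |\<rho>|, and m |\<rho>| \<kappa>' \<le> 2 by \<open>flat_deriv_bounds\<close>. The
      bound is therefore independent of m.\<close>
    have T_bound: "\<bar>T m x K\<bar> \<le> (2 * \<bar>C\<bar> + B K) * Be" if x: "x \<in> D" and K: "K \<in> incr_indices q" for m x K
    proof -
      have "\<bar>real m * \<kappa>' m x * contract (\<lambda>j. partial j \<rho> x) (f x) K\<bar> \<le> real m * \<kappa>' m x * (\<bar>C\<bar> * (- \<rho> x))"
      proof -
        have "\<bar>contract (\<lambda>j. partial j \<rho> x) (f x) K\<bar> \<le> \<bar>C\<bar> * (- \<rho> x)"
        proof -
          have "\<rho> x < 0" using x by (simp add: assms(3))
          then have "\<bar>\<rho> x\<bar> = - \<rho> x" by simp
          moreover have "C * \<bar>\<rho> x\<bar> \<le> \<bar>C\<bar> * \<bar>\<rho> x\<bar>" by (intro mult_right_mono) simp_all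
          ultimately show ?thesis using C[OF x K] by (metis order_trans)
        qed
        moreover have "0 \<le> real m * \<kappa>' m x"
          using flat_deriv_bounds(1) by (simp add: \<kappa>'_def)
        ultimately show ?thesis
          unfolding abs_mult[of "real m * \<kappa>' m x"] by (simp only: abs_of_nonneg mult_left_mono)
      qed
      also have "\<dots> = ((1 + (real m * (- \<rho> x) - 1)) * \<kappa>' m x) * \<bar>C\<bar>" by (simp add: mult_ac)
      also have "\<dots> \<le> 2 * \<bar>C\<bar>"
        unfolding \<kappa>'_def by (intro mult_right_mono flat_deriv_bounds) simp
      finally have 1: "\<bar>real m * \<kappa>' m x * contract (\<lambda>j. partial j \<rho> x) (f x) K\<bar> \<le> 2 * \<bar>C\<bar>" .
      have "\<bar>\<kappa> m x * \<beta> x K\<bar> \<le> 1 * B K"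
        unfolding abs_mult using flat_1_bounds by (intro mult_mono B x) (auto simp: \<kappa>_def)
      with 1 have "\<bar>real m * \<kappa>' m x * contract (\<lambda>j. partial j \<rho> x) (f x) K + \<kappa> m x * \<beta> x K\<bar> \<le> 2 * \<bar>C\<bar> + B K"
        by linarith
      then show ?thesis
        unfolding T_def abs_mult[of _ "exp (- \<phi> x)"] using Be x B(1)[of K] by (intro mult_mono) auto
    qed
    show ?thesis
      unfolding L2_inner_def
    proof (rule set_integral_dominated_convergence)
      show "set_integrable lebesgue D (\<lambda>x. \<Sum>K\<in>incr_indices q. \<bar>u x K * 1\<bar> * ((2 * \<bar>C\<bar> + B K) * Be))"
        by (intro set_integral_sum(1) set_integrable_mult_left set_integrable_abs int_u) auto
      show "set_integrable lebesgue D (\<lambda>x. cov_inner q (u x) (T m x))" for m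
        using int_uT[of "\<lambda>K x. T m x K"] smooth_T by simp
      show "set_borel_measurable lebesgue D (\<lambda>x. cov_inner q (u x) (d_adj \<phi> f x) * exp (- \<phi> x))"
      proof -
        have "set_integrable lebesgue D (\<lambda>x. cov_inner q (u x) (\<lambda>K. \<beta> x K * exp (- \<phi> x)))"
          by (rule int_uT) (intro smooth_mult smooth_\<beta> smooth_e)
        then show ?thesis
          unfolding set_borel_measurable_def set_integrable_def cov_inner_def \<beta>_def
          by (auto simp: sum_distrib_right mult.assoc dest!: borel_measurable_integrable)
      qed
      show "\<bar>cov_inner q (u x) (T m x)\<bar> \<le> (\<Sum>K\<in>incr_indices q. \<bar>u x K * 1\<bar> * ((2 * \<bar>C\<bar> + B K) * Be))" if "x \<in> D" for m x
        unfolding cov_inner_def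
        by (rule order_trans[OF sum_abs]) (auto simp: abs_mult intro!: sum_mono mult_left_mono T_bound that)
      show "(\<lambda>m. cov_inner q (u x) (T m x)) \<longlonglongrightarrow> cov_inner q (u x) (d_adj \<phi> f x) * exp (- \<phi> x)" if x: "x \<in> D" for x
      proof -
        have "(\<lambda>m. T m x K) \<longlonglongrightarrow> \<beta> x K * exp (- \<phi> x)" for K
        proof -
          have c: "0 < - \<rho> x" using x by (simp add: assms(3))
          \<comment> \<open>Dividing by |\<rho> x| at fixed \<open>x\<close> brings in the form of
            \<open>flat_tendsto\<close>: m |\<rho>| \<kappa>' tends to 0, and the other factor does
            not depend on m.\<close>
          have "(\<lambda>m. (real m * (- \<rho> x) * \<kappa>' m x) * (contract (\<lambda>j. partial j \<rho> x) (f x) K / (- \<rho> x))) \<longlonglongrightarrow> 0 * (contract (\<lambda>j. partial j \<rho> x) (f x) K / (- \<rho> x))"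
            unfolding \<kappa>'_def by (intro tendsto_mult tendsto_const flat_tendsto c)
          then have "(\<lambda>m. real m * \<kappa>' m x * contract (\<lambda>j. partial j \<rho> x) (f x) K) \<longlonglongrightarrow> 0"
            using c by (simp add: mult_ac)
          from tendsto_mult_right[OF tendsto_add[OF this tendsto_mult_right[OF lim_\<kappa>[OF x], of "\<beta> x K"]], of "exp (- \<phi> x)"]
          show ?thesis unfolding T_def by simp
        qed
        then have "(\<lambda>m. cov_inner q (u x) (T m x)) \<longlonglongrightarrow> (\<Sum>K\<in>incr_indices q. u x K * (\<beta> x K * exp (- \<phi> x)))"
          unfolding cov_inner_def by (intro tendsto_sum tendsto_mult_left)
        then show ?thesis
          by (simp add: cov_inner_def \<beta>_def sum_distrib_right mult.assoc)
      qed
    qed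
  qed
  ultimately show ?thesis
    unfolding eq by (rule LIMSEQ_unique)
qed

section \<open>Functions vanishing on the boundary are controlled by the defining function\<close>

lemma defining_function_zero_on_frontier:
  assumes "smooth \<rho>" "D = {x. \<rho> x < 0}" "p \<in> frontier D"
  shows "\<rho> p = 0"
proof -
  have "closed {x. \<rho> x \<le> 0}"
    by (intro closed_Collect_le smooth_continuous assms(1) continuous_on_const)
  then have "closure D \<subseteq> {x. \<rho> x \<le> 0}"
    by (rule closure_minimal[rotated]) (auto simp: assms(2))
  moreover have "interior D = D"
    using sublevel_open[OF assms(1)] assms(2) by (simp add: interior_open)
  ultimately show ?thesis
    using assms(2,3) by (force simp: frontier_def)
qed

lemma smooth_lipschitz:
  assumes "smooth g" "convex S" "bounded S"
  obtains M where "0 \<le> M" "\<And>x y. x \<in> S \<Longrightarrow> y \<in> S \<Longrightarrow> \<bar>g x - g y\<bar> \<le> M * norm (x - y)"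
proof -
  obtain B where B: "\<And>i. 0 \<le> B i" "\<And>i x. x \<in> S \<Longrightarrow> \<bar>partial i g x\<bar> \<le> B i"
    using smooth_bounded[OF assms(3) smooth_partial[OF assms(1)]] by metis
  have "\<bar>g x - g y\<bar> \<le> (\<Sum>i\<in>UNIV. B i) * norm (x - y)" if "x \<in> S" "y \<in> S" for x y
    unfolding real_norm_def[symmetric]
  proof (rule differentiable_bound[OF assms(2) has_derivative_at_withinI[OF smooth_has_derivative[OF assms(1)]] _ that])
    fix z assume z: "z \<in> S"
    have "norm (grad g z) \<le> (\<Sum>i\<in>UNIV. B i)"
      by (rule order_trans[OF norm_le_l1_cart]) (auto simp: grad_def intro!: sum_mono B(2) z)
    then show "onorm ((\<bullet>) (grad g z)) \<le> (\<Sum>i\<in>UNIV. B i)"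
      by (intro onorm_le) (metis Cauchy_Schwarz_ineq2 mult_right_mono norm_ge_zero order_trans real_norm_def)
  qed
  then show thesis
    using that[of "\<Sum>i\<in>UNIV. B i"] B(1) by (simp add: sum_nonneg)
qed

lemma smooth_inner_grad: "smooth g \<Longrightarrow> smooth (\<lambda>x. grad g x \<bullet> v)"
  unfolding inner_vec_def grad_def by (auto intro!: smooth_sum smooth_mult smooth_partial)

text \<open>Since \<open>\<rho>\<close> grows at rate at least \<open>1/2\<close> in the normal direction near \<open>p\<close>, every point \<open>x\<close> of \<open>D\<close> near \<open>p\<close>
  is within distance \<open>2 \<bar>\<rho> x\<bar>\<close> of the boundary.\<close>

lemma boundary_bound_local:
  assumes "bounded D" "smooth \<rho>" "D = {x. \<rho> x < 0}" "\<And>p. p \<in> frontier D \<Longrightarrow> norm (grad \<rho> p) = 1"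
    and "smooth g" "\<And>p. p \<in> frontier D \<Longrightarrow> g p = 0" and p: "p \<in> closure D"
  shows "\<exists>r>0. \<exists>C\<ge>0. \<forall>x\<in>D \<inter> ball p r. \<bar>g x\<bar> \<le> C * \<bar>\<rho> x\<bar>"
proof (cases "p \<in> D")
  case True
  then have "\<rho> p < 0" by (simp add: assms(3))
  \<comment> \<open>Inside \<open>D\<close>, |\<rho>| stays above \<open>c\<close> near
    \<open>p\<close>, so boundedness of \<open>g\<close> is enough.\<close>
  define c where "c = - \<rho> p / 2"
  have c: "0 < c" using \<open>\<rho> p < 0\<close> by (simp add: c_def)
  obtain r where r: "0 < r" "\<And>x. dist x p < r \<Longrightarrow> dist (\<rho> x) (\<rho> p) < c"
    using smooth_isCont[OF assms(2), of p] c unfolding continuous_at_eps_delta by blast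
  obtain B where B: "0 \<le> B" "\<And>x. x \<in> D \<Longrightarrow> \<bar>g x\<bar> \<le> B" using smooth_bounded[OF assms(1,5)] by blast
  have "\<bar>g x\<bar> \<le> B / c * \<bar>\<rho> x\<bar>" if "x \<in> D \<inter> ball p r" for x
  proof -
    have "c \<le> \<bar>\<rho> x\<bar>" using r(2)[of x] that by (simp add: c_def dist_real_def dist_commute abs_if split: if_splits)
    then have "B / c * c \<le> B / c * \<bar>\<rho> x\<bar>" using B(1) c by (intro mult_left_mono) auto
    then show ?thesis using B(2)[of x] that c by simp
  qed
  then show ?thesis using r(1) B(1) c by (metis divide_nonneg_pos)
next
  case False
  have fr: "p \<in> frontier D"
    using p False interior_subset by (auto simp: frontier_def)
  define \<nu> where "\<nu> = grad \<rho> p"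
  have \<nu>: "norm \<nu> = 1" using assms(4)[OF fr] by (simp add: \<nu>_def)
  have "\<rho> p = 0" by (rule defining_function_zero_on_frontier[OF assms(2,3) fr])
  have "grad \<rho> p \<bullet> \<nu> = 1" using \<nu> by (simp add: \<nu>_def norm_eq_1)
  obtain \<delta> where \<delta>: "0 < \<delta>" "\<And>x. dist x p < \<delta> \<Longrightarrow> dist (grad \<rho> x \<bullet> \<nu>) (grad \<rho> p \<bullet> \<nu>) < 1/2"
    using smooth_isCont[OF smooth_inner_grad[OF assms(2)], of p \<nu>]
    unfolding continuous_at_eps_delta by (metis half_gt_zero zero_less_one)
  have half: "1/2 \<le> grad \<rho> x \<bullet> \<nu>" if "dist x p < \<delta>" for x
    using \<delta>(2)[OF that] \<open>grad \<rho> p \<bullet> \<nu> = 1\<close> by (simp add: dist_real_def abs_if split: if_splits)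
  \<comment> \<open>\<delta> / 4 makes 2 |\<rho> x| smaller than \<delta> / 2; for \<open>x\<close>
    within \<delta> / 2 of \<open>p\<close> the segment of that length stays in the ball where the
    slope of \<rho> along \<nu> is at least 1/2.\<close>
  obtain \<delta>' where \<delta>': "0 < \<delta>'" "\<And>x. dist x p < \<delta>' \<Longrightarrow> dist (\<rho> x) (\<rho> p) < \<delta> / 4"
    using smooth_isCont[OF assms(2), of p] \<delta>(1) unfolding continuous_at_eps_delta by (metis zero_less_divide_iff zero_less_numeral)
  obtain M where M: "0 \<le> M" "\<And>x y. x \<in> ball p \<delta> \<Longrightarrow> y \<in> ball p \<delta> \<Longrightarrow> \<bar>g x - g y\<bar> \<le> M * norm (x - y)"
    using smooth_lipschitz[OF assms(5) convex_ball bounded_ball] by blast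
  have "\<bar>g x\<bar> \<le> (2 * M) * \<bar>\<rho> x\<bar>" if x: "x \<in> D \<inter> ball p (min \<delta>' (\<delta> / 2))" for x
  proof -
    \<comment> \<open>Rising at rate at least 1/2 for time \<open>T\<close>, \<rho> gains at least
      |\<rho> x|; so the segment leaves \<open>D\<close> and meets the boundary, where
      \<open>g\<close> vanishes.\<close>
    define T where "T = 2 * \<bar>\<rho> x\<bar>"
    have "\<rho> x < 0" using x by (simp add: assms(3))
    then have "0 < T" by (simp add: T_def)
    have T2: "T < \<delta> / 2"
      using \<delta>'(2)[of x] x \<open>\<rho> p = 0\<close> by (simp add: T_def dist_real_def dist_commute)
    have near: "dist (x + t *\<^sub>R \<nu>) p < \<delta>" if "0 \<le> t" "t \<le> T" for t
    proof -
      have "dist (x + t *\<^sub>R \<nu>) p \<le> dist (x + t *\<^sub>R \<nu>) x + dist x p" by (rule dist_triangle)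
      also have "dist (x + t *\<^sub>R \<nu>) x = t" using that(1) \<nu> by (simp add: dist_norm)
      finally show ?thesis using x that(2) T2 by (simp add: dist_commute)
    qed
    have d: "((\<lambda>r. \<rho> (x + r *\<^sub>R \<nu>)) has_derivative (\<lambda>h. grad \<rho> (x + r *\<^sub>R \<nu>) \<bullet> (h *\<^sub>R \<nu>))) (at r)" for r
      by (rule has_derivative_compose[OF _ smooth_has_derivative[OF assms(2)]])
         (auto intro!: derivative_eq_intros)
    obtain s where s: "s \<in> {0<..<T}"
      "\<rho> (x + T *\<^sub>R \<nu>) - \<rho> (x + 0 *\<^sub>R \<nu>) = grad \<rho> (x + s *\<^sub>R \<nu>) \<bullet> ((T - 0) *\<^sub>R \<nu>)"
      using mvt_simple[OF \<open>0 < T\<close> has_derivative_at_withinI[OF d]] by blast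
    have "T * (1/2) \<le> T * (grad \<rho> (x + s *\<^sub>R \<nu>) \<bullet> \<nu>)"
      using \<open>0 < T\<close> s(1) by (intro mult_left_mono half near) auto
    moreover have "\<rho> (x + T *\<^sub>R \<nu>) - \<rho> x = T * (grad \<rho> (x + s *\<^sub>R \<nu>) \<bullet> \<nu>)"
      using s(2) by simp
    moreover have "\<rho> x = - (T * (1/2))" using \<open>\<rho> x < 0\<close> by (simp add: T_def)
    ultimately have "0 \<le> \<rho> (x + T *\<^sub>R \<nu>)" by linarith
    then have "closed_segment x (x + T *\<^sub>R \<nu>) - D \<noteq> {}" by (auto simp: assms(3))
    moreover have "closed_segment x (x + T *\<^sub>R \<nu>) \<inter> D \<noteq> {}" using x by auto
    ultimately have "closed_segment x (x + T *\<^sub>R \<nu>) \<inter> frontier D \<noteq> {}"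
      by (intro connected_Int_frontier connected_segment)
    then obtain w where w: "w \<in> frontier D" "w \<in> closed_segment x (x + T *\<^sub>R \<nu>)" by blast
    then obtain u where u: "0 \<le> u" "u \<le> 1" "w = (1 - u) *\<^sub>R x + u *\<^sub>R (x + T *\<^sub>R \<nu>)"
      unfolding in_segment by blast
    have w': "w = x + (u * T) *\<^sub>R \<nu>" using u(3) by (simp add: algebra_simps)
    have uT: "0 \<le> u * T" "u * T \<le> T" using u \<open>0 < T\<close> by (auto simp: mult_le_cancel_right1)
    have "\<bar>g x - g w\<bar> \<le> M * norm (x - w)"
      using near[OF uT] near[of 0] \<open>0 < T\<close> w' by (intro M(2)) (auto simp: dist_commute)
    also have "\<dots> \<le> M * T"
      using uT \<nu> M(1) by (intro mult_left_mono) (auto simp: w')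
    finally show ?thesis using assms(6)[OF w(1)] by (simp add: T_def mult_ac)
  qed
  moreover have "0 < min \<delta>' (\<delta> / 2)" "0 \<le> 2 * M" using \<delta> \<delta>' M by auto
  ultimately show ?thesis by blast
qed

text \<open>Compactness of the closure of \<open>D\<close>; the sum of the local constants over a
  finite subcover dominates each of them. It will be applied to the coefficients of the contraction
  of \<open>f\<close> with the gradient of \<rho>.\<close>

lemma boundary_bound:
  assumes "bounded D" "smooth \<rho>" "D = {x. \<rho> x < 0}" "\<And>p. p \<in> frontier D \<Longrightarrow> norm (grad \<rho> p) = 1"
    and "smooth g" "\<And>p. p \<in> frontier D \<Longrightarrow> g p = 0"
  shows "\<exists>C\<ge>0. \<forall>x\<in>D. \<bar>g x\<bar> \<le> C * \<bar>\<rho> x\<bar>"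
proof -
  have "\<forall>p\<in>closure D. \<exists>r C. 0 < r \<and> 0 \<le> C \<and> (\<forall>x\<in>D \<inter> ball p r. \<bar>g x\<bar> \<le> C * \<bar>\<rho> x\<bar>)"
    using boundary_bound_local[OF assms] by blast
  then obtain r C where rC: "\<And>p. p \<in> closure D \<Longrightarrow> 0 < r p" "\<And>p. p \<in> closure D \<Longrightarrow> 0 \<le> C p"
    "\<And>p x. p \<in> closure D \<Longrightarrow> x \<in> D \<inter> ball p (r p) \<Longrightarrow> \<bar>g x\<bar> \<le> C p * \<bar>\<rho> x\<bar>"
    by metis
  have "compact (closure D)" using assms(1) by simp
  moreover have "open (ball p (r p))" for p by simp
  moreover have "closure D \<subseteq> (\<Union>p\<in>closure D. ball p (r p))"
  proof
    fix p assume "p \<in> closure D"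
    then have "p \<in> ball p (r p)" using rC(1) by (simp only: centre_in_ball)
    with \<open>p \<in> closure D\<close> show "p \<in> (\<Union>p\<in>closure D. ball p (r p))" by (rule UN_I)
  qed
  ultimately obtain P where P: "P \<subseteq> closure D" "finite P" "closure D \<subseteq> (\<Union>p\<in>P. ball p (r p))"
    using compactE_image[of "closure D" "closure D" "\<lambda>p. ball p (r p)"] by (smt (verit, best))
  have "\<bar>g x\<bar> \<le> (\<Sum>p\<in>P. C p) * \<bar>\<rho> x\<bar>" if x: "x \<in> D" for x
  proof -
    obtain p where p: "p \<in> P" "x \<in> ball p (r p)"
      using x P(3) closure_subset[of D] by blast
    have "\<bar>g x\<bar> \<le> C p * \<bar>\<rho> x\<bar>" using rC(3)[of p x] p x P(1) by blast
    also have "\<dots> \<le> (\<Sum>p\<in>P. C p) * \<bar>\<rho> x\<bar>"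
      using P(1,2) p(1) rC(2) by (intro mult_right_mono member_le_sum) auto
    finally show ?thesis .
  qed
  moreover have "0 \<le> (\<Sum>p\<in>P. C p)" using P(1) rC(2) by (intro sum_nonneg) auto
  ultimately show ?thesis by blast
qed

section \<open>Products of exact one-forms\<close>

primrec wedge_d :: "(real ^ 'n::finite \<Rightarrow> real) list \<Rightarrow> 'n form" where
  "wedge_d [] x = (\<lambda>I. if I = [] then 1 else 0)"
| "wedge_d (h # hs) x = wedge (\<lambda>i. partial i h x) (wedge_d hs x)"

lemma wedge_d_covectors: "wedge_d hs x \<in> covectors (length hs)"
proof (induction hs)
  case Nil
  show ?case by (simp add: covectors_def)
next
  case (Cons h hs)
  then show ?case by (simp add: wedge_covectors)
qed

lemma smooth_wedge_d: "(\<And>h. h \<in> set hs \<Longrightarrow> smooth h) \<Longrightarrow> smooth (\<lambda>x. wedge_d hs x I)"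
  by (induction hs arbitrary: I) (auto simp: wedge_def intro!: smooth_alt_sum smooth_mult smooth_partial)

lemma partial_wedge_d:
  assumes "\<And>g. g \<in> set (h # hs) \<Longrightarrow> smooth g"
  shows "partial m (\<lambda>x. wedge_d (h # hs) x I) x =
    wedge (\<lambda>i. partial m (partial i h) x) (wedge_d hs x) I +
    wedge (\<lambda>i. partial i h x) (\<lambda>K. partial m (\<lambda>x. wedge_d hs x K) x) I"
proof -
  have sm: "smooth h" "smooth (\<lambda>x. wedge_d hs x K)" for K
    using assms by (auto intro: smooth_wedge_d)
  have "smooth (\<lambda>x. partial i h x * wedge_d hs x K)" for i K
    by (intro smooth_mult smooth_partial sm)
  then have "partial m (\<lambda>x. wedge_d (h # hs) x I) x = alt_sum (\<lambda>i K. partial m (\<lambda>x. partial i h x * wedge_d hs x K) x) I"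
    unfolding wedge_d.simps wedge_def by (rule partial_alt_sum)
  then show ?thesis
    by (simp add: partial_mult smooth_differentiable smooth_partial sm alt_sum_add wedge_def)
qed

text \<open>Leibniz rule. A derivative on the first factor gives the symmetric Hessian of
  \<open>h\<close>, which the alternating double sum annihilates; in the other term, swapping the
  two sums exposes d of the shorter product, zero by induction.\<close>

lemma wedge_d_closed:
  assumes "\<And>h. h \<in> set hs \<Longrightarrow> smooth h"
  shows "smooth_d (wedge_d hs) x J = 0"
  using assms
proof (induction hs arbitrary: J)
  case Nil
  show ?case by (simp add: smooth_d_def partial_const alt_sum_zero)
next
  case (Cons h hs)
  have "partial j (\<lambda>x. wedge_d (h # hs) x K) x = alt_sum (\<lambda>i K. partial j (partial i h) x * wedge_d hs x K) K
      + alt_sum (\<lambda>i K. partial i h x * partial j (\<lambda>x. wedge_d hs x K) x) K" for j K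
    unfolding wedge_def[symmetric] by (rule partial_wedge_d) (rule Cons.prems)
  then have "smooth_d (wedge_d (h # hs)) x J =
      alt_sum (\<lambda>j. alt_sum (\<lambda>i K. partial j (partial i h) x * wedge_d hs x K)) J
    + alt_sum (\<lambda>j. alt_sum (\<lambda>i K. partial i h x * partial j (\<lambda>x. wedge_d hs x K) x)) J"
    unfolding smooth_d_def alt_sum_add[symmetric] by presburger
  also have "alt_sum (\<lambda>j. alt_sum (\<lambda>i K. partial j (partial i h) x * wedge_d hs x K)) J = 0"
  proof (rule alt_sum_alt_sum_symmetric)
    fix i j K
    have "partial j (partial i h) x = partial i (partial j h) x"
      by (rule partial_commute) (use Cons.prems in simp)
    then show "partial i (partial j h) x * wedge_d hs x K = partial j (partial i h) x * wedge_d hs x K" by simp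
  qed
  also have "alt_sum (\<lambda>j. alt_sum (\<lambda>i K. partial i h x * partial j (\<lambda>x. wedge_d hs x K) x)) J
     = - alt_sum (\<lambda>i K. partial i h x * smooth_d (wedge_d hs) x K) J"
    by (subst alt_sum_alt_sum_swap) (simp add: alt_sum_mult[abs_def] smooth_d_def)
  also have "\<dots> = 0"
    using Cons.IH[OF Cons.prems] by (simp add: alt_sum_zero)
  finally show ?case by simp
qed

text \<open>By the antiderivation rule, a vector orthogonal to every factor contracts the product to
  zero. With \<open>v\<close> the gradient of \<rho> this is the boundary condition; with
  \<open>v\<close> the gradient of a further factor it serves the orthonormal case.\<close>

lemma contract_wedge_d:
  assumes "\<And>h. h \<in> set hs \<Longrightarrow> (\<Sum>j\<in>UNIV. v j * partial j h x) = 0"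
  shows "contract v (wedge_d hs x) K = 0"
  using assms
proof (induction hs arbitrary: K)
  case (Cons h hs)
  then show ?case
    by (simp add: contract_wedge) (simp add: wedge_def alt_sum_zero)
qed (simp add: contract_def)

section \<open>Pairing a product of orthonormal one-forms with its derivatives\<close>

lemma full_inner_zero_left: "full_inner q (\<lambda>K. 0) \<eta> = 0"
  using full_inner_minus_left[of q "\<lambda>K. 0" \<eta>] by simp

lemma full_inner_wedge_wedge:
  assumes "\<omega> \<in> covectors q" and "\<And>K. contract w \<omega> K = 0"
  shows "full_inner (Suc q) (wedge w \<omega>) (wedge v \<eta>)
    = real (Suc q) * ((\<Sum>j\<in>UNIV. v j * w j) * full_inner q \<omega> \<eta> - full_inner q (wedge w (contract v \<omega>)) \<eta>)"
proof -
  have "full_inner q (contract v (wedge w \<omega>)) \<eta> = (\<Sum>j\<in>UNIV. v j * w j) * full_inner q \<omega> \<eta> - full_inner q (wedge w (contract v \<omega>)) \<eta>"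
    unfolding full_inner_commute[of q _ \<eta>] contract_wedge[abs_def]
    by (simp add: full_inner_diff_right full_inner_mult_right)
  then show ?thesis using full_inner_wedge[OF wedge_covectors[OF assms(1)]] by simp
qed

text \<open>The exterior product by \<open>w\<close> passes to \<eta> as a contraction, which
  vanishes; in degree 0 the exterior product itself is zero on the empty list.\<close>

lemma full_inner_wedge_left_zero:
  assumes "\<omega> \<in> covectors q" "\<eta> \<in> covectors q" and "\<And>K. contract w \<eta> K = 0"
  shows "full_inner q (wedge w (contract v \<omega>)) \<eta> = 0"
proof (cases q)
  case 0
  then show ?thesis by (simp add: wedge_def)
next
  case (Suc q')
  have "full_inner q \<eta> (wedge w (contract v \<omega>)) = real q * full_inner q' (contract w \<eta>) (contract v \<omega>)"
    using full_inner_wedge[of \<eta> q'] assms(2) Suc by simp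
  also have "contract w \<eta> = (\<lambda>K. 0)" using assms(3) by auto
  finally show ?thesis by (simp add: full_inner_commute[of q _ \<eta>] full_inner_zero_left)
qed

text \<open>For orthonormal differentials the product has unit length; the factorial belongs to
  \<open>full_inner\<close>. By Leibniz, a derivative of the product replaces one factor dh by its
  derivative, of which only the component along dh itself survives the pairing.\<close>

lemma full_inner_wedge_d:
  assumes "\<And>h. h \<in> set hs \<Longrightarrow> smooth h" "\<And>h. h \<in> set hs \<Longrightarrow> norm (grad h x) = 1"
    and "sorted_wrt (\<lambda>h h'. grad h x \<bullet> grad h' x = 0) hs"
  shows "full_inner (length hs) (wedge_d hs x) (wedge_d hs x) = fact (length hs)"
    and "full_inner (length hs) (wedge_d hs x) (\<lambda>I. partial m (\<lambda>x. wedge_d hs x I) x)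
      = fact (length hs) * (\<Sum>h\<leftarrow>hs. \<Sum>j\<in>UNIV. partial m (partial j h) x * partial j h x)"
  using assms
proof (induction hs)
  case Nil
  { case 1 show ?case by simp next case 2 show ?case by (simp add: partial_const) }
next
  case (Cons h hs)
  have prems: "\<And>h. h \<in> set hs \<Longrightarrow> smooth h" "\<And>h. h \<in> set hs \<Longrightarrow> norm (grad h x) = 1"
    "sorted_wrt (\<lambda>h h'. grad h x \<bullet> grad h' x = 0) hs"
    if "\<And>h'. h' \<in> set (h # hs) \<Longrightarrow> smooth h'" "\<And>h'. h' \<in> set (h # hs) \<Longrightarrow> norm (grad h' x) = 1"
      "sorted_wrt (\<lambda>h h'. grad h x \<bullet> grad h' x = 0) (h # hs)"
    using that by auto
  let ?N = "wedge_d hs x" and ?w = "\<lambda>i. partial i h x"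
  { case 1
    have zero: "contract ?w ?N K = 0" for K
      using 1(3) by (intro contract_wedge_d) (simp add: inner_vec_def grad_def)
    have cov: "?N \<in> covectors (length hs)" by (rule wedge_d_covectors)
    have unit: "(\<Sum>j\<in>UNIV. ?w j * ?w j) = 1"
      using 1(2)[of h] by (simp add: norm_eq_1 inner_vec_def grad_def)
    show ?case
      using full_inner_wedge_wedge[OF cov zero] full_inner_wedge_left_zero[OF cov cov zero]
        Cons.IH(1)[OF prems[OF 1]] by (simp add: unit del: full_inner.simps)
  next
    case 2
    have zero: "contract ?w ?N K = 0" for K
      using 2(3) by (intro contract_wedge_d) (simp add: inner_vec_def grad_def)
    have cov: "?N \<in> covectors (length hs)" by (rule wedge_d_covectors)
    have cov': "(\<lambda>K. partial m (\<lambda>x. wedge_d hs x K) x) \<in> covectors (length hs)"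
      by (intro covectors_partial wedge_d_covectors smooth_wedge_d) (use 2(1) in auto)
    have unit: "(\<Sum>j\<in>UNIV. ?w j * ?w j) = 1"
      using 2(2)[of h] by (simp add: norm_eq_1 inner_vec_def grad_def)
    have "contract ?w ?N = (\<lambda>K. 0)" using zero by auto
    then have z2: "full_inner (length hs) (wedge ?w (contract ?w ?N)) \<eta> = 0" for \<eta>
      by (simp add: wedge_def alt_sum_zero[abs_def] full_inner_zero_left)
    let ?A = "wedge (\<lambda>i. partial m (partial i h) x) ?N"
    let ?B = "wedge ?w (\<lambda>K. partial m (\<lambda>x. wedge_d hs x K) x)"
    have "full_inner (length (h # hs)) (wedge_d (h # hs) x) (\<lambda>I. partial m (\<lambda>x. wedge_d (h # hs) x I) x)
        = full_inner (length (h # hs)) (wedge_d (h # hs) x) (\<lambda>I. ?A I + ?B I)"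
    proof -
      have "partial m (\<lambda>x. wedge_d (h # hs) x I) x = ?A I + ?B I" for I
        by (rule partial_wedge_d) (use 2(1) in simp)
      then show ?thesis by presburger
    qed
    also have "\<dots> = full_inner (Suc (length hs)) (wedge ?w ?N) ?A + full_inner (Suc (length hs)) (wedge ?w ?N) ?B"
      by (simp add: full_inner_add_right del: full_inner.simps)
    also have "full_inner (Suc (length hs)) (wedge ?w ?N) ?A
        = real (Suc (length hs)) * ((\<Sum>j\<in>UNIV. partial m (partial j h) x * partial j h x) * fact (length hs))"
      using full_inner_wedge_wedge[OF cov zero] full_inner_wedge_left_zero[OF cov cov zero]
        Cons.IH(1)[OF prems[OF 2]] by simp
    also have "full_inner (Suc (length hs)) (wedge ?w ?N) ?B
        = real (Suc (length hs)) * (fact (length hs) * (\<Sum>h\<leftarrow>hs. \<Sum>j\<in>UNIV. partial m (partial j h) x * partial j h x))"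
      using full_inner_wedge_wedge[OF cov zero] z2 Cons.IH(2)[OF prems[OF 2]] by (simp add: unit)
    finally show ?case by (simp add: algebra_simps)
  }
qed

text \<open>By Cartan's formula, \<open>d \<iota>\<^sub>i f = \<partial>\<^sub>i f\<close> for a closed form \<open>f\<close>, so \<open>d d\<^sup>* f\<close> acts on each coefficient separately.\<close>

lemma smooth_d_d_adj:
  fixes f :: "'n::{finite,linorder} form"
  assumes f: "\<And>x. f x \<in> covectors (Suc q)" "\<And>I. smooth (\<lambda>x. f x I)"
    and closed: "\<And>x J. smooth_d f x J = 0" and "smooth \<phi>"
    and hess: "\<And>i j. partial i (partial j \<phi>) x = (if i = j then c else 0)"
    and J: "length J = Suc q"
  shows "smooth_d (d_adj \<phi> f) x J = c * real (Suc q) * f x J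
    + (\<Sum>i\<in>UNIV. partial i \<phi> x * partial i (\<lambda>x. f x J) x) - (\<Sum>i\<in>UNIV. partial i (partial i (\<lambda>x. f x J)) x)"
proof -
  \<comment> \<open>Closedness at the longer list \<open>i # J\<close>: the recursion of
    \<open>alt_sum\<close> splits off the derivative in direction \<open>i\<close>.\<close>
  have cartan: "alt_sum (\<lambda>j K. partial j (\<lambda>x. f x (i # K)) y) J = partial i (\<lambda>x. f x J) y" for i y
    using closed[of y "i # J"] by (simp add: smooth_d_def)
  have d: "partial j (\<lambda>x. d_adj \<phi> f x K) x = (\<Sum>i\<in>UNIV. (if j = i then c else 0) * f x (i # K)
      + partial i \<phi> x * partial j (\<lambda>x. f x (i # K)) x - partial i (partial j (\<lambda>x. f x (i # K))) x)" for j K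
  proof -
    have "partial j (\<lambda>x. d_adj \<phi> f x K) x = (\<Sum>i\<in>UNIV. partial j (\<lambda>x. partial i \<phi> x * f x (i # K) - partial i (\<lambda>x. f x (i # K)) x) x)"
      unfolding d_adj_def by (rule partial_sum) (intro smooth_diff smooth_mult smooth_partial f(2) assms(4))
    then show ?thesis
      by (simp add: partial_diff partial_mult smooth_differentiable smooth_mult smooth_partial f(2) assms(4) hess
          partial_commute[OF f(2), of j])
  qed
  \<comment> \<open>\<open>cartan\<close> settles the first-order terms directly; in the
    second-order terms the outer derivative is first pulled out of \<open>alt_sum\<close>. Only the
    Hessian of \<phi> leaves a term of order zero.\<close>
  have "smooth_d (d_adj \<phi> f) x J = (\<Sum>i\<in>UNIV. alt_sum (\<lambda>j K. (if j = i then c else 0) * f x (i # K)) J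
      + partial i \<phi> x * partial i (\<lambda>x. f x J) x - partial i (partial i (\<lambda>x. f x J)) x)"
    unfolding smooth_d_def d alt_sum_sum alt_sum_diff alt_sum_add alt_sum_mult cartan
    by (intro sum.cong refl arg_cong2[where f = "(-)"])
       (simp add: partial_alt_sum[symmetric] smooth_partial f(2) cartan)
  also have "\<dots> = (\<Sum>i\<in>UNIV. alt_sum (\<lambda>j K. (if j = i then c else 0) * f x (i # K)) J)
      + (\<Sum>i\<in>UNIV. partial i \<phi> x * partial i (\<lambda>x. f x J) x) - (\<Sum>i\<in>UNIV. partial i (partial i (\<lambda>x. f x J)) x)"
    by (simp add: sum.distrib sum_subtractf)
  also have "(\<Sum>i\<in>UNIV. alt_sum (\<lambda>j K. (if j = i then c else 0) * f x (i # K)) J) = alt_sum (\<lambda>j K. c * f x (j # K)) J"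
  proof -
    have "(\<Sum>i\<in>UNIV. (if j = i then c else 0) * f x (i # K)) = c * f x (j # K)" for j K
    proof -
      have "(\<Sum>i\<in>UNIV. (if j = i then c else 0) * f x (i # K)) = (\<Sum>i\<in>UNIV. if j = i then c * f x (j # K) else 0)"
        by (intro sum.cong) auto
      then show ?thesis by simp
    qed
    then show ?thesis unfolding alt_sum_sum[symmetric] by simp
  qed
  also have "\<dots> = c * real (Suc q) * f x J"
    by (simp add: alt_sum_mult alt_sum_covector[OF f(1) J])
  finally show ?thesis .
qed

section \<open>Blow-up at a boundary point\<close>

text \<open>Dominating function for the blow-up. The linear factor is absorbed by half of the
  exponent, and exp(-|y|^2 / 2) is, up to a constant, a product of one-dimensional normal
  densities.\<close>

lemma integrable_gaussian:
  "integrable lborel (\<lambda>y :: real ^ 'n::finite. (A + B * norm y) * exp (- (norm y)\<^sup>2))"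
proof -
  let ?g = "\<lambda>t :: real. exp (- t\<^sup>2 / 2)"
  have "integrable lborel (\<lambda>t. sqrt (2 * pi) * std_normal_density t)"
    by (intro integrable_mult_right integrable_normal_density) simp
  then have g: "integrable lborel ?g"
    by (simp add: std_normal_density_def)
  have "(\<integral>\<^sup>+(y :: real ^ 'n). (\<Prod>b\<in>Basis. ennreal (?g (y \<bullet> b))) \<partial>lborel) = (\<Prod>b\<in>(Basis :: (real ^ 'n) set). (\<integral>\<^sup>+t. ennreal (?g t) \<partial>lborel))"
    using nn_integral_lborel_prod[of "\<lambda>(b :: real ^ 'n) t. ?g t"] by (simp add: prod_ennreal)
  also have "\<dots> < \<infinity>"
    using g by (auto simp: integrable_iff_bounded power_less_top_ennreal)
  also have "(\<lambda>y :: real ^ 'n. (\<Prod>b\<in>Basis. ennreal (?g (y \<bullet> b)))) = (\<lambda>y. ennreal (exp (- (norm y)\<^sup>2 / 2)))"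
  proof
    fix y :: "real ^ 'n"
    have "(norm y)\<^sup>2 = (\<Sum>b\<in>Basis. (y \<bullet> b)\<^sup>2)"
      unfolding power2_norm_eq_inner by (subst euclidean_inner) (simp add: power2_eq_square)
    then show "(\<Prod>b\<in>Basis. ennreal (?g (y \<bullet> b))) = ennreal (exp (- (norm y)\<^sup>2 / 2))"
      by (simp add: prod_ennreal exp_sum[symmetric] sum_negf sum_divide_distrib)
  qed
  finally have int: "integrable lborel (\<lambda>y :: real ^ 'n. (\<bar>A\<bar> + 2 * \<bar>B\<bar>) * exp (- (norm y)\<^sup>2 / 2))"
    by (intro integrable_mult_right) (simp add: integrable_iff_bounded)
  show ?thesis
  proof (rule Bochner_Integration.integrable_bound[OF int])
    have "norm ((A + B * norm y) * exp (- (norm y)\<^sup>2)) \<le> norm ((\<bar>A\<bar> + 2 * \<bar>B\<bar>) * exp (- (norm y)\<^sup>2 / 2))" for y :: "real ^ 'n"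
    proof -
      let ?r = "norm y"
      have "?r \<le> 2 * (1 + ?r\<^sup>2 / 2)"
      proof -
        have "0 \<le> (?r - 1)\<^sup>2" by simp
        then have "2 * ?r \<le> 1 + ?r\<^sup>2" by (simp add: power2_diff)
        then have "?r \<le> 2 + ?r\<^sup>2" using norm_ge_zero[of y] by linarith
        then show ?thesis by simp
      qed
      also have "\<dots> \<le> 2 * exp (?r\<^sup>2 / 2)"
        by (intro mult_left_mono exp_ge_add_one_self) simp
      finally have e: "?r \<le> 2 * exp (?r\<^sup>2 / 2)" "1 \<le> exp (?r\<^sup>2 / 2)" by simp_all
      have "\<bar>A + B * ?r\<bar> \<le> \<bar>A\<bar> * 1 + \<bar>B\<bar> * ?r"
        by (rule order_trans[OF abs_triangle_ineq]) (simp add: abs_mult)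
      also have "\<dots> \<le> \<bar>A\<bar> * exp (?r\<^sup>2 / 2) + \<bar>B\<bar> * (2 * exp (?r\<^sup>2 / 2))"
        by (intro add_mono mult_left_mono e) auto
      finally have "\<bar>A + B * ?r\<bar> * exp (- ?r\<^sup>2) \<le> ((\<bar>A\<bar> + 2 * \<bar>B\<bar>) * exp (?r\<^sup>2 / 2)) * exp (- ?r\<^sup>2)"
        by (intro mult_right_mono) (auto simp: algebra_simps)
      also have "\<dots> = (\<bar>A\<bar> + 2 * \<bar>B\<bar>) * exp (- ?r\<^sup>2 / 2)"
        by (simp add: mult.assoc exp_add[symmetric])
      finally show ?thesis by (simp add: abs_mult)
    qed
    then show "AE y :: real ^ 'n in lborel. norm ((A + B * norm y) * exp (- (norm y)\<^sup>2)) \<le> norm ((\<bar>A\<bar> + 2 * \<bar>B\<bar>) * exp (- (norm y)\<^sup>2 / 2))"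
      by (intro AE_I2)
  qed simp
qed

lemma integral_affine:
  fixes g :: "real ^ 'n::finite \<Rightarrow> real"
  assumes "g \<in> borel_measurable borel" "c \<noteq> 0"
  shows "(LINT x|lborel. g x) = \<bar>c\<bar> ^ CARD('n) * (LINT y|lborel. g (p + c *\<^sub>R y))"
proof -
  have "(LINT x|lborel. g x) = (LINT x|density (distr lborel borel (\<lambda>x. p + c *\<^sub>R x)) (\<lambda>_. \<bar>c\<bar> ^ CARD('n)). g x)"
    using lborel_affine[OF assms(2), of p] by simp
  also have "\<dots> = (LINT x|distr lborel borel (\<lambda>x. p + c *\<^sub>R x). \<bar>c\<bar> ^ CARD('n) *\<^sub>R g x)"
    using assms(1) by (intro integral_density) auto
  also have "\<dots> = (LINT y|lborel. \<bar>c\<bar> ^ CARD('n) *\<^sub>R g (p + c *\<^sub>R y))"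
    using assms(1) by (intro integral_distr) auto
  finally show ?thesis by simp
qed

text \<open>Substitute \<open>x = p + y / m\<close> with \<open>a = m\<^sup>2\<close>. As \<open>m \<rightarrow> \<infinity>\<close> the domain becomes the half space
  \<open>y \<bullet> \<nu> < 0\<close>, the term with \<open>c\<close> is of lower order, and what remains is
  \<open>S\<close> times a negative integral.\<close>

lemma blow_up_nonneg:
  fixes w :: "'n::finite \<Rightarrow> real ^ 'n \<Rightarrow> real"
  assumes D: "bounded D" "smooth \<rho>" "D = {x. \<rho> x < 0}" and p: "\<rho> p = 0" and \<nu>: "grad \<rho> p \<noteq> 0"
    and w: "\<And>i. smooth (w i)" "smooth c" "\<And>i. w i p = S * grad \<rho> p $ i"
    and nonneg: "\<And>a. 0 < a \<Longrightarrow>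
      0 \<le> (LINT x:D|lebesgue. (2 * a * (\<Sum>i\<in>UNIV. (x - p) $ i * w i x) - c x) * exp (- (a * (norm (x - p))\<^sup>2 - 1)))"
  shows "S \<le> 0"
proof -
  define \<nu> where "\<nu> = grad \<rho> p"
  have "open D" using sublevel_open D by blast
  \<comment> \<open>With r = \<open>real (Suc m)\<close> and a = r^2, this times the Gaussian is the
    substituted integrand divided by r e; the factor e stems from the constant -1 in the
    weight.\<close>
  define H where "H = (\<lambda>m y. 2 * (\<Sum>i\<in>UNIV. y $ i * w i (p + (1 / real (Suc m)) *\<^sub>R y))
     - c (p + (1 / real (Suc m)) *\<^sub>R y) * (1 / real (Suc m)))"
  define s where "s = (\<lambda>m y. indicator D (p + (1 / real (Suc m)) *\<^sub>R y) * (H m y * exp (- (norm y)\<^sup>2)))"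
  define s' where "s' = (\<lambda>y. indicator {y. y \<bullet> \<nu> < 0} y * (2 * S * (y \<bullet> \<nu>) * exp (- (norm y)\<^sup>2)))"
  have "0 \<le> (LINT y|lborel. s m y)" for m
  proof -
    define r where "r = real (Suc m)"
    have r: "0 < r" by (simp add: r_def)
    define G where "G = (\<lambda>x. (2 * r\<^sup>2 * (\<Sum>i\<in>UNIV. (x - p) $ i * w i x) - c x) * exp (- (r\<^sup>2 * (norm (x - p))\<^sup>2 - 1)))"
    have G: "G \<in> borel_measurable borel"
      unfolding G_def by (intro borel_measurable_continuous_onI continuous_intros smooth_continuous w)
    have ind: "indicat_real D \<in> borel_measurable borel" using \<open>open D\<close> by (intro borel_measurable_indicator) simp
    have "0 \<le> (LINT x|lebesgue. indicator D x * G x)"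
      using nonneg[of "r\<^sup>2"] r unfolding set_lebesgue_integral_def G_def by simp
    also have "\<dots> = (LINT x|lborel. indicator D x * G x)"
      by (rule integral_completion) (use G ind in simp)
    also have "\<dots> = \<bar>1 / r\<bar> ^ CARD('n) * (LINT y|lborel. indicator D (p + (1 / r) *\<^sub>R y) * G (p + (1 / r) *\<^sub>R y))"
      by (rule integral_affine) (use G ind r in auto)
    also have "(\<lambda>y. indicator D (p + (1 / r) *\<^sub>R y) * G (p + (1 / r) *\<^sub>R y)) = (\<lambda>y. (r * exp 1) * s m y)"
    proof
      fix y
      have "G (p + (1 / r) *\<^sub>R y) = (2 * r * (\<Sum>i\<in>UNIV. y $ i * w i (p + (1 / r) *\<^sub>R y)) - c (p + (1 / r) *\<^sub>R y)) * exp (- ((norm y)\<^sup>2 - 1))"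
        using r unfolding G_def by (simp add: sum_divide_distrib[symmetric] power_divide power2_eq_square)
      also have "\<dots> = r * exp 1 * (H m y * exp (- (norm y)\<^sup>2))"
        using r unfolding H_def r_def[symmetric] by (simp add: exp_diff exp_minus field_simps)
      finally show "indicator D (p + (1 / r) *\<^sub>R y) * G (p + (1 / r) *\<^sub>R y) = (r * exp 1) * s m y"
        unfolding s_def r_def[symmetric] by simp
    qed
    finally have "0 \<le> (\<bar>1 / r\<bar> ^ CARD('n) * (r * exp 1)) * (LINT y|lborel. s m y)" by (simp add: mult.assoc)
    moreover have "0 < \<bar>1 / r\<bar> ^ CARD('n) * (r * exp 1)" using r by simp
    ultimately show ?thesis by (metis zero_le_mult_iff not_less)
  qed
  moreover have "(\<lambda>m. LINT y|lborel. s m y) \<longlonglongrightarrow> (LINT y|lborel. s' y)"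
  proof -
    obtain B where B: "\<And>i. 0 \<le> B i" "\<And>i x. x \<in> D \<Longrightarrow> \<bar>w i x\<bar> \<le> B i"
      using smooth_bounded[OF D(1) w(1)] by metis
    obtain Bc where Bc: "0 \<le> Bc" "\<And>x. x \<in> D \<Longrightarrow> \<bar>c x\<bar> \<le> Bc"
      using smooth_bounded[OF D(1) w(2)] by metis
    show ?thesis
    proof (rule integral_dominated_convergence[where w = "\<lambda>y. (Bc + 2 * (\<Sum>i\<in>UNIV. B i) * norm y) * exp (- (norm y)\<^sup>2)"])
      show "integrable lborel (\<lambda>y :: real ^ 'n. (Bc + 2 * (\<Sum>i\<in>UNIV. B i) * norm y) * exp (- (norm y)\<^sup>2))"
        by (rule integrable_gaussian)
      show "s m \<in> borel_measurable lborel" for m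
      proof -
        have aff: "continuous_on UNIV (\<lambda>y. p + (1 / real (Suc m)) *\<^sub>R y)"
          by (intro continuous_intros)
        have H: "continuous_on UNIV (\<lambda>y. H m y * exp (- (norm y)\<^sup>2))"
          unfolding H_def
          by (intro continuous_intros continuous_on_compose2[OF smooth_continuous aff subset_UNIV] w)
        have "indicat_real D \<in> borel_measurable borel" using \<open>open D\<close> by (intro borel_measurable_indicator) simp
        then have "(\<lambda>y. indicat_real D (p + (1 / real (Suc m)) *\<^sub>R y)) \<in> borel_measurable borel"
          by (rule measurable_compose[OF borel_measurable_continuous_onI[OF aff]])
        then have "s m \<in> borel_measurable borel"
          unfolding s_def by (intro borel_measurable_times borel_measurable_continuous_onI[OF H])
        then show ?thesis by simp
      qed
      show "s' \<in> borel_measurable lborel"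
        unfolding s'_def by simp
      have "\<bar>s m y\<bar> \<le> (Bc + 2 * (\<Sum>i\<in>UNIV. B i) * norm y) * exp (- (norm y)\<^sup>2)" for m y
      proof (cases "p + (1 / real (Suc m)) *\<^sub>R y \<in> D")
        case True
        have "\<bar>\<Sum>i\<in>UNIV. y $ i * w i (p + (1 / real (Suc m)) *\<^sub>R y)\<bar> \<le> (\<Sum>i\<in>UNIV. norm y * B i)"
          by (rule order_trans[OF sum_abs], rule sum_mono)
             (use True in \<open>auto simp: abs_mult simp del: of_nat_Suc intro!: mult_mono component_le_norm_cart B\<close>)
        then have "\<bar>\<Sum>i\<in>UNIV. y $ i * w i (p + (1 / real (Suc m)) *\<^sub>R y)\<bar> \<le> (\<Sum>i\<in>UNIV. B i) * norm y"
          by (simp add: sum_distrib_left mult.commute del: of_nat_Suc)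
        moreover have "\<bar>c (p + (1 / real (Suc m)) *\<^sub>R y) * (1 / real (Suc m))\<bar> \<le> Bc * 1"
          unfolding abs_mult by (intro mult_mono Bc True) (auto simp: Bc)
        ultimately have "\<bar>H m y\<bar> \<le> Bc + 2 * (\<Sum>i\<in>UNIV. B i) * norm y"
          unfolding H_def by linarith
        then show ?thesis using True by (simp add: s_def abs_mult del: of_nat_Suc)
      next
        case False
        have "0 \<le> Bc + 2 * (\<Sum>i\<in>UNIV. B i) * norm y" using B(1) Bc(1) by (simp add: sum_nonneg)
        then show ?thesis using False by (simp add: s_def del: of_nat_Suc)
      qed
      then show "AE y in lborel. norm (s m y) \<le> (Bc + 2 * (\<Sum>i\<in>UNIV. B i) * norm y) * exp (- (norm y)\<^sup>2)" for m
        by simp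
      have "(\<lambda>m. s m y) \<longlonglongrightarrow> s' y" for y
      proof -
        have t0: "(\<lambda>m. 1 / real (Suc m)) \<longlonglongrightarrow> 0"
          using LIMSEQ_inverse_real_of_nat by (simp add: inverse_eq_divide)
        have x: "(\<lambda>m. p + (1 / real (Suc m)) *\<^sub>R y) \<longlonglongrightarrow> p"
          using tendsto_add[OF tendsto_const tendsto_scaleR[OF t0 tendsto_const], of p y] by simp
        have "(\<lambda>m. H m y) \<longlonglongrightarrow> 2 * (\<Sum>i\<in>UNIV. y $ i * w i p) - c p * 0"
          unfolding H_def
          by (intro tendsto_intros isCont_tendsto_compose[OF smooth_isCont x] w t0)
        moreover have "2 * (\<Sum>i\<in>UNIV. y $ i * w i p) - c p * 0 = 2 * S * (y \<bullet> \<nu>)"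
          by (simp add: w(3) inner_vec_def \<nu>_def sum_distrib_left mult_ac)
        ultimately have H: "(\<lambda>m. H m y * exp (- (norm y)\<^sup>2)) \<longlonglongrightarrow> 2 * S * (y \<bullet> \<nu>) * exp (- (norm y)\<^sup>2)"
          by (intro tendsto_mult tendsto_const) (simp only:)
        \<comment> \<open>The rescaled defining function tends to the linear function
          \<open>y \<bullet> \<nu>\<close>, whose sign decides whether the rescaled point eventually
          lies in \<open>D\<close>.\<close>
        have "((\<lambda>t. \<rho> (p + t *\<^sub>R y)) has_derivative (\<lambda>h. grad \<rho> (p + 0 *\<^sub>R y) \<bullet> (h *\<^sub>R y))) (at 0)"
          by (rule has_derivative_compose[OF _ smooth_has_derivative[OF D(2)]])
             (auto intro!: derivative_eq_intros)
        then have "((\<lambda>t. \<rho> (p + t *\<^sub>R y)) has_real_derivative y \<bullet> \<nu>) (at 0)"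
          by (simp add: has_field_derivative_def \<nu>_def inner_commute mult.commute[of _ "y \<bullet> _"])
        then have "((\<lambda>t. \<rho> (p + t *\<^sub>R y) / t) \<longlongrightarrow> y \<bullet> \<nu>) (at 0)"
          by (simp add: has_field_derivative_iff p)
        moreover have "filterlim (\<lambda>m. 1 / real (Suc m)) (at 0) sequentially"
          unfolding filterlim_at using t0 by (intro conjI always_eventually) auto
        ultimately have q: "(\<lambda>m. \<rho> (p + (1 / real (Suc m)) *\<^sub>R y) / (1 / real (Suc m))) \<longlonglongrightarrow> y \<bullet> \<nu>"
          by (rule filterlim_compose)
        consider "y \<bullet> \<nu> < 0" | "y \<bullet> \<nu> = 0" | "0 < y \<bullet> \<nu>" by linarith
        then show ?thesis
        proof cases
          case 1
          have "eventually (\<lambda>m. \<rho> (p + (1 / real (Suc m)) *\<^sub>R y) / (1 / real (Suc m)) < 0) sequentially"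
            using order_tendstoD(2)[OF q 1] .
          then have "eventually (\<lambda>m. H m y * exp (- (norm y)\<^sup>2) = s m y) sequentially"
            by eventually_elim (simp add: s_def D(3) mult_less_0_iff divide_less_0_iff del: of_nat_Suc)
          from Lim_transform_eventually[OF H this] show ?thesis using 1 by (simp add: s'_def)
        next
          case 2
          \<comment> \<open>On the tangent hyperplane the indicator of \<open>D\<close> may
            oscillate, but \<open>H\<close> tends to a multiple of \<open>y \<bullet> \<nu>\<close>,
            which is 0 here.\<close>
          have "(\<lambda>m. H m y * exp (- (norm y)\<^sup>2)) \<longlonglongrightarrow> 0" using H 2 by simp
          then have "(\<lambda>m. norm (H m y * exp (- (norm y)\<^sup>2))) \<longlonglongrightarrow> 0" by (rule tendsto_norm_zero)
          moreover have "norm (s m y) \<le> norm (H m y * exp (- (norm y)\<^sup>2))" for m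
            by (simp add: s_def indicator_def)
          ultimately have "(\<lambda>m. s m y) \<longlonglongrightarrow> 0"
            by (intro Lim_null_comparison[of "\<lambda>m. s m y"] always_eventually allI)
          then show ?thesis using 2 by (simp add: s'_def)
        next
          case 3
          have "eventually (\<lambda>m. \<rho> (p + (1 / real (Suc m)) *\<^sub>R y) / (1 / real (Suc m)) > 0) sequentially"
            using order_tendstoD(1)[OF q 3] .
          then have "eventually (\<lambda>m. s m y = 0) sequentially"
            by eventually_elim (simp add: s_def D(3) zero_less_mult_iff zero_less_divide_iff del: of_nat_Suc)
          then show ?thesis using 3 by (simp add: s'_def tendsto_eventually)
        qed
      qed
      then show "AE y in lborel. (\<lambda>m. s m y) \<longlonglongrightarrow> s' y" by simp
    qed
  qed
  ultimately have "0 \<le> (LINT y|lborel. s' y)"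
    by (intro LIMSEQ_le_const) auto
  show "S \<le> 0"
  proof (rule ccontr)
    assume "\<not> S \<le> 0"
    then have S: "0 < S" by simp
    have int: "integrable lborel s'"
    proof (rule Bochner_Integration.integrable_bound)
      show "integrable lborel (\<lambda>y :: real ^ 'n. (0 + 2 * S * norm \<nu> * norm y) * exp (- (norm y)\<^sup>2))"
        by (rule integrable_gaussian)
      have "- (y \<bullet> \<nu>) \<le> norm \<nu> * norm y" for y :: "real ^ 'n"
        using Cauchy_Schwarz_ineq2[of y \<nu>] by (simp add: mult.commute abs_le_iff)
      then show "AE y in lborel. norm (s' y) \<le> norm ((0 + 2 * S * norm \<nu> * norm y) * exp (- (norm y)\<^sup>2))"
        using S by (auto simp: s'_def indicator_def abs_mult mult.assoc intro!: AE_I2)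
    qed (simp add: s'_def)
    \<comment> \<open>For S > 0 the limit integrand is nonpositive with nonnegative integral, hence
      null almost everywhere; yet it is strictly negative on a nonempty open half space.\<close>
    have "(LINT y|lborel. - s' y) = 0 \<longleftrightarrow> (AE y in lborel. - s' y = 0)"
      by (rule integral_nonneg_eq_0_iff_AE)
        (use int S in \<open>auto simp: s'_def indicator_def mult_nonneg_nonpos mult_nonpos_nonneg\<close>)
    moreover have "0 \<le> (LINT y|lborel. - s' y)"
      using S by (intro integral_nonneg_AE) (auto simp: s'_def indicator_def mult_nonneg_nonpos mult_nonpos_nonneg)
    ultimately have "AE y in lborel. s' y = 0"
      using \<open>0 \<le> (LINT y|lborel. s' y)\<close> by simp
    then have "AE y in lborel. y \<notin> {y. y \<bullet> \<nu> < 0}"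
      by eventually_elim (use S in \<open>auto simp: s'_def\<close>)
    moreover have op: "open {y. y \<bullet> \<nu> < 0}"
      by (intro open_Collect_less continuous_intros)
    ultimately have "{y. y \<bullet> \<nu> < 0} \<in> null_sets lborel"
      by (subst AE_iff_null_sets) auto
    then have "negligible {y. y \<bullet> \<nu> < 0}"
      by (simp add: negligible_iff_null_sets null_sets_completionI)
    then have "{y. y \<bullet> \<nu> < 0} = {}"
      using open_not_negligible[OF op] by blast
    moreover have "- \<nu> \<in> {y. y \<bullet> \<nu> < 0}"
      using \<nu> by (simp add: \<nu>_def)
    ultimately show False by blast
  qed
qed

section \<open>Eigenvectors and the test form\<close>

lemma second_fund_form_linear:
  "second_fund_form \<rho> p (x + y) \<eta> = second_fund_form \<rho> p x \<eta> + second_fund_form \<rho> p y \<eta>"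
  "second_fund_form \<rho> p (c *\<^sub>R x) \<eta> = c * second_fund_form \<rho> p x \<eta>"
  unfolding second_fund_form_def
  by (simp_all add: algebra_simps sum.distrib sum_distrib_left)

lemma second_fund_form_commute:
  assumes "smooth \<rho>"
  shows "second_fund_form \<rho> p \<xi> \<eta> = second_fund_form \<rho> p \<eta> \<xi>"
  unfolding second_fund_form_def
  by (subst sum.swap) (simp add: partial_commute[OF assms] mult_ac)

lemma subspace_sff_eigenspace: "subspace (sff_eigenspace \<rho> p \<mu>)"
proof -
  have "second_fund_form \<rho> p 0 \<eta> = 0" for \<eta>
    using second_fund_form_linear(2)[of \<rho> p 0 0 \<eta>] by simp
  then show ?thesis
    unfolding subspace_def sff_eigenspace_def tangent_space_def
    by (auto simp: second_fund_form_linear inner_add_left inner_add_right algebra_simps)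
qed

lemma sff_eigenspaces_orthogonal:
  assumes "smooth \<rho>" "\<xi> \<in> sff_eigenspace \<rho> p \<mu>" "\<eta> \<in> sff_eigenspace \<rho> p \<mu>'" "\<mu> \<noteq> \<mu>'"
  shows "\<xi> \<bullet> \<eta> = 0"
proof -
  have "second_fund_form \<rho> p \<xi> \<eta> = \<mu> * (\<xi> \<bullet> \<eta>)" "second_fund_form \<rho> p \<eta> \<xi> = \<mu>' * (\<eta> \<bullet> \<xi>)"
    using assms(2,3) by (auto simp: sff_eigenspace_def)
  then show ?thesis
    using second_fund_form_commute[OF assms(1), of p \<xi> \<eta>] assms(4) by (simp add: inner_commute)
qed

text \<open>Each new copy of \<mu> finds fewer vectors already chosen in its eigenspace than the
  dimension, so a unit vector orthogonal to them remains. Vectors from other eigenspaces are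
  orthogonal by symmetry of the form.\<close>

lemma orthonormal_eigenvectors:
  assumes "smooth \<rho>" "\<And>\<mu>. count M \<mu> \<le> dim (sff_eigenspace \<rho> p \<mu>)"
  shows "\<exists>xs. mset (map fst xs) = M \<and> sorted_wrt (\<lambda>a b. snd a \<bullet> snd b = 0) xs \<and>
    (\<forall>(\<mu>, \<xi>)\<in>set xs. \<xi> \<in> sff_eigenspace \<rho> p \<mu> \<and> norm \<xi> = 1)"
  using assms(2)
proof (induction M)
  case empty
  show ?case by (intro exI[of _ "[]"]) simp
next
  case (add \<mu> M)
  have "count M \<kappa> \<le> dim (sff_eigenspace \<rho> p \<kappa>)" for \<kappa>
    using add.prems[of \<kappa>] by (simp split: if_splits)
  then obtain xs where xs: "mset (map fst xs) = M" "sorted_wrt (\<lambda>a b. snd a \<bullet> snd b = 0) xs"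
      "\<And>\<kappa> \<xi>. (\<kappa>, \<xi>) \<in> set xs \<Longrightarrow> \<xi> \<in> sff_eigenspace \<rho> p \<kappa> \<and> norm \<xi> = 1"
    using add.IH by blast
  let ?E = "sff_eigenspace \<rho> p \<mu>"
  define S where "S = snd ` set (filter (\<lambda>a. fst a = \<mu>) xs)"
  have "S \<subseteq> ?E" using xs(3) by (auto simp: S_def)
  have E: "span ?E = ?E" by (simp add: subspace_sff_eigenspace)
  have "card S \<le> length (filter (\<lambda>a. fst a = \<mu>) xs)"
    unfolding S_def by (rule order_trans[OF card_image_le card_length]) simp
  also have "\<dots> = count M \<mu>"
    unfolding xs(1)[symmetric] by (induction xs) auto
  also have "\<dots> < dim ?E" using add.prems[of \<mu>] by simp
  finally have "dim S < dim ?E"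
    using dim_le_card'[of S] by (simp add: S_def)
  then have "span S \<noteq> span ?E" by (metis dim_span less_irrefl)
  moreover have "span S \<subseteq> span ?E" using \<open>S \<subseteq> ?E\<close> by (rule span_mono)
  ultimately have "span S \<subset> span ?E" by blast
  then obtain z where z: "z \<noteq> 0" "z \<in> ?E" "\<And>y. y \<in> span S \<Longrightarrow> orthogonal z y"
    using orthogonal_to_subspace_exists_gen[of S ?E] unfolding E by blast
  define \<xi> where "\<xi> = (1 / norm z) *\<^sub>R z"
  have \<xi>: "\<xi> \<in> ?E" "norm \<xi> = 1"
    using z subspace_scale[OF subspace_sff_eigenspace] by (auto simp: \<xi>_def)
  have "\<xi> \<bullet> \<eta> = 0" if "(\<kappa>, \<eta>) \<in> set xs" for \<kappa> \<eta>
  proof (cases "\<kappa> = \<mu>")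
    case True
    then have "\<eta> \<in> S" using that by (force simp: S_def)
    then show ?thesis using z(3)[OF span_base] by (simp add: \<xi>_def orthogonal_def)
  next
    case False
    then show ?thesis using sff_eigenspaces_orthogonal[OF assms(1) \<xi>(1)] xs(3)[OF that] by metis
  qed
  then show ?case
    using xs \<xi> by (intro exI[of _ "(\<mu>, \<xi>) # xs"]) auto
qed

text \<open>\<open>\<xi> \<bullet> x\<close> corrected to have vanishing normal derivative along the boundary.\<close>

definition neumann_coord :: "(real ^ 'n::finite \<Rightarrow> real) \<Rightarrow> real ^ 'n \<Rightarrow> real ^ 'n \<Rightarrow> real"
  where "neumann_coord \<rho> \<xi> x = \<xi> \<bullet> x - \<rho> x * (grad \<rho> x \<bullet> \<xi>)"

lemma smooth_inner: "smooth (\<lambda>x. \<xi> \<bullet> x)"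
  unfolding inner_vec_def inner_real_def by (intro smooth_sum smooth_mult smooth_const smooth_component)

lemma smooth_neumann_coord: "smooth \<rho> \<Longrightarrow> smooth (neumann_coord \<rho> \<xi>)"
  unfolding neumann_coord_def[abs_def] by (intro smooth_diff smooth_mult smooth_inner smooth_inner_grad)

lemma partial_inner: "partial i (\<lambda>x. \<xi> \<bullet> x) x = \<xi> $ i"
  by (subst partialI[OF bounded_linear_imp_has_derivative[OF bounded_linear_inner_right]]) (simp add: inner_axis)

lemma partial_neumann_coord:
  assumes "smooth \<rho>"
  shows "partial i (neumann_coord \<rho> \<xi>) x = \<xi> $ i
    - (partial i \<rho> x * (grad \<rho> x \<bullet> \<xi>) + \<rho> x * partial i (\<lambda>x. grad \<rho> x \<bullet> \<xi>) x)"
  unfolding neumann_coord_def[abs_def]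
  by (simp add: partial_diff partial_mult partial_inner smooth_inner smooth_inner_grad smooth_mult smooth_differentiable assms)

text \<open>On the boundary the normal derivative of the correction is |\<nabla>\<rho>|^2
  (\<nabla>\<rho> \<bullet> \<xi>), and the normalization of \<rho> makes it equal to that of \<xi>
  \<bullet> x. One fixed \<xi> thus serves all boundary points.\<close>

lemma neumann_coord_normal_derivative:
  assumes "smooth \<rho>" "\<rho> x = 0" "norm (grad \<rho> x) = 1"
  shows "(\<Sum>j\<in>UNIV. partial j \<rho> x * partial j (neumann_coord \<rho> \<xi>) x) = 0"
proof -
  have "(\<Sum>j\<in>UNIV. partial j \<rho> x * partial j (neumann_coord \<rho> \<xi>) x)
      = grad \<rho> x \<bullet> \<xi> - (grad \<rho> x \<bullet> grad \<rho> x) * (grad \<rho> x \<bullet> \<xi>)"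
    unfolding partial_neumann_coord[OF assms(1)] assms(2)
    by (simp add: inner_vec_def grad_def right_diff_distrib sum_subtractf sum_distrib_right mult.assoc)
  then show ?thesis using assms(3) by (simp add: norm_eq_1)
qed

lemma grad_neumann_coord:
  assumes "smooth \<rho>" "\<rho> x = 0" "\<xi> \<in> tangent_space \<rho> x"
  shows "grad (neumann_coord \<rho> \<xi>) x = \<xi>"
  using assms by (simp add: vec_eq_iff grad_def[of "neumann_coord \<rho> \<xi>"] partial_neumann_coord tangent_space_def)

text \<open>Both factors of the correction vanish at \<open>x\<close>, so its Hessian is the sum of
  the two cross products of first derivatives. Pairing with the tangent vector \<xi> kills one; the
  other yields the second fundamental form times the normal.\<close>

lemma hess_neumann_coord:
  assumes "smooth \<rho>" "\<rho> x = 0" "\<xi> \<in> tangent_space \<rho> x"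
  shows "(\<Sum>j\<in>UNIV. partial m (partial j (neumann_coord \<rho> \<xi>)) x * \<xi> $ j)
    = - second_fund_form \<rho> x \<xi> \<xi> * grad \<rho> x $ m"
proof -
  let ?A = "\<lambda>j. partial j (\<lambda>x. grad \<rho> x \<bullet> \<xi>) x"
  have t: "grad \<rho> x \<bullet> \<xi> = 0" using assms(3) by (simp add: tangent_space_def)
  have A: "?A j = (\<Sum>k\<in>UNIV. partial j (partial k \<rho>) x * \<xi> $ k)" for j
  proof -
    have "?A j = (\<Sum>k\<in>UNIV. partial j (\<lambda>x. partial k \<rho> x * \<xi> $ k) x)"
      unfolding inner_vec_def grad_def inner_real_def vec_lambda_beta
      by (rule partial_sum) (intro smooth_mult smooth_partial smooth_const assms(1))
    then show ?thesis
      by (simp add: partial_mult smooth_differentiable smooth_partial assms(1) partial_const)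
  qed
  have p: "partial j (neumann_coord \<rho> \<xi>) = (\<lambda>x. \<xi> $ j
    - (partial j \<rho> x * (grad \<rho> x \<bullet> \<xi>) + \<rho> x * partial j (\<lambda>x. grad \<rho> x \<bullet> \<xi>) x))" for j
    by (rule ext) (rule partial_neumann_coord[OF assms(1)])
  have hess: "partial m (partial j (neumann_coord \<rho> \<xi>)) x = - (partial j \<rho> x * ?A m + partial m \<rho> x * ?A j)" for j
    unfolding p
    by (simp add: partial_diff partial_add partial_mult partial_const smooth_differentiable smooth_partial
        smooth_inner_grad smooth_mult smooth_add assms(1) t assms(2))
  have "(\<Sum>j\<in>UNIV. partial m (partial j (neumann_coord \<rho> \<xi>)) x * \<xi> $ j)
     = (\<Sum>j\<in>UNIV. - (partial j \<rho> x * \<xi> $ j * ?A m) - partial m \<rho> x * (?A j * \<xi> $ j))"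
    unfolding hess by (intro sum.cong refl) (simp add: algebra_simps)
  also have "\<dots> = - (\<Sum>j\<in>UNIV. partial j \<rho> x * \<xi> $ j) * ?A m - partial m \<rho> x * (\<Sum>j\<in>UNIV. ?A j * \<xi> $ j)"
    by (simp add: sum_negf sum_distrib_left sum_distrib_right sum_subtractf)
  also have "(\<Sum>j\<in>UNIV. partial j \<rho> x * \<xi> $ j) = 0"
    using t by (simp add: inner_vec_def grad_def)
  also have "(\<Sum>j\<in>UNIV. ?A j * \<xi> $ j) = second_fund_form \<rho> x \<xi> \<xi>"
    unfolding A second_fund_form_def by (simp add: sum_distrib_left mult_ac)
  finally show ?thesis by (simp add: grad_def)
qed

section \<open>The integral inequality behind the estimate, and the conclusion\<close>

lemma smooth_forms_UNIV:
  assumes "\<And>x. f x \<in> covectors q" "\<And>I. smooth (\<lambda>x. f x I)"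
  shows "f \<in> smooth_forms q D"
  unfolding smooth_forms_def smooth_up_to_boundary_def using assms by blast

text \<open>From \<open>\<parallel>f\<parallel>\<^sup>2 = \<langle>u, d\<^sup>*f\<rangle>\<close> and the bound on \<open>u\<close> one gets \<open>2aq \<parallel>f\<parallel>\<^sup>2 \<le> \<parallel>d\<^sup>*f\<parallel>\<^sup>2 = \<langle>dd\<^sup>*f, f\<rangle>\<close>; the zeroth
  order term of \<open>dd\<^sup>*f\<close> is \<open>2aq f\<close> and cancels the left-hand side.\<close>

lemma L2_estimate_consequence:
  fixes f :: "'n::{finite,linorder} form"
  assumes D: "bounded D" "smooth \<rho>" "D = {x. \<rho> x < 0}"
    and f: "\<And>x. f x \<in> covectors (Suc q)" "\<And>I. smooth (\<lambda>x. f x I)" "\<And>x J. smooth_d f x J = 0"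
    and C: "\<And>x K. x \<in> D \<Longrightarrow> K \<in> incr_indices q \<Longrightarrow> \<bar>contract (\<lambda>j. partial j \<rho> x) (f x) K\<bar> \<le> C * \<bar>\<rho> x\<bar>"
    and a: "0 < a" and \<phi>: "\<phi> = (\<lambda>x. a * (norm (x - p))\<^sup>2 - 1)"
    and solve: "f \<in> smooth_forms (Suc q) D \<inter> dom_d_adj (Suc q) D \<phi> \<Longrightarrow> ext_d (Suc q + 1) D \<phi> f (\<lambda>x I. 0) \<Longrightarrow>
      \<exists>u \<in> L2_forms q D \<phi>. ext_d (Suc q) D \<phi> u f \<and>
        L2_inner q D \<phi> u u \<le> L2_inner (Suc q) D \<phi> (\<lambda>x. hess_inv (Suc q) \<phi> x (f x)) f"
  shows "0 \<le> (LINT x:D|lebesgue. (2 * a * (\<Sum>i\<in>UNIV. (x - p) $ i * cov_inner (Suc q) (f x) (\<lambda>I. partial i (\<lambda>x. f x I) x))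
      - (\<Sum>i\<in>UNIV. cov_inner (Suc q) (f x) (\<lambda>I. partial i (partial i (\<lambda>x. f x I)) x))) * exp (- (a * (norm (x - p))\<^sup>2 - 1)))"
proof -
  have "open D" using sublevel_open D by blast
  have smooth_\<phi>: "smooth \<phi>"
    unfolding \<phi> power2_norm_eq_inner inner_vec_def inner_real_def vector_minus_component
    by (intro smooth_diff smooth_mult smooth_sum smooth_const smooth_component)
  define \<beta> where "\<beta> = d_adj \<phi> f"
  have \<beta>: "\<And>x. \<beta> x \<in> covectors q" "\<And>K. smooth (\<lambda>x. \<beta> x K)"
    unfolding \<beta>_def by (intro d_adj_covectors f(1,2)) (intro smooth_d_adj f(2) smooth_\<phi>)
  have cov_d: "smooth_d g x \<in> covectors (Suc r)" if "\<And>x. g x \<in> covectors r" "\<And>I. smooth (\<lambda>x. g x I)" for g :: "'n form" and r x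
    unfolding smooth_d_def by (intro alt_sum_covectors covectors_partial that)
  \<comment> \<open>Serves three times: for membership in the domain of the adjoint, for the
    solution \<open>u\<close>, and for \<beta> with its classical derivative.\<close>
  have adj: "L2_inner (Suc q) D \<phi> v f = L2_inner q D \<phi> u \<beta>" if "ext_d (Suc q) D \<phi> u v" for u v
    unfolding \<beta>_def by (rule L2_inner_d_adj[OF D smooth_\<phi> f(1,2) C that])
  have fL: "f \<in> L2_forms (Suc q) D \<phi>" and \<beta>L: "\<beta> \<in> L2_forms q D \<phi>"
    using L2_forms_smooth[OF \<open>open D\<close> D(1) f(1,2) smooth_\<phi>] L2_forms_smooth[OF \<open>open D\<close> D(1) \<beta> smooth_\<phi>] by auto
  have "f \<in> smooth_forms (Suc q) D \<inter> dom_d_adj (Suc q) D \<phi>"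
    using smooth_forms_UNIV[OF f(1,2)] fL \<beta>L adj unfolding dom_d_adj_def by auto
  moreover have "ext_d (Suc q + 1) D \<phi> f (\<lambda>x I. 0)"
  proof -
    have "smooth_d f = (\<lambda>x I. 0)" using f(3) by (intro ext)
    then show ?thesis
      using ext_d_smooth[OF \<open>open D\<close> D(1) f(1,2) smooth_\<phi> cov_d[OF f(1,2)]] by simp
  qed
  ultimately obtain u where u: "u \<in> L2_forms q D \<phi>" "ext_d (Suc q) D \<phi> u f"
    "L2_inner q D \<phi> u u \<le> L2_inner (Suc q) D \<phi> (\<lambda>x. hess_inv (Suc q) \<phi> x (f x)) f"
    using solve by blast
  define s where "s = 2 * a * real (Suc q)"
  have s: "0 < s" using a by (simp add: s_def)
  have "L2_inner (Suc q) D \<phi> (\<lambda>x. hess_inv (Suc q) \<phi> x (f x)) f = 1 / s * L2_inner (Suc q) D \<phi> f f"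
    unfolding s_def by (rule L2_inner_hess_inv_quadratic[OF \<phi>]) (use a f(1) open_in_sets_lebesgue[OF \<open>open D\<close>] in auto)
  then have uu: "s * L2_inner q D \<phi> u u \<le> L2_inner (Suc q) D \<phi> f f"
    using mult_left_mono[OF u(3), of s] s by simp
  have int_uu: "set_integrable lebesgue D (\<lambda>x. cov_inner q (u x) (u x) * exp (- \<phi> x))"
    and int_\<beta>\<beta>: "set_integrable lebesgue D (\<lambda>x. cov_inner q (\<beta> x) (\<beta> x) * exp (- \<phi> x))"
    using u(1) \<beta>L by (auto simp: L2_forms_def)
  have int_u\<beta>: "set_integrable lebesgue D (\<lambda>x. cov_inner q (u x) (\<beta> x) * exp (- \<phi> x))"
  proof -
    have "set_integrable lebesgue D (\<lambda>x. \<Sum>K\<in>incr_indices q. u x K * (\<beta> x K * exp (- \<phi> x)))"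
      by (intro set_integral_sum(1) set_integrable_mult_smooth L2_forms_set_integrable[OF \<open>open D\<close> D(1) u(1) smooth_\<phi>]
          \<open>open D\<close> D(1) smooth_mult \<beta>(2) smooth_exp smooth_minus smooth_\<phi>)
    then show ?thesis by (simp add: cov_inner_def sum_distrib_right mult.assoc)
  qed
  \<comment> \<open>The weighted integral of |s u - \<beta>|^2 is nonnegative. The factor
    \<open>s\<close> is such that the bound on \<open>u\<close> turns the first term on the right
    into \<open>s\<close> times the squared norm of \<open>f\<close>, half of the left-hand
    side.\<close>
  have amgm: "2 * s * L2_inner q D \<phi> u \<beta> \<le> s * (s * L2_inner q D \<phi> u u) + L2_inner q D \<phi> \<beta> \<beta>"
  proof -
    have "0 \<le> (LINT x:D|lebesgue. (s * s) * (cov_inner q (u x) (u x) * exp (- \<phi> x)) - (2 * s) * (cov_inner q (u x) (\<beta> x) * exp (- \<phi> x))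
        + cov_inner q (\<beta> x) (\<beta> x) * exp (- \<phi> x))"
      unfolding set_lebesgue_integral_def
    proof (rule integral_nonneg_AE, rule AE_I2)
      fix x
      have "0 \<le> (\<Sum>K\<in>incr_indices q. (s * u x K - \<beta> x K)\<^sup>2) * exp (- \<phi> x)"
        by (intro mult_nonneg_nonneg sum_nonneg) auto
      also have "\<dots> = (s * s) * (cov_inner q (u x) (u x) * exp (- \<phi> x)) - (2 * s) * (cov_inner q (u x) (\<beta> x) * exp (- \<phi> x))
        + cov_inner q (\<beta> x) (\<beta> x) * exp (- \<phi> x)"
        unfolding cov_inner_def
        by (simp add: power2_diff sum.distrib sum_subtractf sum_distrib_left sum_distrib_right power2_eq_square algebra_simps)
      finally show "0 \<le> indicat_real D x *\<^sub>R ((s * s) * (cov_inner q (u x) (u x) * exp (- \<phi> x)) - (2 * s) * (cov_inner q (u x) (\<beta> x) * exp (- \<phi> x))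
        + cov_inner q (\<beta> x) (\<beta> x) * exp (- \<phi> x))" by simp
    qed
    also have "\<dots> = (s * s) * L2_inner q D \<phi> u u - (2 * s) * L2_inner q D \<phi> u \<beta> + L2_inner q D \<phi> \<beta> \<beta>"
      unfolding L2_inner_def
      by (simp only: set_integral_add(2) set_integral_diff set_integrable_mult_right int_uu int_u\<beta> int_\<beta>\<beta> set_integral_mult_right)
    finally show ?thesis by (simp add: mult.assoc)
  qed
  have "L2_inner (Suc q) D \<phi> f f = L2_inner q D \<phi> u \<beta>" by (rule adj[OF u(2)])
  then have "2 * s * L2_inner (Suc q) D \<phi> f f \<le> s * (s * L2_inner q D \<phi> u u) + L2_inner q D \<phi> \<beta> \<beta>"
    using amgm by (simp only:)
  also have "\<dots> \<le> s * L2_inner (Suc q) D \<phi> f f + L2_inner q D \<phi> \<beta> \<beta>"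
    using uu s by (intro add_right_mono mult_left_mono) auto
  finally have "2 * s * L2_inner (Suc q) D \<phi> f f \<le> s * L2_inner (Suc q) D \<phi> f f + L2_inner q D \<phi> \<beta> \<beta>" .
  then have main: "s * L2_inner (Suc q) D \<phi> f f \<le> L2_inner q D \<phi> \<beta> \<beta>" by simp
  \<comment> \<open>The second integration by parts moves d*, applied to \<open>f\<close>, back to d
    on \<beta>; the boundary condition is again that of \<open>f\<close>.\<close>
  have "L2_inner q D \<phi> \<beta> \<beta> = L2_inner (Suc q) D \<phi> (smooth_d \<beta>) f"
    by (rule adj[symmetric]) (rule ext_d_smooth[OF \<open>open D\<close> D(1) \<beta> smooth_\<phi> cov_d[OF \<beta>]])
  also have "\<dots> = (LINT x:D|lebesgue. s * (cov_inner (Suc q) (f x) (f x) * exp (- \<phi> x)) +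
      (2 * a * (\<Sum>i\<in>UNIV. (x - p) $ i * cov_inner (Suc q) (f x) (\<lambda>I. partial i (\<lambda>x. f x I) x))
      - (\<Sum>i\<in>UNIV. cov_inner (Suc q) (f x) (\<lambda>I. partial i (partial i (\<lambda>x. f x I)) x))) * exp (- \<phi> x))"
  proof -
    have "cov_inner (Suc q) (smooth_d \<beta> x) (f x) = s * cov_inner (Suc q) (f x) (f x)
      + 2 * a * (\<Sum>i\<in>UNIV. (x - p) $ i * cov_inner (Suc q) (f x) (\<lambda>I. partial i (\<lambda>x. f x I) x))
      - (\<Sum>i\<in>UNIV. cov_inner (Suc q) (f x) (\<lambda>I. partial i (partial i (\<lambda>x. f x I)) x))" for x
    proof -
      have "smooth_d \<beta> x J = s * f x J + (\<Sum>i\<in>UNIV. 2 * a * (x - p) $ i * partial i (\<lambda>x. f x J) x)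
          - (\<Sum>i\<in>UNIV. partial i (partial i (\<lambda>x. f x J)) x)" if "J \<in> incr_indices (Suc q)" for J
      proof -
        have "length J = Suc q" using that by (simp add: incr_indices_def)
        moreover have "partial i (partial j \<phi>) x = (if i = j then 2 * a else 0)" for i j
          unfolding \<phi> by (rule partial_partial_quadratic)
        moreover have "partial i \<phi> x = 2 * a * (x - p) $ i" for i
          unfolding \<phi> partial_quadratic ..
        ultimately show ?thesis
          using smooth_d_d_adj[OF f smooth_\<phi>, of x "2 * a" J] by (simp add: \<beta>_def s_def)
      qed
      then have "cov_inner (Suc q) (smooth_d \<beta> x) (f x) = (\<Sum>J\<in>incr_indices (Suc q). (s * f x J + (\<Sum>i\<in>UNIV. 2 * a * (x - p) $ i * partial i (\<lambda>x. f x J) x)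
          - (\<Sum>i\<in>UNIV. partial i (partial i (\<lambda>x. f x J)) x)) * f x J)"
        unfolding cov_inner_def by (intro sum.cong) auto
      also have "\<dots> = s * cov_inner (Suc q) (f x) (f x) + (\<Sum>J\<in>incr_indices (Suc q). \<Sum>i\<in>UNIV. 2 * a * (x - p) $ i * (f x J * partial i (\<lambda>x. f x J) x))
          - (\<Sum>J\<in>incr_indices (Suc q). \<Sum>i\<in>UNIV. f x J * partial i (partial i (\<lambda>x. f x J)) x)"
      proof -
        have "(s * F + (\<Sum>i\<in>UNIV. k i * d i) - (\<Sum>i\<in>UNIV. e i)) * F
            = s * (F * F) + (\<Sum>i\<in>UNIV. k i * (F * d i)) - (\<Sum>i\<in>UNIV. F * e i)"
          for F and k d e :: "'n \<Rightarrow> real"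
          by (simp add: left_diff_distrib distrib_right sum_distrib_right) (simp add: mult_ac)
        then show ?thesis
          by (simp only: cov_inner_def sum.distrib sum_subtractf sum_distrib_left)
      qed
      also have "(\<Sum>J\<in>incr_indices (Suc q). \<Sum>i\<in>UNIV. 2 * a * (x - p) $ i * (f x J * partial i (\<lambda>x. f x J) x))
          = 2 * a * (\<Sum>i\<in>UNIV. (x - p) $ i * cov_inner (Suc q) (f x) (\<lambda>I. partial i (\<lambda>x. f x I) x))"
        unfolding cov_inner_def by (subst sum.swap) (simp add: sum_distrib_left mult.assoc)
      also have "(\<Sum>J\<in>incr_indices (Suc q). \<Sum>i\<in>UNIV. f x J * partial i (partial i (\<lambda>x. f x J)) x)
          = (\<Sum>i\<in>UNIV. cov_inner (Suc q) (f x) (\<lambda>I. partial i (partial i (\<lambda>x. f x I)) x))"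
        unfolding cov_inner_def by (rule sum.swap)
      finally show ?thesis .
    qed
    then show ?thesis
      unfolding L2_inner_def by (simp only: distrib_right left_diff_distrib mult.assoc add_diff_eq)
  qed
  also have "\<dots> = s * L2_inner (Suc q) D \<phi> f f + (LINT x:D|lebesgue.
      (2 * a * (\<Sum>i\<in>UNIV. (x - p) $ i * cov_inner (Suc q) (f x) (\<lambda>I. partial i (\<lambda>x. f x I) x))
      - (\<Sum>i\<in>UNIV. cov_inner (Suc q) (f x) (\<lambda>I. partial i (partial i (\<lambda>x. f x I)) x))) * exp (- \<phi> x))"
    unfolding L2_inner_def set_integral_mult_right[symmetric]
    by (rule set_integral_add(2); rule set_integrable_smooth[OF \<open>open D\<close> D(1)]; unfold cov_inner_def vector_minus_component)
       (intro smooth_mult smooth_diff smooth_sum smooth_const smooth_component smooth_partial f(2) smooth_exp smooth_minus smooth_\<phi>)+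
  finally show ?thesis using main unfolding \<phi> by simp
qed

theorem theorem1p3:
  fixes D :: "(real ^ 'n::{finite,linorder}) set" and q :: nat
  assumes "smooth_bounded_domain D"
    and "1 \<le> q" and "q \<le> CARD('n) - 1"
    and "\<And>a b x0 \<phi> f.
      a > 0 \<Longrightarrow> b > 0 \<Longrightarrow> \<phi> = (\<lambda>x. a * (norm (x - x0))\<^sup>2 - b) \<Longrightarrow>
      f \<in> smooth_forms q D \<inter> dom_d_adj q D \<phi> \<Longrightarrow> ext_d (q + 1) D \<phi> f (\<lambda>x I. 0) \<Longrightarrow>
      \<exists>u \<in> L2_forms (q - 1) D \<phi>. ext_d q D \<phi> u f \<and>
        (LINT x:D|lebesgue. cov_inner (q - 1) (u x) (u x) * exp (- \<phi> x))
        \<le> (LINT x:D|lebesgue. cov_inner q (hess_inv q \<phi> x (f x)) (f x) * exp (- \<phi> x))"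
  shows "q_convex q D"
  unfolding q_convex_def
proof (intro allI impI ballI)
  fix \<rho> p and M :: "real multiset"
  assume "defining_function D \<rho>" and p: "p \<in> frontier D"
    and M: "size M = q \<and> (\<forall>\<mu>. count M \<mu> \<le> dim (sff_eigenspace \<rho> p \<mu>))"
  then have D: "bounded D" "smooth \<rho>" "D = {x. \<rho> x < 0}" and unit: "\<And>p. p \<in> frontier D \<Longrightarrow> norm (grad \<rho> p) = 1"
    using assms(1) by (auto simp: defining_function_def smooth_bounded_domain_def)
  have zero: "\<rho> x = 0" if "x \<in> frontier D" for x
    by (rule defining_function_zero_on_frontier[OF D(2,3) that])
  obtain xs where xs: "mset (map fst xs) = M" "sorted_wrt (\<lambda>a b. snd a \<bullet> snd b = 0) xs"
      "\<And>\<mu> \<xi>. (\<mu>, \<xi>) \<in> set xs \<Longrightarrow> \<xi> \<in> sff_eigenspace \<rho> p \<mu> \<and> norm \<xi> = 1"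
    using orthonormal_eigenvectors[OF D(2), of M p] M by blast
  have tangent: "\<xi> \<in> tangent_space \<rho> p" "second_fund_form \<rho> p \<xi> \<xi> = \<mu>" if "(\<mu>, \<xi>) \<in> set xs" for \<mu> \<xi>
    using xs(3)[OF that] by (auto simp: sff_eigenspace_def norm_eq_1)
  define hs where "hs = map (\<lambda>a. neumann_coord \<rho> (snd a)) xs"
  have hs: "\<And>h. h \<in> set hs \<Longrightarrow> smooth h"
    by (auto simp: hs_def intro: smooth_neumann_coord D)
  have len: "length hs = q"
    using xs(1) M by (auto simp: hs_def)
  obtain r where q: "q = Suc r" using assms(2) by (cases q) auto
  define f where "f = wedge_d hs"
  have f: "\<And>x. f x \<in> covectors (Suc r)" "\<And>I. smooth (\<lambda>x. f x I)" "\<And>x J. smooth_d f x J = 0"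
    using wedge_d_covectors[of hs] smooth_wedge_d[OF hs] wedge_d_closed[OF hs] by (auto simp: f_def len q)
  have "\<exists>C\<ge>0. \<forall>x\<in>D. \<bar>contract (\<lambda>j. partial j \<rho> x) (f x) K\<bar> \<le> C * \<bar>\<rho> x\<bar>" for K
  proof (rule boundary_bound[OF D unit])
    show "smooth (\<lambda>x. contract (\<lambda>j. partial j \<rho> x) (f x) K)"
      unfolding contract_def by (intro smooth_sum smooth_mult smooth_partial D(2) f(2))
    show "contract (\<lambda>j. partial j \<rho> x) (f x) K = 0" if "x \<in> frontier D" for x
      unfolding f_def using neumann_coord_normal_derivative[OF D(2) zero[OF that] unit[OF that]]
      by (intro contract_wedge_d) (auto simp: hs_def)
  qed
  then obtain C where C: "\<And>K. 0 \<le> C K" "\<And>K x. x \<in> D \<Longrightarrow> \<bar>contract (\<lambda>j. partial j \<rho> x) (f x) K\<bar> \<le> C K * \<bar>\<rho> x\<bar>"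
    by metis
  \<comment> \<open>One constant for all multi-indices: the sum of finitely many nonnegative
    constants dominates each.\<close>
  have C': "\<bar>contract (\<lambda>j. partial j \<rho> x) (f x) K\<bar> \<le> (\<Sum>K\<in>incr_indices r. C K) * \<bar>\<rho> x\<bar>"
    if "x \<in> D" "K \<in> incr_indices r" for x K
    by (rule order_trans[OF C(2)[OF that(1)]]) (intro mult_right_mono member_le_sum; use that C(1) in simp)
  define W where "W = (\<lambda>i x. cov_inner (Suc r) (f x) (\<lambda>I. partial i (\<lambda>x. f x I) x))"
  define c where "c = (\<lambda>x. \<Sum>i\<in>UNIV. cov_inner (Suc r) (f x) (\<lambda>I. partial i (partial i (\<lambda>x. f x I)) x))"
  have smooth_W: "smooth (W i)" for i
    unfolding W_def cov_inner_def by (intro smooth_sum smooth_mult smooth_partial f(2))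
  have smooth_c: "smooth c"
    unfolding c_def cov_inner_def by (intro smooth_sum smooth_mult smooth_partial f(2))
  \<comment> \<open>\<open>full_inner_wedge_d\<close> applies at \<open>p\<close> because the
    gradients of the corrected coordinates are there the orthonormal eigenvectors; each Hessian term
    is \<open>- \<mu>\<close> times the normal, and the factorials cancel.\<close>
  have W: "W i p = - (\<Sum>\<^sub># M) * grad \<rho> p $ i" for i
  proof -
    have g: "grad h p = \<xi>" if "(\<mu>, \<xi>) \<in> set xs" "h = neumann_coord \<rho> \<xi>" for \<mu> \<xi> h
      unfolding that(2) by (rule grad_neumann_coord[OF D(2) zero[OF p] tangent(1)[OF that(1)]])
    have "full_inner (length hs) (f p) (\<lambda>I. partial i (\<lambda>x. f x I) p)
      = fact (length hs) * (\<Sum>h\<leftarrow>hs. \<Sum>j\<in>UNIV. partial i (partial j h) p * partial j h p)"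
      unfolding f_def
    proof (rule full_inner_wedge_d(2)[OF hs])
      show "norm (grad h p) = 1" if "h \<in> set hs" for h
        using that xs(3) g by (force simp: hs_def)
      show "sorted_wrt (\<lambda>h h'. grad h p \<bullet> grad h' p = 0) hs"
        unfolding hs_def sorted_wrt_map
        by (rule sorted_wrt_mono_rel[OF _ xs(2)]) (use g in auto)
    qed
    moreover have "full_inner (length hs) (f p) (\<lambda>I. partial i (\<lambda>x. f x I) p) = fact (length hs) * W i p"
      unfolding W_def len q by (intro full_inner_cov_inner covectors_partial f)
    ultimately have "W i p = (\<Sum>h\<leftarrow>hs. \<Sum>j\<in>UNIV. partial i (partial j h) p * partial j h p)" by simp
    also have "\<dots> = (\<Sum>a\<leftarrow>xs. - fst a * grad \<rho> p $ i)"
      unfolding hs_def map_map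
    proof (rule arg_cong[where f = sum_list], rule map_cong[OF refl])
      fix a assume "a \<in> set xs"
      then have a: "(fst a, snd a) \<in> set xs" by simp
      have "partial j (neumann_coord \<rho> (snd a)) p = snd a $ j" for j
        using g[OF a refl] by (simp add: grad_def vec_eq_iff)
      then show "((\<lambda>h. \<Sum>j\<in>UNIV. partial i (partial j h) p * partial j h p) \<circ> (\<lambda>a. neumann_coord \<rho> (snd a))) a
          = - fst a * grad \<rho> p $ i"
        using hess_neumann_coord[OF D(2) zero[OF p] tangent(1)[OF a]] tangent(2)[OF a] by simp
    qed
    also have "\<dots> = - (\<Sum>a\<leftarrow>xs. fst a) * grad \<rho> p $ i"
      by (induction xs) (auto simp: algebra_simps)
    also have "(\<Sum>a\<leftarrow>xs. fst a) = \<Sum>\<^sub># M"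
      unfolding xs(1)[symmetric] by (simp only: sum_mset_sum_list)
    finally show ?thesis .
  qed
  have "- (\<Sum>\<^sub># M) \<le> 0"
  \<comment> \<open>Here \<open>S\<close> is minus the sum of the eigenvalues. The weights are
    centred at \<open>p\<close> with b = 1; the choice of b only rescales the measure.\<close>
  proof (rule blow_up_nonneg[OF D zero[OF p] _ smooth_W smooth_c W])
    show "grad \<rho> p \<noteq> 0" using unit[OF p] by force
    fix a :: real assume a: "0 < a"
    show "0 \<le> (LINT x:D|lebesgue. (2 * a * (\<Sum>i\<in>UNIV. (x - p) $ i * W i x) - c x) * exp (- (a * (norm (x - p))\<^sup>2 - 1)))"
      unfolding W_def c_def
    proof (rule L2_estimate_consequence[OF D f C' a refl])
      let ?\<phi> = "\<lambda>x. a * (norm (x - p))\<^sup>2 - 1"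
      assume "f \<in> smooth_forms (Suc r) D \<inter> dom_d_adj (Suc r) D ?\<phi>" "ext_d (Suc r + 1) D ?\<phi> f (\<lambda>x I. 0)"
      then show "\<exists>u \<in> L2_forms r D ?\<phi>. ext_d (Suc r) D ?\<phi> u f \<and>
        L2_inner r D ?\<phi> u u \<le> L2_inner (Suc r) D ?\<phi> (\<lambda>x. hess_inv (Suc r) ?\<phi> x (f x)) f"
        using assms(4)[OF a zero_less_one, of ?\<phi> p f] unfolding q L2_inner_def by simp
    qed
  qed
  then show "0 \<le> \<Sum>\<^sub># M" by simp
qed

end
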